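(* Let $(M,\bar h,J,\bar\xi)$, $\dim M=2n\ge 4$, be a rotational hypersurface of type III in $\mathbb C^n\times\mathbb R$ and assume that $$t(s)>0,\qquad t'(s)\le -1,\qquad s\in I .$$ Then the Kähler metric $$g=\bar h+(1-t')(\bar\eta\otimes\bar\eta+\tilde{\bar\eta}\otimes\tilde{\bar\eta})$$ is of quasi-constant holomorphic sectional curvatures with functions $$a<0,\qquad a+k^2<0 .$$
   Context: Rotational hypersurfaces of type III: let $(\mathbb C^n,h',J_0)$ be the flat Kähler-Lorentz space with standard complex structure $J_0$ and $h'(\mathbf Z,\mathbf Z)=|z^1|^2+\dots+|z^{n-1}|^2-|z^n|^2$, and let $\mathbb R$ be spanned by $\mathbf e$ with $\mathbf e^2=+1$; the product metric on $\mathbb C^n\times\mathbb R$ is also denoted $h'$. For smooth functions $t(s)>0$, $q(s)$ on an interval $I$, the rotational hypersurface $M$ (with no common points with the axis $\mathbb R\mathbf e$) consists of the points $\mathbf Z=t(s)\mathbf n+q(s)\mathbf e$, $s\in I$, $\mathbf n\in\mathbb C^n$ with $h'(\mathbf n,\mathbf n)=-1$; its meridian is $\gamma:\mathbf z(s)=t(s)\mathbf n+q(s)\mathbf e$ ($\mathbf n$ fixed). $M$ is of type III if its normals are space-like; the meridian is then time-like and $s$ is taken to be a natural parameter, $-t'^2+q'^2=-1$. Structures on $M$: $\bar h$ is the induced metric, of signature $(2(n-1),2)$; $\bar\xi=\partial\mathbf Z/\partial s=t'\mathbf n+q'\mathbf e$; $\tilde{\bar\xi}=J_0\mathbf n$;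 $\bar\eta=\bar h(\bar\xi,\cdot)$, $\tilde{\bar\eta}=\bar h(\tilde{\bar\xi},\cdot)$; $D$ is the $\bar h$-orthogonal complement of $D^\perp=\mathrm{span}\{\bar\xi,\tilde{\bar\xi}\}$ in $TM$. The almost complex structure $J$ is defined by $J|_D=J_0$, $J\bar\xi=\tilde{\bar\xi}$, $J\tilde{\bar\xi}=-\bar\xi$. Further $\xi=\frac1{\sqrt{-t'}}\bar\xi$ is the $g$-unit vector field associated with $g$, and $D^\perp=\mathrm{span}\{\xi,J\xi\}$. $(M,g,J,D)$ is of quasi-constant holomorphic sectional curvatures if the $g$-sectional curvature of any $J$-invariant 2-plane $E\subset T_pM$ depends only on $p$ and on the ($g$-)angle between $E$ and $D^\perp(p)$. $a(p)$ is the holomorphic sectional curvature of $J$-invariant 2-planes contained in $D(p)$; $k$ is the function determined by $\nabla_{x_0}\xi=\frac k2x_0$ for $x_0\in D$, where $\nabla$ is the Levi-Civita connection of $g$. *)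

theory Defs
  imports "HOL-Analysis.Analysis"
begin

section \<open>Smooth maps, vector fields and connections on subsets of a Euclidean space\<close>

primrec Ck_on :: "nat \<Rightarrow> ('a::real_normed_vector \<Rightarrow> 'b::real_normed_vector) \<Rightarrow> 'a set \<Rightarrow> bool" where
  "Ck_on 0 f U \<longleftrightarrow> continuous_on U f"
| "Ck_on (Suc k) f U \<longleftrightarrow>
     (\<forall>x\<in>U. f differentiable (at x)) \<and> (\<forall>v. Ck_on k (\<lambda>x. frechet_derivative f (at x) v) U)"

text \<open>Intended for open \<open>U\<close>.\<close>

definition smooth_on :: "('a::real_normed_vector \<Rightarrow> 'b::real_normed_vector) \<Rightarrow> 'a set \<Rightarrow> bool" where
  "smooth_on f U \<longleftrightarrow> (\<forall>k. Ck_on k f U)"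

text \<open>Smoothness on an arbitrary subset \<open>M\<close> of a Euclidean space, by local smooth extensions;
  only the values of \<open>f\<close> on \<open>M\<close> matter.\<close>

definition smooth_map_on :: "('a::euclidean_space \<Rightarrow> 'b::euclidean_space) \<Rightarrow> 'a set \<Rightarrow> bool" where
  "smooth_map_on f M \<longleftrightarrow>
     (\<forall>p\<in>M. \<exists>U F. open U \<and> p \<in> U \<and> smooth_on F U \<and> (\<forall>x\<in>U \<inter> M. F x = f x))"

definition tangent_space :: "'a::euclidean_space set \<Rightarrow> 'a \<Rightarrow> 'a set" where
  "tangent_space M p =
     {v. \<exists>c \<epsilon>. \<epsilon> > 0 \<and> smooth_on c {-\<epsilon><..<\<epsilon>} \<and> c ` {-\<epsilon><..<\<epsilon>} \<subseteq> M \<and> c 0 = p \<and>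
           (c has_vector_derivative v) (at (0::real))}"

definition vector_fields :: "'a::euclidean_space set \<Rightarrow> ('a \<Rightarrow> 'a) set" where
  "vector_fields M = {X. smooth_map_on X M \<and> (\<forall>p\<in>M. X p \<in> tangent_space M p)}"

text \<open>The derivative of \<open>f\<close> at \<open>p \<in> M\<close> in direction \<open>v\<close>. The Frechet derivative within \<open>M\<close>
  depends only on \<open>f\<close> restricted to \<open>M\<close>; as a linear map on the ambient space it need not be
  unique, but its value at a tangent vector \<open>v\<close> is.\<close>

definition deriv_along :: "'a::euclidean_space set \<Rightarrow> ('a \<Rightarrow> 'b::euclidean_space) \<Rightarrow> 'a \<Rightarrow> 'a \<Rightarrow> 'b" where
  "deriv_along M f p v = frechet_derivative f (at p within M) v"

definition lie_bracket :: "'a::euclidean_space set \<Rightarrow> ('a \<Rightarrow> 'a) \<Rightarrow> ('a \<Rightarrow> 'a) \<Rightarrow> 'a \<Rightarrow> 'a" where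
  "lie_bracket M X Y = (\<lambda>p. deriv_along M Y p (X p) - deriv_along M X p (Y p))"

text \<open>Tensors on \<open>M\<close> are families indexed by the base point; only their values at points of \<open>M\<close>
  and on tangent vectors are relevant.\<close>

definition riemannian_metric ::
  "'a::euclidean_space set \<Rightarrow> ('a \<Rightarrow> 'a \<Rightarrow> 'a \<Rightarrow> real) \<Rightarrow> bool" where
  "riemannian_metric M g \<longleftrightarrow>
     (\<forall>p\<in>M. \<forall>u\<in>tangent_space M p. \<forall>v\<in>tangent_space M p. \<forall>w\<in>tangent_space M p. \<forall>\<alpha> \<beta>.
        g p u v = g p v u \<and>
        g p (\<alpha> *\<^sub>R u + \<beta> *\<^sub>R v) w = \<alpha> * g p u w + \<beta> * g p v w) \<and>
     (\<forall>p\<in>M. \<forall>v\<in>tangent_space M p. v \<noteq> 0 \<longrightarrow> g p v v > 0) \<and>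
     (\<forall>X\<in>vector_fields M. \<forall>Y\<in>vector_fields M. smooth_map_on (\<lambda>p. g p (X p) (Y p)) M)"

definition affine_connection ::
  "'a::euclidean_space set \<Rightarrow> (('a \<Rightarrow> 'a) \<Rightarrow> ('a \<Rightarrow> 'a) \<Rightarrow> 'a \<Rightarrow> 'a) \<Rightarrow> bool" where
  "affine_connection M nabla \<longleftrightarrow>
     (\<forall>X\<in>vector_fields M. \<forall>Y\<in>vector_fields M. nabla X Y \<in> vector_fields M) \<and>
     (\<forall>X\<in>vector_fields M. \<forall>Y\<in>vector_fields M. \<forall>Z\<in>vector_fields M. \<forall>p\<in>M.
        nabla (\<lambda>x. X x + Y x) Z p = nabla X Z p + nabla Y Z p \<and>
        nabla X (\<lambda>x. Y x + Z x) p = nabla X Y p + nabla X Z p) \<and>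
     (\<forall>X\<in>vector_fields M. \<forall>Y\<in>vector_fields M. \<forall>f :: 'a \<Rightarrow> real. smooth_map_on f M \<longrightarrow> (\<forall>p\<in>M.
        nabla (\<lambda>x. f x *\<^sub>R X x) Y p = f p *\<^sub>R nabla X Y p \<and>
        nabla X (\<lambda>x. f x *\<^sub>R Y x) p = deriv_along M f p (X p) *\<^sub>R Y p + f p *\<^sub>R nabla X Y p))"

definition levi_civita ::
  "'a::euclidean_space set \<Rightarrow> ('a \<Rightarrow> 'a \<Rightarrow> 'a \<Rightarrow> real) \<Rightarrow>
   (('a \<Rightarrow> 'a) \<Rightarrow> ('a \<Rightarrow> 'a) \<Rightarrow> 'a \<Rightarrow> 'a) \<Rightarrow> bool" where
  "levi_civita M g nabla \<longleftrightarrow>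
     affine_connection M nabla \<and>
     (\<forall>X\<in>vector_fields M. \<forall>Y\<in>vector_fields M. \<forall>p\<in>M.
        nabla X Y p - nabla Y X p = lie_bracket M X Y p) \<and>
     (\<forall>X\<in>vector_fields M. \<forall>Y\<in>vector_fields M. \<forall>Z\<in>vector_fields M. \<forall>p\<in>M.
        deriv_along M (\<lambda>x. g x (Y x) (Z x)) p (X p) =
          g p (nabla X Y p) (Z p) + g p (Y p) (nabla X Z p))"

definition cov_deriv_at ::
  "'a::euclidean_space set \<Rightarrow> (('a \<Rightarrow> 'a) \<Rightarrow> ('a \<Rightarrow> 'a) \<Rightarrow> 'a \<Rightarrow> 'a) \<Rightarrow> 'a \<Rightarrow> 'a \<Rightarrow> ('a \<Rightarrow> 'a) \<Rightarrow> 'a" where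
  "cov_deriv_at M nabla p x Y =
     (THE w. \<forall>X\<in>vector_fields M. X p = x \<longrightarrow> nabla X Y p = w)"

definition curvature_op ::
  "'a::euclidean_space set \<Rightarrow> (('a \<Rightarrow> 'a) \<Rightarrow> ('a \<Rightarrow> 'a) \<Rightarrow> 'a \<Rightarrow> 'a) \<Rightarrow>
   ('a \<Rightarrow> 'a) \<Rightarrow> ('a \<Rightarrow> 'a) \<Rightarrow> ('a \<Rightarrow> 'a) \<Rightarrow> 'a \<Rightarrow> 'a" where
  "curvature_op M nabla X Y Z p =
     nabla X (nabla Y Z) p - nabla Y (nabla X Z) p - nabla (lie_bracket M X Y) Z p"

definition tangent_plane :: "'a::euclidean_space set \<Rightarrow> 'a \<Rightarrow> 'a set \<Rightarrow> bool" where
  "tangent_plane M p E \<longleftrightarrow> subspace E \<and> dim E = 2 \<and> E \<subseteq> tangent_space M p"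

definition sectional_curvature ::
  "'a::euclidean_space set \<Rightarrow> ('a \<Rightarrow> 'a \<Rightarrow> 'a \<Rightarrow> real) \<Rightarrow>
   (('a \<Rightarrow> 'a) \<Rightarrow> ('a \<Rightarrow> 'a) \<Rightarrow> 'a \<Rightarrow> 'a) \<Rightarrow> 'a \<Rightarrow> 'a set \<Rightarrow> real" where
  "sectional_curvature M g nabla p E =
     (THE \<kappa>. \<forall>X\<in>vector_fields M. \<forall>Y\<in>vector_fields M. span {X p, Y p} = E \<longrightarrow>
        \<kappa> = g p (curvature_op M nabla X Y Y p) (X p) /
            (g p (X p) (X p) * g p (Y p) (Y p) - (g p (X p) (Y p))\<^sup>2))"

text \<open>The angle between two subspaces is the least angle between nonzero vectors of them.
  For two planes invariant under an orthogonal complex structure, every nonzero vector of one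
  makes this same angle with the other plane.\<close>

definition subspace_angle ::
  "('a \<Rightarrow> 'a \<Rightarrow> 'a \<Rightarrow> real) \<Rightarrow> 'a \<Rightarrow> 'a::euclidean_space set \<Rightarrow> 'a set \<Rightarrow> real" where
  "subspace_angle g p E F =
     Inf {arccos (g p x y / (sqrt (g p x x) * sqrt (g p y y))) | x y.
            x \<in> E \<and> x \<noteq> 0 \<and> y \<in> F \<and> y \<noteq> 0}"

definition kaehler_metric ::
  "'a::euclidean_space set \<Rightarrow> ('a \<Rightarrow> 'a \<Rightarrow> 'a \<Rightarrow> real) \<Rightarrow> ('a \<Rightarrow> 'a \<Rightarrow> 'a) \<Rightarrow>
   (('a \<Rightarrow> 'a) \<Rightarrow> ('a \<Rightarrow> 'a) \<Rightarrow> 'a \<Rightarrow> 'a) \<Rightarrow> bool" where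
  "kaehler_metric M g J nabla \<longleftrightarrow>
     riemannian_metric M g \<and>
     (\<forall>p\<in>M. \<forall>v\<in>tangent_space M p. \<forall>w\<in>tangent_space M p. \<forall>\<alpha> \<beta>.
        J p v \<in> tangent_space M p \<and>
        J p (\<alpha> *\<^sub>R v + \<beta> *\<^sub>R w) = \<alpha> *\<^sub>R J p v + \<beta> *\<^sub>R J p w \<and>
        J p (J p v) = - v \<and>
        g p (J p v) (J p w) = g p v w) \<and>
     (\<forall>X\<in>vector_fields M. (\<lambda>p. J p (X p)) \<in> vector_fields M) \<and>
     (\<forall>X\<in>vector_fields M. \<forall>Y\<in>vector_fields M. \<forall>p\<in>M.
        nabla X (\<lambda>x. J x (Y x)) p = J p (nabla X Y p))"

definition J_invariant_plane ::
  "'a::euclidean_space set \<Rightarrow> ('a \<Rightarrow> 'a \<Rightarrow> 'a) \<Rightarrow> 'a \<Rightarrow> 'a set \<Rightarrow> bool" where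
  "J_invariant_plane M J p E \<longleftrightarrow> tangent_plane M p E \<and> J p ` E \<subseteq> E"

text \<open>The argument \<open>F\<close> is the distribution \<open>D\<^sup>\<bottom>\<close>.\<close>

definition quasi_constant_hol_sec_curv ::
  "'a::euclidean_space set \<Rightarrow> ('a \<Rightarrow> 'a \<Rightarrow> 'a \<Rightarrow> real) \<Rightarrow> ('a \<Rightarrow> 'a \<Rightarrow> 'a) \<Rightarrow> ('a \<Rightarrow> 'a set) \<Rightarrow>
   (('a \<Rightarrow> 'a) \<Rightarrow> ('a \<Rightarrow> 'a) \<Rightarrow> 'a \<Rightarrow> 'a) \<Rightarrow> bool" where
  "quasi_constant_hol_sec_curv M g J F nabla \<longleftrightarrow>
     (\<exists>H :: 'a \<Rightarrow> real \<Rightarrow> real. \<forall>p\<in>M. \<forall>E. J_invariant_plane M J p E \<longrightarrow>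
        sectional_curvature M g nabla p E = H p (subspace_angle g p E (F p)))"


section \<open>Rotational hypersurfaces of type III\<close>

text \<open>The coordinate with the negative sign is \<open>l\<close>; \<open>complex ^ 'n\<close> is \<open>\<complex>\<^sup>n\<close> and
  \<open>complex ^ 'n \<times> real\<close> is \<open>\<complex>\<^sup>n \<times> \<real>\<close>, with \<open>(0, 1)\<close> in the role of \<open>e\<close>.\<close>

definition flat_metric :: "'n::finite \<Rightarrow> complex ^ 'n \<Rightarrow> complex ^ 'n \<Rightarrow> real" where
  "flat_metric l z w = (\<Sum>i\<in>UNIV. (if i = l then - 1 else 1) * Re (z $ i * cnj (w $ i)))"

definition product_metric ::
  "'n::finite \<Rightarrow> (complex ^ 'n) \<times> real \<Rightarrow> (complex ^ 'n) \<times> real \<Rightarrow> real" where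
  "product_metric l v w = flat_metric l (fst v) (fst w) + snd v * snd w"

text \<open>Only applied to vectors of \<open>\<complex>\<^sup>n\<close>, that is with vanishing real component.\<close>

definition J\<^sub>0 :: "(complex ^ 'n::finite) \<times> real \<Rightarrow> (complex ^ 'n) \<times> real" where
  "J\<^sub>0 v = (\<i> *s fst v, 0)"

definition rot_point ::
  "(real \<Rightarrow> real) \<Rightarrow> (real \<Rightarrow> real) \<Rightarrow> real \<times> (complex ^ 'n::finite) \<Rightarrow> (complex ^ 'n) \<times> real" where
  "rot_point t q = (\<lambda>(s, n). (t s *\<^sub>R n, q s))"

definition rot_params :: "'n::finite \<Rightarrow> real set \<Rightarrow> (real \<times> (complex ^ 'n)) set" where
  "rot_params l I = I \<times> {n. flat_metric l n n = - 1}"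

definition rot_hypersurface ::
  "'n::finite \<Rightarrow> (real \<Rightarrow> real) \<Rightarrow> (real \<Rightarrow> real) \<Rightarrow> real set \<Rightarrow> ((complex ^ 'n) \<times> real) set" where
  "rot_hypersurface l t q I = rot_point t q ` rot_params l I"

definition spacelike_normals :: "'n::finite \<Rightarrow> ((complex ^ 'n) \<times> real) set \<Rightarrow> bool" where
  "spacelike_normals l M \<longleftrightarrow>
     (\<forall>p\<in>M. \<forall>N. N \<noteq> 0 \<and> (\<forall>v\<in>tangent_space M p. product_metric l N v = 0) \<longrightarrow>
        product_metric l N N > 0)"

text \<open>The parameters \<open>s\<close> and \<open>n\<close> of a point of the hypersurface; they are unique when \<open>t > 0\<close>
  and \<open>t\<close> is injective on \<open>I\<close>, in particular when \<open>t' \<le> - 1\<close>.\<close>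

definition rot_s ::
  "'n::finite \<Rightarrow> (real \<Rightarrow> real) \<Rightarrow> (real \<Rightarrow> real) \<Rightarrow> real set \<Rightarrow> (complex ^ 'n) \<times> real \<Rightarrow> real" where
  "rot_s l t q I p = fst (inv_into (rot_params l I) (rot_point t q) p)"

definition rot_n ::
  "'n::finite \<Rightarrow> (real \<Rightarrow> real) \<Rightarrow> (real \<Rightarrow> real) \<Rightarrow> real set \<Rightarrow> (complex ^ 'n) \<times> real \<Rightarrow> complex ^ 'n" where
  "rot_n l t q I p = snd (inv_into (rot_params l I) (rot_point t q) p)"

definition xi_bar ::
  "'n::finite \<Rightarrow> (real \<Rightarrow> real) \<Rightarrow> (real \<Rightarrow> real) \<Rightarrow> real set \<Rightarrow>
   (complex ^ 'n) \<times> real \<Rightarrow> (complex ^ 'n) \<times> real" where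
  "xi_bar l t q I p = (deriv t (rot_s l t q I p) *\<^sub>R rot_n l t q I p, deriv q (rot_s l t q I p))"

definition xi_bar_tilde ::
  "'n::finite \<Rightarrow> (real \<Rightarrow> real) \<Rightarrow> (real \<Rightarrow> real) \<Rightarrow> real set \<Rightarrow>
   (complex ^ 'n) \<times> real \<Rightarrow> (complex ^ 'n) \<times> real" where
  "xi_bar_tilde l t q I p = J\<^sub>0 (rot_n l t q I p, 0)"

definition rot_xi ::
  "'n::finite \<Rightarrow> (real \<Rightarrow> real) \<Rightarrow> (real \<Rightarrow> real) \<Rightarrow> real set \<Rightarrow>
   (complex ^ 'n) \<times> real \<Rightarrow> (complex ^ 'n) \<times> real" where
  "rot_xi l t q I p = (1 / sqrt (- deriv t (rot_s l t q I p))) *\<^sub>R xi_bar l t q I p"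

definition rot_D_perp ::
  "'n::finite \<Rightarrow> (real \<Rightarrow> real) \<Rightarrow> (real \<Rightarrow> real) \<Rightarrow> real set \<Rightarrow>
   (complex ^ 'n) \<times> real \<Rightarrow> ((complex ^ 'n) \<times> real) set" where
  "rot_D_perp l t q I p = span {xi_bar l t q I p, xi_bar_tilde l t q I p}"

definition rot_D ::
  "'n::finite \<Rightarrow> (real \<Rightarrow> real) \<Rightarrow> (real \<Rightarrow> real) \<Rightarrow> real set \<Rightarrow>
   (complex ^ 'n) \<times> real \<Rightarrow> ((complex ^ 'n) \<times> real) set" where
  "rot_D l t q I p =
     {v \<in> tangent_space (rot_hypersurface l t q I) p.
        \<forall>w\<in>rot_D_perp l t q I p. product_metric l v w = 0}"

text \<open>The linear extension of \<open>J = J\<^sub>0\<close> on \<open>D\<close>, \<open>J \<xi> = \<xi>~\<close>, \<open>J \<xi>~ = - \<xi>\<close> to \<open>D \<oplus> D\<^sup>\<bottom>\<close>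
  (with \<open>\<xi>\<close>, \<open>\<xi>~\<close> standing for \<^const>\<open>xi_bar\<close>, \<^const>\<open>xi_bar_tilde\<close>).\<close>

definition rot_J ::
  "'n::finite \<Rightarrow> (real \<Rightarrow> real) \<Rightarrow> (real \<Rightarrow> real) \<Rightarrow> real set \<Rightarrow>
   (complex ^ 'n) \<times> real \<Rightarrow> (complex ^ 'n) \<times> real \<Rightarrow> (complex ^ 'n) \<times> real" where
  "rot_J l t q I p v =
     (THE w. \<exists>x\<in>rot_D l t q I p. \<exists>\<alpha> \<beta>.
        v = x + \<alpha> *\<^sub>R xi_bar l t q I p + \<beta> *\<^sub>R xi_bar_tilde l t q I p \<and>
        w = J\<^sub>0 x + \<alpha> *\<^sub>R xi_bar_tilde l t q I p - \<beta> *\<^sub>R xi_bar l t q I p)"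

definition rot_g ::
  "'n::finite \<Rightarrow> (real \<Rightarrow> real) \<Rightarrow> (real \<Rightarrow> real) \<Rightarrow> real set \<Rightarrow>
   (complex ^ 'n) \<times> real \<Rightarrow> (complex ^ 'n) \<times> real \<Rightarrow> (complex ^ 'n) \<times> real \<Rightarrow> real" where
  "rot_g l t q I p v w =
     (let h = product_metric l; X = xi_bar l t q I p; Y = xi_bar_tilde l t q I p in
      h v w + (1 - deriv t (rot_s l t q I p)) * (h X v * h X w + h Y v * h Y w))"

end

theory Submission
  imports Defs
begin

text \<open>Let \<open>r\<close> solve \<open>r' = r / t\<close>. The map \<open>r(s) n \<mapsto> t(s) n + q(s) e\<close> is a global chart of the hypersurface
  over a domain of \<open>\<complex>\<^sup>n\<close> in which \<open>J\<close> is multiplication by \<open>i\<close>. In it the induced metric is the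
  multiple \<open>A = t\<^sup>2 / u\<close> of the flat one, where \<open>u = r\<^sup>2 = - h(w, w)\<close>, and \<open>g\<close> is the real part of
  \<open>H(X, Y) = A (h(X, Y) + \<alpha> h(X, w) h(w, Y))\<close> with the Hermitian extension of \<open>h\<close> and
  \<open>\<alpha> = (1 - t') / u = - A' / A\<close>. The Christoffel symbol is complex bilinear,
  \<open>\<Gamma>(X, Y) = \<alpha> (h(X, w) Y + h(Y, w) X) + \<beta> h(X, w) h(Y, w) w\<close>, so \<open>g\<close> is Kaehler. The holomorphic
  sectional curvature of the plane of \<open>v\<close> depends only on \<open>u\<close> and on \<open>\<bar>H(v, w)\<bar>\<^sup>2 / (H(v, v) H(w, w))\<close>, the
  squared cosine of the angle with \<open>D\<^sup>\<bottom>\<close>. One reads off \<open>a = 4 (t' - 1) / t\<^sup>2\<close> and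
  \<open>k\<^sup>2 = - 4 t' / t\<^sup>2\<close>, hence \<open>a + k\<^sup>2 = - 4 / t\<^sup>2\<close>.\<close>

section \<open>Smooth maps between Euclidean spaces\<close>

text \<open>The equation r' = r / t expresses conformality: for w = r n the flat form is r^2 dn^2 -
  r'^2 ds^2, while a natural parameter makes the induced metric t^2 dn^2 - ds^2, and these are
  proportional exactly for r' = r / t or r' = - r / t. The plus sign sends w / t and i w / t to
  \<open>xi_bar\<close> and \<open>xi_bar_tilde\<close>, so that \<open>rot_J\<close> becomes
  multiplication by i also on \<open>rot_D_perp\<close>. From u = r^2 one gets ds/du = t / (2 u),
  hence A' / A = (t' - 1) / u: the factor 1 - t' in g is the one that gives \<alpha> = - A' / A, the
  Kaehler condition. The sign of t' enters through 1 - \<alpha> u = t' < 0, which makes the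
  direction of w, negative for h, positive for H. The connection is an arbitrary operator on vector
  fields of a subset, and sectional curvature, pointwise covariant derivative and J are definite
  descriptions. The connection therefore has to be identified on chart representatives of fields
  before anything is computed, and each description needs a proof that its value is independent of
  the choices it ranges over.\<close>

lemma frechet_derivative_cong_open:
  assumes "open U" "x \<in> U" "\<And>y. y \<in> U \<Longrightarrow> f y = g y" "f differentiable (at x)"
  shows "frechet_derivative f (at x) = frechet_derivative g (at x)"
proof -
  have "(f has_derivative frechet_derivative f (at x)) (at x)"
    using assms(4) frechet_derivative_works by blast
  hence "(g has_derivative frechet_derivative f (at x)) (at x)"
    by (rule has_derivative_transform_within_open) (use assms in auto)
  thus ?thesis by (rule frechet_derivative_at)
qed

lemma differentiable_cong_open:
  assumes "open U" "x \<in> U" "\<And>y. y \<in> U \<Longrightarrow> f y = g y" "f differentiable (at x)"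
  shows "g differentiable (at x)"
  using has_derivative_transform_within_open[OF _ assms(1,2)] assms(3,4)
  unfolding differentiable_def by metis

section \<open>Closure properties of C^k maps\<close>

lemma Ck_on_cong:
  assumes "open U" "\<And>x. x \<in> U \<Longrightarrow> f x = g x" "Ck_on k f U"
  shows "Ck_on k g U"
  using assms(2,3)
proof (induction k arbitrary: f g)
  case 0
  then show ?case by (simp cong: continuous_on_cong)
next
  case (Suc k)
  have "g differentiable (at x)" if "x \<in> U" for x
    using differentiable_cong_open[OF assms(1) that, of f g] Suc that by auto
  moreover have "Ck_on k (\<lambda>x. frechet_derivative g (at x) v) U" for v
  proof (rule Suc.IH)
    show "Ck_on k (\<lambda>x. frechet_derivative f (at x) v) U" using Suc by simp
    show "frechet_derivative f (at x) v = frechet_derivative g (at x) v" if "x \<in> U" for x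
      using frechet_derivative_cong_open[OF assms(1) that, of f g] Suc that by auto
  qed
  ultimately show ?case by simp
qed

lemma Ck_on_imp_continuous_on: "Ck_on k f U \<Longrightarrow> continuous_on U f"
  by (cases k) (auto intro!: continuous_at_imp_continuous_on differentiable_imp_continuous_within)

lemma Ck_on_SucD: "Ck_on (Suc k) f U \<Longrightarrow> Ck_on k f U"
proof (induction k arbitrary: f)
  case 0
  then show ?case using Ck_on_imp_continuous_on by (simp only: Ck_on.simps(1)) blast
next
  case (Suc k)
  then show ?case by (metis Ck_on.simps(2))
qed

text \<open>Allows an explicit derivative \<open>f'\<close> in place of
  \<open>frechet_derivative\<close>, with which it agrees on the open set. The closure properties
  below climb one order through this rule.\<close>

lemma Ck_on_Suc_has_derivative:
  assumes "open U"
    and "\<And>x. x \<in> U \<Longrightarrow> (f has_derivative f' x) (at x)"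
    and "\<And>v. Ck_on k (\<lambda>x. f' x v) U"
  shows "Ck_on (Suc k) f U"
proof -
  have "frechet_derivative f (at x) = f' x" if "x \<in> U" for x
    using assms(2)[OF that] frechet_derivative_at by metis
  hence "Ck_on k (\<lambda>x. frechet_derivative f (at x) v) U" for v
    using Ck_on_cong[OF assms(1) _ assms(3)] by simp
  moreover have "f differentiable (at x)" if "x \<in> U" for x
    using assms(2)[OF that] differentiable_def by blast
  ultimately show ?thesis by simp
qed

lemma Ck_on_Suc_D:
  assumes "Ck_on (Suc k) f U" "x \<in> U"
  shows "(f has_derivative frechet_derivative f (at x)) (at x)"
  using assms frechet_derivative_works by auto

lemma Ck_on_const: "Ck_on k (\<lambda>x. c) U"
  by (induction k arbitrary: c) simp_all

lemma Ck_on_bounded_linear: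
  assumes "bounded_linear f"
  shows "Ck_on k f U"
proof (cases k)
  case 0
  then show ?thesis using assms linear_continuous_on by auto
next
  case (Suc j)
  have "frechet_derivative f (at x) = f" for x
    using assms frechet_derivative_at[OF bounded_linear_imp_has_derivative] by metis
  then show ?thesis
    using Suc assms bounded_linear_imp_differentiable[OF assms] by (simp add: Ck_on_const)
qed

lemma Ck_on_add:
  assumes "open U" "Ck_on k f U" "Ck_on k g U"
  shows "Ck_on k (\<lambda>x. f x + g x) U"
  using assms(2,3)
proof (induction k arbitrary: f g)
  case 0
  then show ?case by (simp add: continuous_on_add)
next
  case (Suc k)
  show ?case
    by (rule Ck_on_Suc_has_derivative[OF assms(1) has_derivative_add
          [OF Ck_on_Suc_D[OF Suc.prems(1)] Ck_on_Suc_D[OF Suc.prems(2)]]])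
      (use Suc in auto)
qed

lemma Ck_on_sum:
  assumes "open U" "\<And>i. i \<in> A \<Longrightarrow> Ck_on k (f i) U"
  shows "Ck_on k (\<lambda>x. \<Sum>i\<in>A. f i x) U"
  using assms(2)
  by (induction A rule: infinite_finite_induct) (auto intro: Ck_on_const Ck_on_add[OF assms(1)])

text \<open>The Leibniz rule expresses the derivative by the same product, so one induction serves
  \<open>*\<close>, \<open>*\<^sub>R\<close>, the inner product and later the Hermitian
  form.\<close>

lemma (in bounded_bilinear) Ck_on:
  assumes "open U" "Ck_on k f U" "Ck_on k g U"
  shows "Ck_on k (\<lambda>x. prod (f x) (g x)) U"
  using assms(2,3)
proof (induction k arbitrary: f g)
  case 0
  then show ?case by (simp add: continuous_on)
next
  case (Suc k)
  note f = Suc.prems(1) and g = Suc.prems(2)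
  show ?case
  proof (rule Ck_on_Suc_has_derivative[OF assms(1) FDERIV[OF Ck_on_Suc_D[OF f] Ck_on_Suc_D[OF g]]])
    fix v
    show "Ck_on k (\<lambda>x. prod (f x) (frechet_derivative g (at x) v) +
        prod (frechet_derivative f (at x) v) (g x)) U"
      using Suc Ck_on_SucD[OF f] Ck_on_SucD[OF g]
      by (intro Ck_on_add[OF assms(1)] Suc.IH) auto
  qed auto
qed

text \<open>\<open>Ck_on\<close> controls derivatives only in a fixed direction. The expansion
  trades a direction that moves with the point for finitely many fixed ones; the chain rule and
  pushforwards rest on it.\<close>

lemma frechet_derivative_Basis_sum:
  fixes f :: "'a::euclidean_space \<Rightarrow> 'b::real_normed_vector"
  assumes "f differentiable (at x)"
  shows "frechet_derivative f (at x) v = (\<Sum>b\<in>Basis. (v \<bullet> b) *\<^sub>R frechet_derivative f (at x) b)"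
proof -
  interpret linear "frechet_derivative f (at x)"
    using assms linear_frechet_derivative by blast
  have "frechet_derivative f (at x) v = frechet_derivative f (at x) (\<Sum>b\<in>Basis. (v \<bullet> b) *\<^sub>R b)"
    by (simp add: euclidean_representation)
  thus ?thesis by (simp add: sum scaleR)
qed

lemma Ck_on_compose:
  fixes f :: "'b::euclidean_space \<Rightarrow> 'c::real_normed_vector" and g :: "'a::real_normed_vector \<Rightarrow> 'b"
  assumes "open U" "open V" "g ` U \<subseteq> V" "Ck_on k f V" "Ck_on k g U"
  shows "Ck_on k (\<lambda>x. f (g x)) U"
  using assms(4,5)
proof (induction k arbitrary: f)
  case 0
  then show ?case using assms(3) continuous_on_compose2 by (simp only: Ck_on.simps(1)) blast
next
  case (Suc k)
  note f = Suc.prems(1) and g = Suc.prems(2)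
  have gk: "Ck_on k g U" by (rule Ck_on_SucD[OF g])
  show ?case
  proof (rule Ck_on_Suc_has_derivative[OF assms(1)])
    show "((\<lambda>x. f (g x)) has_derivative
       (\<lambda>v. \<Sum>b\<in>Basis. (frechet_derivative g (at x) v \<bullet> b) *\<^sub>R frechet_derivative f (at (g x)) b)) (at x)"
      if "x \<in> U" for x
    proof -
      have gx: "g x \<in> V" using assms(3) that by auto
      have "((\<lambda>x. f (g x)) has_derivative
         (\<lambda>v. frechet_derivative f (at (g x)) (frechet_derivative g (at x) v))) (at x)"
        using has_derivative_compose[OF Ck_on_Suc_D[OF g that] Ck_on_Suc_D[OF f gx]] .
      moreover have "f differentiable (at (g x))" using f gx by simp
      ultimately show ?thesis by (simp only: frechet_derivative_Basis_sum[symmetric])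
    qed
    fix v
    show "Ck_on k (\<lambda>x. \<Sum>b\<in>Basis. (frechet_derivative g (at x) v \<bullet> b) *\<^sub>R
        frechet_derivative f (at (g x)) b) U"
    proof (intro Ck_on_sum bounded_bilinear.Ck_on[OF bounded_bilinear_scaleR]
        bounded_bilinear.Ck_on[OF bounded_bilinear_inner] assms(1) Ck_on_const)
      show "Ck_on k (\<lambda>x. frechet_derivative g (at x) v) U" using g by simp
      show "Ck_on k (\<lambda>x. frechet_derivative f (at (g x)) b) U" for b
        using f gk by (intro Suc.IH) simp
    qed
  qed
qed

lemma Ck_on_local:
  assumes "open U" "\<And>x. x \<in> U \<Longrightarrow> \<exists>V. open V \<and> x \<in> V \<and> Ck_on k f V"
  shows "Ck_on k f U"
  using assms(2)
proof (induction k arbitrary: f)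
  case 0
  then show ?case
    by (metis Ck_on.simps(1) continuous_at_imp_continuous_on continuous_on_eq_continuous_at)
next
  case (Suc k)
  have "Ck_on k (\<lambda>x. frechet_derivative f (at x) v) U" for v
    using Suc.prems by (intro Suc.IH) force
  moreover have "f differentiable (at x)" if "x \<in> U" for x
    using Suc.prems[OF that] by auto
  ultimately show ?case by simp
qed

lemma Ck_on_subset: "Ck_on k f U \<Longrightarrow> V \<subseteq> U \<Longrightarrow> Ck_on k f V"
  by (induction k arbitrary: f) (auto intro: continuous_on_subset)

section \<open>The same properties for smooth maps\<close>

lemma smooth_on_cong:
  "open U \<Longrightarrow> (\<And>x. x \<in> U \<Longrightarrow> f x = g x) \<Longrightarrow> smooth_on f U \<Longrightarrow> smooth_on g U"
  unfolding smooth_on_def using Ck_on_cong by blast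

lemma smooth_on_const: "smooth_on (\<lambda>x. c) U"
  by (simp add: smooth_on_def Ck_on_const)

lemma smooth_on_bounded_linear: "bounded_linear f \<Longrightarrow> smooth_on f U"
  by (simp add: smooth_on_def Ck_on_bounded_linear)

lemma smooth_on_ident: "smooth_on (\<lambda>x. x) U"
  by (rule smooth_on_bounded_linear[OF bounded_linear_ident])

lemma smooth_on_add:
  "open U \<Longrightarrow> smooth_on f U \<Longrightarrow> smooth_on g U \<Longrightarrow> smooth_on (\<lambda>x. f x + g x) U"
  by (simp add: smooth_on_def Ck_on_add)

lemma smooth_on_sum:
  "open U \<Longrightarrow> (\<And>i. i \<in> A \<Longrightarrow> smooth_on (f i) U) \<Longrightarrow> smooth_on (\<lambda>x. \<Sum>i\<in>A. f i x) U"
  by (simp add: smooth_on_def Ck_on_sum)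

lemma (in bounded_bilinear) smooth_on:
  "open U \<Longrightarrow> smooth_on f U \<Longrightarrow> smooth_on g U \<Longrightarrow> smooth_on (\<lambda>x. prod (f x) (g x)) U"
  by (simp add: smooth_on_def Ck_on)

lemmas smooth_on_mult = bounded_bilinear.smooth_on[OF bounded_bilinear_mult]
  and smooth_on_scaleR = bounded_bilinear.smooth_on[OF bounded_bilinear_scaleR]
  and smooth_on_inner = bounded_bilinear.smooth_on[OF bounded_bilinear_inner]

lemma smooth_on_compose:
  fixes f :: "'b::euclidean_space \<Rightarrow> 'c::real_normed_vector" and g :: "'a::real_normed_vector \<Rightarrow> 'b"
  assumes "open U" "open V" "g ` U \<subseteq> V" "smooth_on f V" "smooth_on g U"
  shows "smooth_on (\<lambda>x. f (g x)) U"
  using assms by (simp add: smooth_on_def Ck_on_compose)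

lemma smooth_on_linear_compose:
  fixes f :: "'b::euclidean_space \<Rightarrow> 'c::real_normed_vector" and g :: "'a::real_normed_vector \<Rightarrow> 'b"
  assumes "bounded_linear f" "open U" "smooth_on g U"
  shows "smooth_on (\<lambda>x. f (g x)) U"
  using smooth_on_compose[OF assms(2) open_UNIV _ smooth_on_bounded_linear[OF assms(1)] assms(3)]
  by simp

lemma smooth_on_uminus: "open U \<Longrightarrow> smooth_on f U \<Longrightarrow> smooth_on (\<lambda>x. - f x) U"
  using smooth_on_scaleR[OF _ smooth_on_const, of U f "-1"] by simp

lemma smooth_on_diff:
  "open U \<Longrightarrow> smooth_on f U \<Longrightarrow> smooth_on g U \<Longrightarrow> smooth_on (\<lambda>x. f x - g x) U"
  using smooth_on_add[OF _ _ smooth_on_uminus, of U f g] by simp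

lemma smooth_on_local:
  assumes "open U" "\<And>x. x \<in> U \<Longrightarrow> \<exists>V. open V \<and> x \<in> V \<and> smooth_on f V"
  shows "smooth_on f U"
  using assms unfolding smooth_on_def by (meson Ck_on_local)

lemma smooth_on_subset: "smooth_on f U \<Longrightarrow> V \<subseteq> U \<Longrightarrow> smooth_on f V"
  unfolding smooth_on_def using Ck_on_subset by blast

lemma smooth_on_imp_continuous_on: "smooth_on f U \<Longrightarrow> continuous_on U f"
  unfolding smooth_on_def using Ck_on.simps(1) by blast

lemma smooth_on_has_derivative:
  "smooth_on f U \<Longrightarrow> x \<in> U \<Longrightarrow> (f has_derivative frechet_derivative f (at x)) (at x)"
  unfolding smooth_on_def using Ck_on_Suc_D by blast

lemma smooth_on_differentiable: "smooth_on f U \<Longrightarrow> x \<in> U \<Longrightarrow> f differentiable (at x)"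
  using smooth_on_has_derivative differentiable_def by blast

lemma smooth_on_frechet_derivative:
  "smooth_on f U \<Longrightarrow> smooth_on (\<lambda>x. frechet_derivative f (at x) v) U"
  unfolding smooth_on_def using Ck_on.simps(2) by blast

section \<open>Derivatives applied to moving vectors and symmetry of second derivatives\<close>

lemma smooth_on_pushforward:
  fixes f :: "'a::euclidean_space \<Rightarrow> 'b::real_normed_vector"
  assumes "open U" "open V" "smooth_on f V" "smooth_on \<psi> U" "\<psi> ` U \<subseteq> V" "smooth_on Y U"
  shows "smooth_on (\<lambda>x. frechet_derivative f (at (\<psi> x)) (Y x)) U"
proof (rule smooth_on_cong[OF assms(1)])
  show "smooth_on (\<lambda>x. \<Sum>b\<in>Basis. (Y x \<bullet> b) *\<^sub>R frechet_derivative f (at (\<psi> x)) b) U"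
    by (intro smooth_on_sum smooth_on_scaleR smooth_on_inner smooth_on_const assms
        smooth_on_compose[OF assms(1,2,5)] smooth_on_frechet_derivative)
  show "(\<Sum>b\<in>Basis. (Y x \<bullet> b) *\<^sub>R frechet_derivative f (at (\<psi> x)) b) =
      frechet_derivative f (at (\<psi> x)) (Y x)" if "x \<in> U" for x
    using frechet_derivative_Basis_sum[symmetric, OF smooth_on_differentiable[OF assms(3)]]
      that assms(5) by blast
qed

text \<open>Product rule for Df(y)(Y y). The second derivative of \<open>f\<close> appears with the
  vector frozen at \<open>Y x\<close>; in this shape its symmetry can be used to cancel it in
  brackets and curvature.\<close>

lemma frechet_derivative_of_frechet_derivative:
  fixes f :: "'a::euclidean_space \<Rightarrow> 'b::real_normed_vector"
  assumes "open U" "smooth_on f U" "x \<in> U" "(Y has_derivative Y') (at x)"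
  shows "((\<lambda>y. frechet_derivative f (at y) (Y y)) has_derivative
    (\<lambda>v. frechet_derivative f (at x) (Y' v) +
         frechet_derivative (\<lambda>y. frechet_derivative f (at y) (Y x)) (at x) v)) (at x)"
proof -
  let ?D = "\<lambda>y. frechet_derivative f (at y)"
  have D: "((\<lambda>y. ?D y b) has_derivative frechet_derivative (\<lambda>y. ?D y b) (at x)) (at x)" for b
    by (rule smooth_on_has_derivative[OF smooth_on_frechet_derivative[OF assms(2)] assms(3)])
  have rep: "?D y v = (\<Sum>b\<in>Basis. (v \<bullet> b) *\<^sub>R ?D y b)" if "y \<in> U" for y v
    using frechet_derivative_Basis_sum smooth_on_differentiable[OF assms(2) that] by blast
  have Yx: "((\<lambda>y. ?D y (Y x)) has_derivative
      (\<lambda>v. \<Sum>b\<in>Basis. (Y x \<bullet> b) *\<^sub>R frechet_derivative (\<lambda>y. ?D y b) (at x) v)) (at x)"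
    by (rule has_derivative_transform_within_open
        [where f="\<lambda>y. \<Sum>b\<in>Basis. (Y x \<bullet> b) *\<^sub>R ?D y b", OF _ assms(1,3) rep[symmetric]])
      (auto intro!: derivative_eq_intros D)
  have "((\<lambda>y. \<Sum>b\<in>Basis. (Y y \<bullet> b) *\<^sub>R ?D y b) has_derivative
      (\<lambda>v. \<Sum>b\<in>Basis. (Y x \<bullet> b) *\<^sub>R frechet_derivative (\<lambda>y. ?D y b) (at x) v + (Y' v \<bullet> b) *\<^sub>R ?D x b)) (at x)"
    by (auto intro!: derivative_eq_intros D assms(4))
  hence "((\<lambda>y. ?D y (Y y)) has_derivative
      (\<lambda>v. \<Sum>b\<in>Basis. (Y x \<bullet> b) *\<^sub>R frechet_derivative (\<lambda>y. ?D y b) (at x) v + (Y' v \<bullet> b) *\<^sub>R ?D x b)) (at x)"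
    by (rule has_derivative_transform_within_open[OF _ assms(1,3) rep[symmetric]])
  thus ?thesis
    by (simp add: sum.distrib frechet_derivative_at[OF Yx, symmetric] rep[OF assms(3), symmetric]
        add.commute)
qed

text \<open>The mean value theorem is applied twice: along \<open>a\<close> to the increment of
  \<open>f\<close> in direction \<open>b\<close>, then along \<open>b\<close> to the derivative in
  direction \<open>a\<close>. The second difference on the left is symmetric in \<open>a\<close> and
  \<open>b\<close>.\<close>

lemma second_difference_mvt:
  fixes f :: "'a::real_normed_vector \<Rightarrow> real"
  assumes "h > 0"
    and f: "\<And>\<sigma> \<tau>. \<lbrakk>0 \<le> \<sigma>; \<sigma> \<le> h; 0 \<le> \<tau>; \<tau> \<le> h\<rbrakk> \<Longrightarrow>
      (f has_derivative f' (x + \<sigma> *\<^sub>R a + \<tau> *\<^sub>R b)) (at (x + \<sigma> *\<^sub>R a + \<tau> *\<^sub>R b))"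
    and fa: "\<And>\<sigma> \<tau>. \<lbrakk>0 \<le> \<sigma>; \<sigma> \<le> h; 0 \<le> \<tau>; \<tau> \<le> h\<rbrakk> \<Longrightarrow>
      ((\<lambda>y. f' y a) has_derivative f'' (x + \<sigma> *\<^sub>R a + \<tau> *\<^sub>R b)) (at (x + \<sigma> *\<^sub>R a + \<tau> *\<^sub>R b))"
  obtains \<sigma> \<tau> where "0 \<le> \<sigma>" "\<sigma> \<le> h" "0 \<le> \<tau>" "\<tau> \<le> h"
    "f (x + h *\<^sub>R a + h *\<^sub>R b) - f (x + h *\<^sub>R a) - f (x + h *\<^sub>R b) + f x =
     h * h * f'' (x + \<sigma> *\<^sub>R a + \<tau> *\<^sub>R b) b"
proof -
  have lin: "\<And>\<sigma> \<tau>. \<lbrakk>0 \<le> \<sigma>; \<sigma> \<le> h; 0 \<le> \<tau>; \<tau> \<le> h\<rbrakk> \<Longrightarrow> linear (f' (x + \<sigma> *\<^sub>R a + \<tau> *\<^sub>R b))"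
    "\<And>\<sigma> \<tau>. \<lbrakk>0 \<le> \<sigma>; \<sigma> \<le> h; 0 \<le> \<tau>; \<tau> \<le> h\<rbrakk> \<Longrightarrow> linear (f'' (x + \<sigma> *\<^sub>R a + \<tau> *\<^sub>R b))"
    using f fa has_derivative_linear by blast+
  define \<phi> where "\<phi> \<sigma> = f (x + \<sigma> *\<^sub>R a + h *\<^sub>R b) - f (x + \<sigma> *\<^sub>R a)" for \<sigma>
  have "(\<phi> has_real_derivative
      f' (x + \<sigma> *\<^sub>R a + h *\<^sub>R b) a - f' (x + \<sigma> *\<^sub>R a) a) (at \<sigma>)" if "0 \<le> \<sigma>" "\<sigma> \<le> h" for \<sigma>
  proof -
    have "((\<lambda>\<sigma>. f (x + \<sigma> *\<^sub>R a + \<tau> *\<^sub>R b)) has_derivative (\<lambda>v. f' (x + \<sigma> *\<^sub>R a + \<tau> *\<^sub>R b) (v *\<^sub>R a))) (at \<sigma>)"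
      if "0 \<le> \<tau>" "\<tau> \<le> h" for \<tau>
      by (rule has_derivative_compose[where g=f])
        (use that \<open>0 \<le> \<sigma>\<close> \<open>\<sigma> \<le> h\<close> in \<open>auto intro!: derivative_eq_intros f\<close>)
    note D = has_derivative_diff[OF this[of h] this[of 0]]
    have eq: "(*) (u - v) = (\<lambda>w. w * u - w * v)" for u v :: real
      by (simp add: fun_eq_iff algebra_simps)
    show ?thesis
      unfolding has_field_derivative_def \<phi>_def eq
      using D assms(1) lin(1)[of \<sigma> h] lin(1)[of \<sigma> 0] that by (simp add: linear_scale)
  qed
  from MVT2[OF \<open>h > 0\<close> this] obtain \<sigma> where s: "0 < \<sigma>" "\<sigma> < h"
    "\<phi> h - \<phi> 0 = h * (f' (x + \<sigma> *\<^sub>R a + h *\<^sub>R b) a - f' (x + \<sigma> *\<^sub>R a) a)" by auto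
  have "((\<lambda>\<tau>. f' (x + \<sigma> *\<^sub>R a + \<tau> *\<^sub>R b) a) has_real_derivative f'' (x + \<sigma> *\<^sub>R a + \<tau> *\<^sub>R b) b) (at \<tau>)"
    if "0 \<le> \<tau>" "\<tau> \<le> h" for \<tau>
  proof -
    have "((\<lambda>\<tau>. f' (x + \<sigma> *\<^sub>R a + \<tau> *\<^sub>R b) a) has_derivative (\<lambda>v. f'' (x + \<sigma> *\<^sub>R a + \<tau> *\<^sub>R b) (v *\<^sub>R b))) (at \<tau>)"
      by (rule has_derivative_compose[where g="\<lambda>y. f' y a"])
        (use s that in \<open>auto intro!: derivative_eq_intros fa\<close>)
    thus ?thesis
      unfolding has_field_derivative_def using lin(2)[of \<sigma> \<tau>] that s
      by (simp add: linear_scale mult_commute_abs)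
  qed
  from MVT2[OF \<open>h > 0\<close> this] obtain \<tau> where t: "0 < \<tau>" "\<tau> < h"
    "f' (x + \<sigma> *\<^sub>R a + h *\<^sub>R b) a - f' (x + \<sigma> *\<^sub>R a) a = h * f'' (x + \<sigma> *\<^sub>R a + \<tau> *\<^sub>R b) b" by auto
  show thesis
    using s t by (intro that[of \<sigma> \<tau>]) (auto simp: \<phi>_def)
qed

text \<open>The same second difference gives both mixed derivatives, each at some nearby point. By
  continuity two different values at \<open>x\<close> would remain separated near
  \<open>x\<close>.\<close>

lemma second_derivative_symmetric_real:
  fixes f :: "'a::real_normed_vector \<Rightarrow> real"
  assumes "open U" "smooth_on f U" "x \<in> U"
  shows "frechet_derivative (\<lambda>y. frechet_derivative f (at y) a) (at x) b =
         frechet_derivative (\<lambda>y. frechet_derivative f (at y) b) (at x) a"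
proof (rule ccontr)
  define F where "F c d y = frechet_derivative (\<lambda>y. frechet_derivative f (at y) c) (at y) d" for c d y
  assume "\<not> ?thesis"
  hence ne: "F a b x \<noteq> F b a x" by (simp add: F_def)
  \<comment> \<open>Half the gap, so that the balls of radius \<open>e\<close> around the two values
    are disjoint.\<close>
  define e where "e = \<bar>F a b x - F b a x\<bar> / 2"
  have "e > 0" using ne by (simp add: e_def)
  have "continuous (at x) (F c d)" for c d
    using smooth_on_imp_continuous_on[OF smooth_on_frechet_derivative[OF smooth_on_frechet_derivative[OF assms(2)]]]
      assms(1,3) unfolding F_def by (simp add: continuous_on_eq_continuous_at)
  hence "\<forall>\<^sub>F y in nhds x. dist (F c d y) (F c d x) < e" for c d
    using \<open>e > 0\<close> tendstoD unfolding continuous_within tendsto_at_iff_tendsto_nhds by blast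
  hence "\<forall>\<^sub>F y in nhds x. y \<in> U \<and> dist (F a b y) (F a b x) < e \<and> dist (F b a y) (F b a x) < e"
    using eventually_nhds_in_open[OF assms(1,3)] by (simp add: eventually_conj_iff)
  then obtain r where r: "r > 0" "\<And>y. dist y x < r \<Longrightarrow>
      y \<in> U \<and> dist (F a b y) (F a b x) < e \<and> dist (F b a y) (F b a x) < e"
    unfolding eventually_nhds_metric by metis
  \<comment> \<open>Keeps all the intermediate points within distance r of \<open>x\<close>; the
    summand 1 avoids division by zero when \<open>a\<close> and \<open>b\<close> both
    vanish.\<close>
  define h where "h = r / (2 * (norm a + norm b + 1))"
  have nn: "norm a + norm b + 1 > 0" by (smt (verit) norm_ge_zero)
  have h: "h > 0" "h * (norm a + norm b + 1) = r / 2"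
    using r(1) nn by (auto simp: h_def field_simps)
  have near: "dist (x + \<sigma> *\<^sub>R c + \<tau> *\<^sub>R d) x < r"
    if "0 \<le> \<sigma>" "\<sigma> \<le> h" "0 \<le> \<tau>" "\<tau> \<le> h" "norm c + norm d = norm a + norm b" for \<sigma> \<tau> c d
  proof -
    have "dist (x + \<sigma> *\<^sub>R c + \<tau> *\<^sub>R d) x = norm (\<sigma> *\<^sub>R c + \<tau> *\<^sub>R d)"
      by (simp add: dist_norm algebra_simps)
    also have "\<dots> \<le> \<sigma> * norm c + \<tau> * norm d"
      using norm_triangle_ineq[of "\<sigma> *\<^sub>R c" "\<tau> *\<^sub>R d"] that by simp
    also have "\<dots> \<le> h * norm c + h * norm d"
      using that by (intro add_mono mult_right_mono) auto
    also have "\<dots> = h * (norm a + norm b)" using that(5) by (metis distrib_left)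
    also have "\<dots> < r" using h r(1) by (simp add: algebra_simps)
    finally show ?thesis .
  qed
  have mvt: "\<exists>\<sigma> \<tau>. 0 \<le> \<sigma> \<and> \<sigma> \<le> h \<and> 0 \<le> \<tau> \<and> \<tau> \<le> h \<and>
      f (x + h *\<^sub>R c + h *\<^sub>R d) - f (x + h *\<^sub>R c) - f (x + h *\<^sub>R d) + f x =
      h * h * F c d (x + \<sigma> *\<^sub>R c + \<tau> *\<^sub>R d)" if "norm c + norm d = norm a + norm b" for c d
    unfolding F_def
    by (rule second_difference_mvt[OF h(1), of f "\<lambda>y. frechet_derivative f (at y)" x c d
          "\<lambda>y. frechet_derivative (\<lambda>y. frechet_derivative f (at y) c) (at y)"])
      (use near r(2) that smooth_on_has_derivative[OF assms(2)]
         smooth_on_has_derivative[OF smooth_on_frechet_derivative[OF assms(2)]] in blast)+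
  obtain \<sigma> \<tau> where 1: "0 \<le> \<sigma>" "\<sigma> \<le> h" "0 \<le> \<tau>" "\<tau> \<le> h"
    "f (x + h *\<^sub>R a + h *\<^sub>R b) - f (x + h *\<^sub>R a) - f (x + h *\<^sub>R b) + f x = h * h * F a b (x + \<sigma> *\<^sub>R a + \<tau> *\<^sub>R b)"
    using mvt[of a b] by auto
  obtain \<sigma>' \<tau>' where 2: "0 \<le> \<sigma>'" "\<sigma>' \<le> h" "0 \<le> \<tau>'" "\<tau>' \<le> h"
    "f (x + h *\<^sub>R b + h *\<^sub>R a) - f (x + h *\<^sub>R b) - f (x + h *\<^sub>R a) + f x = h * h * F b a (x + \<sigma>' *\<^sub>R b + \<tau>' *\<^sub>R a)"
    using mvt[of b a] by auto
  have "h * h * F a b (x + \<sigma> *\<^sub>R a + \<tau> *\<^sub>R b) = h * h * F b a (x + \<sigma>' *\<^sub>R b + \<tau>' *\<^sub>R a)"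
    using 1(5) 2(5) by (simp add: algebra_simps)
  hence "F a b (x + \<sigma> *\<^sub>R a + \<tau> *\<^sub>R b) = F b a (x + \<sigma>' *\<^sub>R b + \<tau>' *\<^sub>R a)"
    using h(1) by simp
  moreover have "dist (F a b (x + \<sigma> *\<^sub>R a + \<tau> *\<^sub>R b)) (F a b x) < e"
    using r(2)[OF near[of \<sigma> \<tau> a b]] 1 by simp
  moreover have "dist (F b a (x + \<sigma>' *\<^sub>R b + \<tau>' *\<^sub>R a)) (F b a x) < e"
    using r(2)[OF near[of \<sigma>' \<tau>' b a]] 2 by simp
  ultimately show False unfolding dist_real_def e_def by (auto simp: field_simps abs_if split: if_splits)
qed

lemma second_derivative_symmetric:
  fixes f :: "'a::real_normed_vector \<Rightarrow> 'b::euclidean_space"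
  assumes "open U" "smooth_on f U" "x \<in> U"
  shows "frechet_derivative (\<lambda>y. frechet_derivative f (at y) a) (at x) b =
         frechet_derivative (\<lambda>y. frechet_derivative f (at y) b) (at x) a"
proof (rule euclidean_eqI)
  fix e :: 'b
  define F where "F y = f y \<bullet> e" for y
  have F: "smooth_on F U" unfolding F_def
    by (intro smooth_on_inner assms smooth_on_const)
  have D: "frechet_derivative F (at y) c = frechet_derivative f (at y) c \<bullet> e" if "y \<in> U" for y c
  proof -
    have "(F has_derivative (\<lambda>c. frechet_derivative f (at y) c \<bullet> e)) (at y)"
      unfolding F_def by (auto intro!: derivative_eq_intros smooth_on_has_derivative[OF assms(2) that])
    thus ?thesis using frechet_derivative_at by metis
  qed
  have DD: "frechet_derivative (\<lambda>y. frechet_derivative F (at y) c) (at x) d =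
     frechet_derivative (\<lambda>y. frechet_derivative f (at y) c) (at x) d \<bullet> e" for c d
  proof -
    have "((\<lambda>y. frechet_derivative f (at y) c \<bullet> e) has_derivative
       (\<lambda>d. frechet_derivative (\<lambda>y. frechet_derivative f (at y) c) (at x) d \<bullet> e)) (at x)"
      by (auto intro!: derivative_eq_intros
          smooth_on_has_derivative[OF smooth_on_frechet_derivative[OF assms(2)] assms(3)])
    hence "((\<lambda>y. frechet_derivative F (at y) c) has_derivative
       (\<lambda>d. frechet_derivative (\<lambda>y. frechet_derivative f (at y) c) (at x) d \<bullet> e)) (at x)"
      by (rule has_derivative_transform_within_open[OF _ assms(1,3)]) (simp add: D)
    thus ?thesis using frechet_derivative_at by metis
  qed
  show "frechet_derivative (\<lambda>y. frechet_derivative f (at y) a) (at x) b \<bullet> e =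
        frechet_derivative (\<lambda>y. frechet_derivative f (at y) b) (at x) a \<bullet> e"
    using second_derivative_symmetric_real[OF assms(1) F assms(3)] DD by metis
qed

subsection \<open>Functions of one real variable\<close>

lemma frechet_derivative_real:
  assumes "(f has_real_derivative d) (at x)"
  shows "frechet_derivative f (at x) v = d * v"
  using frechet_derivative_at[OF assms[unfolded has_field_derivative_def]] by metis

lemma smooth_on_deriv:
  fixes f :: "real \<Rightarrow> real"
  assumes "open U" "smooth_on f U"
  shows "x \<in> U \<Longrightarrow> (f has_real_derivative deriv f x) (at x)" "smooth_on (deriv f) U"
proof -
  show *: "(f has_real_derivative deriv f x) (at x)" if "x \<in> U" for x
    using smooth_on_differentiable[OF assms(2) that] DERIV_imp_deriv real_differentiableE by metis
  show "smooth_on (deriv f) U"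
    by (rule smooth_on_cong[OF assms(1) _ smooth_on_frechet_derivative[OF assms(2), of 1]])
      (simp add: frechet_derivative_real[OF *])
qed

text \<open>Bootstrapping: if \<open>f\<close> is C^k, so is its derivative F(f), hence
  \<open>f\<close> is C^(k+1). This yields smoothness of \<open>exp\<close>, \<open>sqrt\<close> and
  inverse functions from the equations they satisfy.\<close>

lemma smooth_on_ode:
  fixes f F :: "real \<Rightarrow> real"
  assumes "open U" "open V" "f ` U \<subseteq> V" "smooth_on F V"
    and f: "\<And>x. x \<in> U \<Longrightarrow> (f has_real_derivative F (f x)) (at x)"
  shows "smooth_on f U"
  unfolding smooth_on_def
proof
  fix k show "Ck_on k f U"
  proof (induction k)
    case 0
    have "continuous_on U f"
      using f DERIV_isCont continuous_at_imp_continuous_on by blast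
    then show ?case by simp
  next
    case (Suc k)
    show ?case
    proof (rule Ck_on_Suc_has_derivative[OF assms(1), where f'="\<lambda>x v. F (f x) * v"])
      show "(f has_derivative (*) (F (f x))) (at x)" if "x \<in> U" for x
        using f[OF that] by (simp add: has_field_derivative_def)
      fix v
      show "Ck_on k (\<lambda>x. F (f x) * v) U"
        using bounded_bilinear.Ck_on[OF bounded_bilinear_mult assms(1)
            Ck_on_compose[OF assms(1-3) _ Suc, of F] Ck_on_const[of k v]] assms(4)
        unfolding smooth_on_def by blast
    qed
  qed
qed

lemma smooth_on_antiderivative:
  fixes f :: "real \<Rightarrow> real"
  assumes "open U" "\<And>x. x \<in> U \<Longrightarrow> (f has_real_derivative f' x) (at x)" "smooth_on f' U"
  shows "smooth_on f U"
  unfolding smooth_on_def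
proof
  fix k show "Ck_on k f U"
  proof (cases k)
    case 0
    have "continuous_on U f"
      using assms(2) DERIV_isCont continuous_at_imp_continuous_on by blast
    with 0 show ?thesis by simp
  next
    case (Suc j)
    have "Ck_on (Suc j) f U"
    proof (rule Ck_on_Suc_has_derivative[OF assms(1), where f'="\<lambda>x v. f' x * v"])
      show "(f has_derivative (*) (f' x)) (at x)" if "x \<in> U" for x
        using assms(2)[OF that] by (simp add: has_field_derivative_def)
      show "Ck_on j (\<lambda>x. f' x * v) U" for v
        using smooth_on_mult[OF assms(1,3) smooth_on_const] by (simp add: smooth_on_def)
    qed
    with Suc show ?thesis by simp
  qed
qed

section \<open>Reciprocals, quotients and inverse functions\<close>

lemma smooth_on_inverse_real: "smooth_on (inverse :: real \<Rightarrow> real) (- {0})"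
  unfolding smooth_on_def
proof
  have o: "open (- {0::real})" by (simp add: open_Compl)
  fix k show "Ck_on k (inverse :: real \<Rightarrow> real) (- {0})"
  proof (induction k)
    case 0
    then show ?case by (auto intro!: continuous_intros)
  next
    case (Suc k)
    have "(inverse has_derivative (\<lambda>v. - (inverse x * v * inverse x))) (at x)" if "x \<in> - {0::real}" for x
      using has_derivative_inverse' that by auto
    hence "(inverse has_derivative (\<lambda>v. inverse x * (- v) * inverse x)) (at x)" if "x \<in> - {0::real}" for x
      using that by simp
    thus ?case
    proof (rule Ck_on_Suc_has_derivative[OF o])
      show "Ck_on k (\<lambda>x. inverse x * - v * inverse x) (- {0::real})" for v
        by (intro bounded_bilinear.Ck_on[OF bounded_bilinear_mult] o Suc Ck_on_const)
    qed
  qed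
qed

lemma smooth_on_inverse:
  fixes f :: "'a::real_normed_vector \<Rightarrow> real"
  assumes "open U" "smooth_on f U" "\<And>x. x \<in> U \<Longrightarrow> f x \<noteq> 0"
  shows "smooth_on (\<lambda>x. inverse (f x)) U"
  by (rule smooth_on_compose[OF assms(1) _ _ smooth_on_inverse_real assms(2)])
    (use assms(3) in \<open>auto simp: open_Compl\<close>)

lemma smooth_on_divide:
  fixes f g :: "'a::real_normed_vector \<Rightarrow> real"
  assumes "open U" "smooth_on f U" "smooth_on g U" "\<And>x. x \<in> U \<Longrightarrow> g x \<noteq> 0"
  shows "smooth_on (\<lambda>x. f x / g x) U"
  unfolding divide_inverse by (intro smooth_on_mult smooth_on_inverse assms)

text \<open>The inverse function y solves y' = 1 / f'(y), so \<open>smooth_on_ode\<close> upgrades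
  differentiability to smoothness. Openness of the image is invariance of domain.\<close>

lemma smooth_inverse_function:
  fixes f :: "real \<Rightarrow> real"
  assumes "open I" "smooth_on f I" "inj_on f I" "\<And>s. s \<in> I \<Longrightarrow> deriv f s \<noteq> 0"
  shows "open (f ` I)"
    and "s \<in> I \<Longrightarrow> (inv_into I f has_real_derivative inverse (deriv f s)) (at (f s))"
    and "smooth_on (inv_into I f) (f ` I)"
proof -
  show o: "open (f ` I)"
    using invariance_of_domain smooth_on_imp_continuous_on[OF assms(2)] assms by blast
  show der: "(inv_into I f has_real_derivative inverse (deriv f s)) (at (f s))" if "s \<in> I" for s
    unfolding has_field_derivative_def
  proof (rule has_derivative_inverse_strong[where f=f and x=s and S=I])
    show "(f has_derivative (*) (deriv f s)) (at s)"
      using smooth_on_deriv(1)[OF assms(1,2) that] by (simp add: has_field_derivative_def)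
  qed (use assms that smooth_on_imp_continuous_on[OF assms(2)] in \<open>auto simp: fun_eq_iff\<close>)
  show "smooth_on (inv_into I f) (f ` I)"
    by (rule smooth_on_ode[OF o assms(1) _ smooth_on_inverse[OF assms(1) smooth_on_deriv(2)[OF assms(1,2)]]])
      (use assms der in auto)
qed

section \<open>Submanifolds with a global chart\<close>

text \<open>The left inverse \<open>\<Psi>\<close> lives on an ambient open set \<open>W\<close>
  containing the image, not only on the image: it then supplies the local extensions required by
  \<open>smooth_map_on\<close>, and its derivative inverts that of \<open>\<Phi>\<close>.\<close>

locale global_chart =
  fixes U :: "'a::euclidean_space set" and W :: "'b::euclidean_space set"
    and \<Phi> :: "'a \<Rightarrow> 'b" and \<Psi> :: "'b \<Rightarrow> 'a"
  assumes open_U: "open U" and open_W: "open W"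
    and smooth_\<Phi>: "smooth_on \<Phi> U" and smooth_\<Psi>: "smooth_on \<Psi> W"
    and \<Phi>_in_W: "x \<in> U \<Longrightarrow> \<Phi> x \<in> W" and \<Psi>_in_U: "y \<in> W \<Longrightarrow> \<Psi> y \<in> U"
    and \<Psi>_\<Phi>: "x \<in> U \<Longrightarrow> \<Psi> (\<Phi> x) = x"
begin

abbreviation M :: "'b set" where "M \<equiv> \<Phi> ` U"

definition d\<Phi> :: "'a \<Rightarrow> 'a \<Rightarrow> 'b" where
  "d\<Phi> x = frechet_derivative \<Phi> (at x)"

text \<open>Differentiating \<open>\<Psi>\<close> recovers the components of a tangent vector
  without choosing a preimage under \<open>d\<Phi>\<close>, so that their smooth dependence on the
  point can be read off.\<close>

definition coord :: "('b \<Rightarrow> 'b) \<Rightarrow> 'a \<Rightarrow> 'a" where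
  "coord X x = frechet_derivative \<Psi> (at (\<Phi> x)) (X (\<Phi> x))"

definition push :: "('a \<Rightarrow> 'a) \<Rightarrow> 'b \<Rightarrow> 'b" where
  "push V p = d\<Phi> (\<Psi> p) (V (\<Psi> p))"

lemma has_derivative_\<Phi>: "x \<in> U \<Longrightarrow> (\<Phi> has_derivative d\<Phi> x) (at x)"
  unfolding d\<Phi>_def by (rule smooth_on_has_derivative[OF smooth_\<Phi>])

lemma linear_d\<Phi>: "x \<in> U \<Longrightarrow> linear (d\<Phi> x)"
  using has_derivative_\<Phi> has_derivative_linear by blast

lemma d\<Psi>_d\<Phi> [simp]:
  assumes "x \<in> U"
  shows "frechet_derivative \<Psi> (at (\<Phi> x)) (d\<Phi> x v) = v"
proof -
  have "((\<lambda>x. \<Psi> (\<Phi> x)) has_derivative (\<lambda>v. frechet_derivative \<Psi> (at (\<Phi> x)) (d\<Phi> x v))) (at x)"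
    using has_derivative_compose[OF has_derivative_\<Phi>[OF assms]
        smooth_on_has_derivative[OF smooth_\<Psi> \<Phi>_in_W[OF assms]]] .
  hence "((\<lambda>x. x) has_derivative (\<lambda>v. frechet_derivative \<Psi> (at (\<Phi> x)) (d\<Phi> x v))) (at x)"
    by (rule has_derivative_transform_within_open[OF _ open_U assms]) (simp add: \<Psi>_\<Phi>)
  thus ?thesis using has_derivative_unique has_derivative_ident by metis
qed

lemma d\<Phi>_eq_iff: "x \<in> U \<Longrightarrow> d\<Phi> x v = d\<Phi> x w \<longleftrightarrow> v = w"
  using d\<Psi>_d\<Phi> by metis

text \<open>A curve c in \<open>M\<close> equals \<Phi>(\<Psi>(c)), so its velocity lies in the
  range of \<open>d\<Phi> x\<close>; conversely every vector there is the velocity of the image of a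
  straight segment.\<close>

lemma tangent_space_M:
  assumes "x \<in> U"
  shows "tangent_space M (\<Phi> x) = range (d\<Phi> x)"
proof (intro subset_antisym subsetI)
  fix v assume "v \<in> tangent_space M (\<Phi> x)"
  then obtain c \<epsilon> where c: "\<epsilon> > 0" "c ` {-\<epsilon><..<\<epsilon>} \<subseteq> M" "c 0 = \<Phi> x"
    "(c has_vector_derivative v) (at (0::real))"
    unfolding tangent_space_def by blast
  let ?d = "\<lambda>\<tau>. \<Psi> (c \<tau>)"
  have "(?d has_derivative (\<lambda>\<tau>. frechet_derivative \<Psi> (at (\<Phi> x)) (\<tau> *\<^sub>R v))) (at 0)"
    by (rule has_derivative_compose[OF c(4)[unfolded has_vector_derivative_def]])
      (simp add: c(3) smooth_on_has_derivative[OF smooth_\<Psi> \<Phi>_in_W[OF assms]])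
  hence "((\<lambda>\<tau>. \<Phi> (?d \<tau>)) has_derivative
      (\<lambda>\<tau>. d\<Phi> x (frechet_derivative \<Psi> (at (\<Phi> x)) (\<tau> *\<^sub>R v)))) (at 0)"
    by (rule has_derivative_compose) (simp add: c(3) \<Psi>_\<Phi> assms has_derivative_\<Phi>)
  hence "(c has_derivative (\<lambda>\<tau>. d\<Phi> x (frechet_derivative \<Psi> (at (\<Phi> x)) (\<tau> *\<^sub>R v)))) (at 0)"
    by (rule has_derivative_transform_within_open[where s="{-\<epsilon><..<\<epsilon>}"])
      (use c(1,2) \<Psi>_\<Phi> in \<open>force+\<close>)
  hence "(\<lambda>\<tau>. \<tau> *\<^sub>R v) = (\<lambda>\<tau>. d\<Phi> x (frechet_derivative \<Psi> (at (\<Phi> x)) (\<tau> *\<^sub>R v)))"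
    using has_derivative_unique c(4)[unfolded has_vector_derivative_def] by blast
  from fun_cong[OF this, of 1] show "v \<in> range (d\<Phi> x)" by simp
next
  fix v assume "v \<in> range (d\<Phi> x)"
  then obtain u where u: "v = d\<Phi> x u" by blast
  define c where "c \<tau> = \<Phi> (x + \<tau> *\<^sub>R u)" for \<tau>
  have line: "bounded_linear (\<lambda>\<tau>. \<tau> *\<^sub>R u)" by (rule bounded_linear_scaleR_left)
  define S where "S = (\<lambda>\<tau>. x + \<tau> *\<^sub>R u) -` U"
  have "open S" unfolding S_def
    by (intro continuous_open_vimage continuous_intros open_U)
  moreover have "0 \<in> S" using assms by (simp add: S_def)
  ultimately obtain \<epsilon> where e: "\<epsilon> > 0" "ball 0 \<epsilon> \<subseteq> S" using openE by blast
  hence S: "{-\<epsilon><..<\<epsilon>} \<subseteq> S" by (auto simp: subset_iff)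
  have "smooth_on c S" unfolding c_def
    by (rule smooth_on_compose[OF \<open>open S\<close> open_U _ smooth_\<Phi> smooth_on_add[OF \<open>open S\<close> smooth_on_const
            smooth_on_bounded_linear[OF line]]])
      (auto simp: S_def)
  hence "smooth_on c {-\<epsilon><..<\<epsilon>}" using smooth_on_subset S by blast
  moreover have "c ` {-\<epsilon><..<\<epsilon>} \<subseteq> M" using S by (auto simp: c_def S_def)
  moreover have "c 0 = \<Phi> x" by (simp add: c_def)
  moreover have "(c has_vector_derivative v) (at 0)"
  proof -
    have "((\<lambda>\<tau>. x + \<tau> *\<^sub>R u) has_derivative (\<lambda>\<tau>. \<tau> *\<^sub>R u)) (at 0)"
      by (auto intro!: derivative_eq_intros)
    hence "(c has_derivative (\<lambda>\<tau>. d\<Phi> x (\<tau> *\<^sub>R u))) (at 0)" unfolding c_def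
      by (rule has_derivative_compose) (simp add: has_derivative_\<Phi> assms)
    thus ?thesis by (simp add: has_vector_derivative_def u linear_scale[OF linear_d\<Phi>[OF assms]])
  qed
  ultimately show "v \<in> tangent_space M (\<Phi> x)" using e(1) unfolding tangent_space_def by blast
qed

text \<open>For the converse, the composition of \<open>f\<close>, \<open>\<Phi>\<close> and
  \<open>\<Psi>\<close> is an extension on all of \<open>W\<close>.\<close>

lemma smooth_map_on_M_iff:
  fixes f :: "'b \<Rightarrow> 'c::euclidean_space"
  shows "smooth_map_on f M \<longleftrightarrow> smooth_on (\<lambda>x. f (\<Phi> x)) U"
proof
  assume f: "smooth_map_on f M"
  show "smooth_on (\<lambda>x. f (\<Phi> x)) U"
  proof (rule smooth_on_local[OF open_U])
    fix x assume "x \<in> U"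
    then obtain V F where V: "open V" "\<Phi> x \<in> V" "smooth_on F V" "\<forall>y\<in>V \<inter> M. F y = f y"
      using f unfolding smooth_map_on_def by blast
    have o: "open (U \<inter> \<Phi> -` V)"
      by (rule continuous_open_preimage[OF smooth_on_imp_continuous_on[OF smooth_\<Phi>] open_U V(1)])
    have "smooth_on (\<lambda>x. F (\<Phi> x)) (U \<inter> \<Phi> -` V)"
      by (rule smooth_on_compose[OF o V(1) _ V(3)]) (auto intro: smooth_on_subset[OF smooth_\<Phi>])
    hence "smooth_on (\<lambda>x. f (\<Phi> x)) (U \<inter> \<Phi> -` V)"
      by (rule smooth_on_cong[OF o, rotated]) (use V(4) in auto)
    thus "\<exists>V. open V \<and> x \<in> V \<and> smooth_on (\<lambda>x. f (\<Phi> x)) V"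
      using o V(2) \<open>x \<in> U\<close> by blast
  qed
next
  assume f: "smooth_on (\<lambda>x. f (\<Phi> x)) U"
  have "smooth_on (\<lambda>y. f (\<Phi> (\<Psi> y))) W"
    by (rule smooth_on_compose[OF open_W open_U _ f smooth_\<Psi>]) (auto simp: \<Psi>_in_U)
  moreover have "\<forall>y\<in>W \<inter> M. f (\<Phi> (\<Psi> y)) = f y" by (auto simp: \<Psi>_\<Phi>)
  ultimately show "smooth_map_on f M"
    unfolding smooth_map_on_def using open_W \<Phi>_in_W by blast
qed

text \<open>A local extension shows that \<open>f\<close> is differentiable within \<open>M\<close>.
  Whichever derivative is then selected there, the chain rule along \<open>\<Phi>\<close> determines
  its values on tangent vectors.\<close>

lemma deriv_along_M:
  fixes f :: "'b \<Rightarrow> 'c::euclidean_space"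
  assumes "smooth_map_on f M" "x \<in> U"
  shows "deriv_along M f (\<Phi> x) (d\<Phi> x v) = frechet_derivative (\<lambda>x. f (\<Phi> x)) (at x) v"
proof -
  obtain V F where V: "open V" "\<Phi> x \<in> V" "smooth_on F V" "\<forall>y\<in>V \<inter> M. F y = f y"
    using assms unfolding smooth_map_on_def by blast
  have "(F has_derivative frechet_derivative F (at (\<Phi> x))) (at (\<Phi> x) within M)"
    using smooth_on_has_derivative[OF V(3,2)] has_derivative_at_withinI by blast
  hence "(f has_derivative frechet_derivative F (at (\<Phi> x))) (at (\<Phi> x) within M)"
    by (rule has_derivative_transform_eventually)
      (use V assms(2) in \<open>auto simp: eventually_at_topological\<close>)
  hence "(f has_derivative frechet_derivative f (at (\<Phi> x) within M)) (at (\<Phi> x) within M)"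
    using differentiableI frechet_derivative_works by blast
  hence "((f \<circ> \<Phi>) has_derivative (frechet_derivative f (at (\<Phi> x) within M) \<circ> d\<Phi> x)) (at x within U)"
    using diff_chain_within has_derivative_at_withinI[OF has_derivative_\<Phi>[OF assms(2)]] by blast
  hence "((\<lambda>x. f (\<Phi> x)) has_derivative (\<lambda>v. frechet_derivative f (at (\<Phi> x) within M) (d\<Phi> x v))) (at x)"
    using at_within_open[OF assms(2) open_U] by (simp add: o_def)
  thus ?thesis unfolding deriv_along_def using frechet_derivative_at by metis
qed

lemma vector_field_M:
  assumes "X \<in> vector_fields M"
  shows "smooth_on (coord X) U" and "x \<in> U \<Longrightarrow> X (\<Phi> x) = d\<Phi> x (coord X x)"
proof -
  have "smooth_on (\<lambda>x. X (\<Phi> x)) U"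
    using assms smooth_map_on_M_iff unfolding vector_fields_def by blast
  thus "smooth_on (coord X) U"
    unfolding coord_def
    by (intro smooth_on_pushforward[OF open_U open_W smooth_\<Psi> smooth_\<Phi>]) (auto simp: \<Phi>_in_W)
  show "X (\<Phi> x) = d\<Phi> x (coord X x)" if "x \<in> U"
  proof -
    have "X (\<Phi> x) \<in> range (d\<Phi> x)"
      using assms tangent_space_M[OF that] that unfolding vector_fields_def by blast
    thus ?thesis using that by (auto simp: coord_def)
  qed
qed

lemma has_derivative_coord:
  assumes "X \<in> vector_fields M" "x \<in> U"
  shows "(coord X has_derivative frechet_derivative (coord X) (at x)) (at x)"
  using smooth_on_has_derivative[OF vector_field_M(1)] assms by blast

lemma vector_fieldI:
  assumes "smooth_on V U" "\<And>x. x \<in> U \<Longrightarrow> X (\<Phi> x) = d\<Phi> x (V x)"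
  shows "X \<in> vector_fields M" and "x \<in> U \<Longrightarrow> coord X x = V x"
proof -
  have "smooth_on (\<lambda>x. frechet_derivative \<Phi> (at x) (V x)) U"
    by (rule smooth_on_pushforward[OF open_U open_U smooth_\<Phi> smooth_on_ident _ assms(1)]) auto
  hence "smooth_on (\<lambda>x. X (\<Phi> x)) U"
    by (rule smooth_on_cong[OF open_U, rotated]) (simp add: assms(2) d\<Phi>_def)
  thus "X \<in> vector_fields M"
    unfolding vector_fields_def using smooth_map_on_M_iff tangent_space_M assms(2) by auto
  show "coord X x = V x" if "x \<in> U" using assms(2) that by (simp add: coord_def)
qed

lemma push:
  assumes "smooth_on V U"
  shows "push V \<in> vector_fields M" and "x \<in> U \<Longrightarrow> coord (push V) x = V x"
    and "x \<in> U \<Longrightarrow> push V (\<Phi> x) = d\<Phi> x (V x)"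
proof -
  show *: "push V (\<Phi> x) = d\<Phi> x (V x)" if "x \<in> U" for x
    using that by (simp add: push_def \<Psi>_\<Phi>)
  show "push V \<in> vector_fields M" "x \<in> U \<Longrightarrow> coord (push V) x = V x"
    using vector_fieldI[OF assms] * by blast+
qed

lemma has_derivative_d\<Phi>:
  assumes "x \<in> U" "(V has_derivative V') (at x)"
  shows "((\<lambda>y. d\<Phi> y (V y)) has_derivative
    (\<lambda>v. d\<Phi> x (V' v) + frechet_derivative (\<lambda>y. d\<Phi> y (V x)) (at x) v)) (at x)"
  unfolding d\<Phi>_def by (rule frechet_derivative_of_frechet_derivative[OF open_U smooth_\<Phi> assms])

text \<open>Differentiating Z = d\<Phi>(coord Z) in the ambient space adds a second derivative of
  \<open>\<Phi>\<close>; it is symmetric and drops out of the commutator.\<close>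

lemma lie_bracket_M:
  assumes "X \<in> vector_fields M" "Y \<in> vector_fields M"
  shows "x \<in> U \<Longrightarrow> lie_bracket M X Y (\<Phi> x) = d\<Phi> x
      (frechet_derivative (coord Y) (at x) (coord X x) - frechet_derivative (coord X) (at x) (coord Y x))"
    and "lie_bracket M X Y \<in> vector_fields M"
    and "x \<in> U \<Longrightarrow> coord (lie_bracket M X Y) x =
      frechet_derivative (coord Y) (at x) (coord X x) - frechet_derivative (coord X) (at x) (coord Y x)"
proof -
  have der: "deriv_along M Z (\<Phi> x) (d\<Phi> x v) = d\<Phi> x (frechet_derivative (coord Z) (at x) v) +
      frechet_derivative (\<lambda>y. d\<Phi> y (coord Z x)) (at x) v"
    if Z: "Z \<in> vector_fields M" and x: "x \<in> U" for Z x v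
  proof -
    have "((\<lambda>y. Z (\<Phi> y)) has_derivative (\<lambda>v. d\<Phi> x (frechet_derivative (coord Z) (at x) v) +
        frechet_derivative (\<lambda>y. d\<Phi> y (coord Z x)) (at x) v)) (at x)"
      by (rule has_derivative_transform_within_open[OF has_derivative_d\<Phi>[OF x has_derivative_coord[OF Z x]] open_U x])
        (simp add: vector_field_M(2)[OF Z])
    note D = frechet_derivative_at[OF this, symmetric]
    have "smooth_map_on Z M" using Z unfolding vector_fields_def by blast
    from deriv_along_M[OF this x, of v] show ?thesis by (simp only: D)
  qed
  let ?B = "\<lambda>x. frechet_derivative (coord Y) (at x) (coord X x) - frechet_derivative (coord X) (at x) (coord Y x)"
  show *: "lie_bracket M X Y (\<Phi> x) = d\<Phi> x (?B x)" if "x \<in> U" for x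
    using that second_derivative_symmetric[OF open_U smooth_\<Phi> that, folded d\<Phi>_def, of "coord X x" "coord Y x"]
    by (simp add: lie_bracket_def vector_field_M(2) assms der linear_diff[OF linear_d\<Phi>])
  have "smooth_on ?B U"
    by (intro smooth_on_diff smooth_on_pushforward[OF open_U open_U] smooth_on_ident
        vector_field_M assms open_U) auto
  from vector_fieldI[OF this *]
  show "lie_bracket M X Y \<in> vector_fields M" "x \<in> U \<Longrightarrow> coord (lie_bracket M X Y) x = ?B x"
    by blast+
qed

end

section \<open>The Levi-Civita connection in a global chart\<close>

text \<open>\<open>G\<close> is the metric in the chart, \<open>\<Gamma>\<close> its Christoffel symbol and \<open>d\<Gamma>\<close> the derivative of \<open>\<Gamma>\<close>.\<close>

locale chart_connection = global_chart U W \<Phi> \<Psi>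
  for U :: "'a::euclidean_space set" and W :: "'b::euclidean_space set" and \<Phi> \<Psi> +
  fixes g :: "'b \<Rightarrow> 'b \<Rightarrow> 'b \<Rightarrow> real" and G :: "'a \<Rightarrow> 'a \<Rightarrow> 'a \<Rightarrow> real"
    and \<Gamma> :: "'a \<Rightarrow> 'a \<Rightarrow> 'a \<Rightarrow> 'a" and d\<Gamma> :: "'a \<Rightarrow> 'a \<Rightarrow> 'a \<Rightarrow> 'a \<Rightarrow> 'a"
    and nabla :: "('b \<Rightarrow> 'b) \<Rightarrow> ('b \<Rightarrow> 'b) \<Rightarrow> 'b \<Rightarrow> 'b"
  assumes g_eq: "x \<in> U \<Longrightarrow> g (\<Phi> x) (d\<Phi> x v) (d\<Phi> x w) = G x v w"
    and G_sym: "x \<in> U \<Longrightarrow> G x v w = G x w v"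
    and G_linear: "x \<in> U \<Longrightarrow> linear (\<lambda>v. G x v w)"
    and G_pos: "x \<in> U \<Longrightarrow> v \<noteq> 0 \<Longrightarrow> G x v v > 0"
    and G_smooth: "smooth_on V U \<Longrightarrow> smooth_on V' U \<Longrightarrow> smooth_on (\<lambda>x. G x (V x) (V' x)) U"
    and \<Gamma>_sym: "x \<in> U \<Longrightarrow> \<Gamma> x v w = \<Gamma> x w v"
    and \<Gamma>_linear: "x \<in> U \<Longrightarrow> linear (\<Gamma> x v)"
    and G_deriv: "x \<in> U \<Longrightarrow> (Y has_derivative Y') (at x) \<Longrightarrow> (Z has_derivative Z') (at x) \<Longrightarrow>
      ((\<lambda>y. G y (Y y) (Z y)) has_derivative
       (\<lambda>v. G x (Y' v + \<Gamma> x v (Y x)) (Z x) + G x (Y x) (Z' v + \<Gamma> x v (Z x)))) (at x)"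
    and \<Gamma>_deriv: "x \<in> U \<Longrightarrow> (Y has_derivative Y') (at x) \<Longrightarrow> (Z has_derivative Z') (at x) \<Longrightarrow>
      ((\<lambda>y. \<Gamma> y (Y y) (Z y)) has_derivative
       (\<lambda>v. d\<Gamma> x v (Y x) (Z x) + \<Gamma> x (Y' v) (Z x) + \<Gamma> x (Y x) (Z' v))) (at x)"
    and levi_civita: "levi_civita (\<Phi> ` U) g nabla"
begin

lemma riemannian_metric: "riemannian_metric M g"
proof -
  have "G x (\<alpha> *\<^sub>R u + \<beta> *\<^sub>R v) w = \<alpha> * G x u w + \<beta> * G x v w" if "x \<in> U" for x u v w \<alpha> \<beta>
    by (simp add: linear_add[OF G_linear[OF that]] linear_scale[OF G_linear[OF that]])
  hence "g (\<Phi> x) (\<alpha> *\<^sub>R d\<Phi> x u + \<beta> *\<^sub>R d\<Phi> x v) (d\<Phi> x w) =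
      \<alpha> * g (\<Phi> x) (d\<Phi> x u) (d\<Phi> x w) + \<beta> * g (\<Phi> x) (d\<Phi> x v) (d\<Phi> x w)"
    if "x \<in> U" for x u v w \<alpha> \<beta>
    using that by (simp add: g_eq linear_add[OF linear_d\<Phi>, symmetric]
        linear_scale[OF linear_d\<Phi>, symmetric])
  moreover have "smooth_map_on (\<lambda>p. g p (X p) (Y p)) M"
    if "X \<in> vector_fields M" "Y \<in> vector_fields M" for X Y
    unfolding smooth_map_on_M_iff
    by (rule smooth_on_cong[OF open_U _ G_smooth[OF that[THEN vector_field_M(1)]]])
      (simp add: vector_field_M(2) that g_eq)
  moreover have "g (\<Phi> x) (d\<Phi> x v) (d\<Phi> x v) > 0" if "x \<in> U" "d\<Phi> x v \<noteq> 0" for x v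
    using that G_pos[of x v] linear_0[OF linear_d\<Phi>[of x]] by (auto simp: g_eq)
  ultimately show ?thesis
    unfolding riemannian_metric_def by (auto simp: tangent_space_M g_eq G_sym)
qed

lemma nabla_closed: "X \<in> vector_fields M \<Longrightarrow> Y \<in> vector_fields M \<Longrightarrow> nabla X Y \<in> vector_fields M"
  using levi_civita[unfolded levi_civita_def, THEN conjunct1, unfolded affine_connection_def, THEN conjunct1]
  by blast

lemma torsion_free:
  "X \<in> vector_fields M \<Longrightarrow> Y \<in> vector_fields M \<Longrightarrow> p \<in> M \<Longrightarrow>
    nabla X Y p - nabla Y X p = lie_bracket M X Y p"
  using conjunct1[OF conjunct2[OF levi_civita[unfolded levi_civita_def]]] by blast

lemma nabla_metric:
  "X \<in> vector_fields M \<Longrightarrow> Y \<in> vector_fields M \<Longrightarrow> Z \<in> vector_fields M \<Longrightarrow> p \<in> M \<Longrightarrow>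
    deriv_along M (\<lambda>x. g x (Y x) (Z x)) p (X p) = g p (nabla X Y p) (Z p) + g p (Y p) (nabla X Z p)"
  using conjunct2[OF conjunct2[OF levi_civita[unfolded levi_civita_def]]] by blast

text \<open>The difference \<open>\<tau>(X, Y, Z)\<close> of the two connections is symmetric in \<open>X, Y\<close> because both are
  torsion free and antisymmetric in \<open>Y, Z\<close> because both are metric, hence vanishes.\<close>

lemma coord_nabla:
  assumes X: "X \<in> vector_fields M" and Y: "Y \<in> vector_fields M" and x: "x \<in> U"
  shows "coord (nabla X Y) x = frechet_derivative (coord Y) (at x) (coord X x) + \<Gamma> x (coord X x) (coord Y x)"
proof -
  define N where "N X Y = frechet_derivative (coord Y) (at x) (coord X x) + \<Gamma> x (coord X x) (coord Y x)" for X Y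
  define \<tau> where "\<tau> X Y Z = G x (coord (nabla X Y) x - N X Y) (coord Z x)" for X Y Z
  have sym: "\<tau> X Y Z = \<tau> Y X Z" if "X \<in> vector_fields M" "Y \<in> vector_fields M" for X Y Z
  proof -
    have "nabla X Y (\<Phi> x) - nabla Y X (\<Phi> x) = lie_bracket M X Y (\<Phi> x)"
      using that x by (intro torsion_free) auto
    hence "d\<Phi> x (coord (nabla X Y) x - coord (nabla Y X) x) = d\<Phi> x (N X Y - N Y X)"
      using that x \<Gamma>_sym[OF x, of "coord X x"]
      by (simp add: vector_field_M(2) nabla_closed lie_bracket_M(1) linear_diff[OF linear_d\<Phi>] N_def)
    hence "coord (nabla X Y) x - N X Y = coord (nabla Y X) x - N Y X"
      using x by (simp add: d\<Phi>_eq_iff algebra_simps)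
    thus ?thesis by (simp add: \<tau>_def)
  qed
  have anti: "\<tau> X Y Z = - \<tau> X Z Y"
    if V: "X \<in> vector_fields M" "Y \<in> vector_fields M" "Z \<in> vector_fields M" for X Y Z
  proof -
    have "deriv_along M (\<lambda>p. g p (Y p) (Z p)) (\<Phi> x) (X (\<Phi> x)) =
        g (\<Phi> x) (nabla X Y (\<Phi> x)) (Z (\<Phi> x)) + g (\<Phi> x) (Y (\<Phi> x)) (nabla X Z (\<Phi> x))"
      using V x by (intro nabla_metric) auto
    also have "\<dots> = G x (coord (nabla X Y) x) (coord Z x) + G x (coord Y x) (coord (nabla X Z) x)"
      using V x by (simp add: vector_field_M(2) nabla_closed g_eq)
    finally have "deriv_along M (\<lambda>p. g p (Y p) (Z p)) (\<Phi> x) (X (\<Phi> x)) = \<dots>" .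
    moreover have "deriv_along M (\<lambda>p. g p (Y p) (Z p)) (\<Phi> x) (X (\<Phi> x)) =
        G x (N X Y) (coord Z x) + G x (coord Y x) (N X Z)"
    proof -
      have "smooth_map_on (\<lambda>p. g p (Y p) (Z p)) M"
        using riemannian_metric V unfolding riemannian_metric_def by blast
      moreover have "((\<lambda>y. g (\<Phi> y) (Y (\<Phi> y)) (Z (\<Phi> y))) has_derivative
          (\<lambda>v. G x (frechet_derivative (coord Y) (at x) v + \<Gamma> x v (coord Y x)) (coord Z x) +
               G x (coord Y x) (frechet_derivative (coord Z) (at x) v + \<Gamma> x v (coord Z x)))) (at x)"
        by (rule has_derivative_transform_within_open[OF G_deriv[OF x has_derivative_coord[OF V(2) x]
                has_derivative_coord[OF V(3) x]] open_U x])
          (simp add: vector_field_M(2) V g_eq)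
      ultimately show ?thesis
        using x by (simp add: vector_field_M(2)[OF V(1)] deriv_along_M
            frechet_derivative_at[symmetric] N_def)
    qed
    ultimately show ?thesis
      unfolding \<tau>_def
      by (simp add: linear_diff[OF G_linear[OF x]] G_sym[OF x, of "coord Y x"])
  qed
  let ?T = "coord (nabla X Y) x - N X Y"
  \<comment> \<open>The test field takes the difference of the connections itself as its value at x,
    so that vanishing of \<open>\<tau>\<close> turns into \<open>G x ?T ?T = 0\<close>.\<close>
  let ?Z = "push (\<lambda>_. ?T)"
  have Z: "?Z \<in> vector_fields M" "coord ?Z x = ?T"
    using push[OF smooth_on_const] x by auto
  \<comment> \<open>The two rules alternate: XYZ = YXZ = -YZX = -ZYX = ZXY = XZY = -XYZ.\<close>
  have "\<tau> X Y ?Z = - \<tau> X Y ?Z"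
    using sym anti X Y Z(1) by metis
  hence "G x ?T ?T = 0" by (simp add: \<tau>_def Z(2))
  thus ?thesis using G_pos[OF x, of ?T] by (force simp: N_def)
qed

lemma nabla_M:
  assumes "X \<in> vector_fields M" "Y \<in> vector_fields M" "x \<in> U"
  shows "nabla X Y (\<Phi> x) =
    d\<Phi> x (frechet_derivative (coord Y) (at x) (coord X x) + \<Gamma> x (coord X x) (coord Y x))"
  using assms by (simp add: vector_field_M(2) nabla_closed coord_nabla)

text \<open>The chart formula uses only the value of the differentiating field at the point, and a
  field constant in the chart attains every tangent value, so the description has exactly one
  solution.\<close>

lemma cov_deriv_at_M:
  assumes "Y \<in> vector_fields M" "x \<in> U"
  shows "cov_deriv_at M nabla (\<Phi> x) (d\<Phi> x v) Y =
    d\<Phi> x (frechet_derivative (coord Y) (at x) v + \<Gamma> x v (coord Y x))"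
  unfolding cov_deriv_at_def
proof (rule the_equality)
  show "\<forall>X\<in>vector_fields M. X (\<Phi> x) = d\<Phi> x v \<longrightarrow>
      nabla X Y (\<Phi> x) = d\<Phi> x (frechet_derivative (coord Y) (at x) v + \<Gamma> x v (coord Y x))"
    using assms by (auto simp: nabla_M vector_field_M(2) d\<Phi>_eq_iff)
  fix w assume "\<forall>X\<in>vector_fields M. X (\<Phi> x) = d\<Phi> x v \<longrightarrow> nabla X Y (\<Phi> x) = w"
  moreover have "push (\<lambda>_. v) \<in> vector_fields M" "push (\<lambda>_. v) (\<Phi> x) = d\<Phi> x v" "coord (push (\<lambda>_. v)) x = v"
    using push[OF smooth_on_const] assms by auto
  ultimately show "w = d\<Phi> x (frechet_derivative (coord Y) (at x) v + \<Gamma> x v (coord Y x))"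
    using nabla_M assms by metis
qed

text \<open>The curvature tensor R(a, b)c in the chart, with components of fields replaced by fixed
  vectors.\<close>

definition curv :: "'a \<Rightarrow> 'a \<Rightarrow> 'a \<Rightarrow> 'a \<Rightarrow> 'a" where
  "curv x a b c = d\<Gamma> x a b c - d\<Gamma> x b a c + \<Gamma> x a (\<Gamma> x b c) - \<Gamma> x b (\<Gamma> x a c)"

text \<open>Tensoriality: second derivatives of Z cancel by symmetry, first derivatives of X and Y
  against the bracket term, and first derivatives of Z between the two iterated derivatives.\<close>

lemma curvature_op_M:
  assumes X: "X \<in> vector_fields M" and Y: "Y \<in> vector_fields M" and Z: "Z \<in> vector_fields M" and x: "x \<in> U"
  shows "curvature_op M nabla X Y Z (\<Phi> x) = d\<Phi> x (curv x (coord X x) (coord Y x) (coord Z x))"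
proof -
  let ?D = "\<lambda>X. frechet_derivative (coord X)"
  have D: "frechet_derivative (coord (nabla Y Z)) (at x) v =
      ?D Z (at x) (?D Y (at x) v) + frechet_derivative (\<lambda>y. ?D Z (at y) (coord Y x)) (at x) v +
      (d\<Gamma> x v (coord Y x) (coord Z x) + \<Gamma> x (?D Y (at x) v) (coord Z x) + \<Gamma> x (coord Y x) (?D Z (at x) v))"
    if Y: "Y \<in> vector_fields M" for Y v
  proof -
    note Y' = has_derivative_coord[OF Y x] and Z' = has_derivative_coord[OF Z x]
    have "(coord (nabla Y Z) has_derivative (\<lambda>v.
       ?D Z (at x) (?D Y (at x) v) + frechet_derivative (\<lambda>y. ?D Z (at y) (coord Y x)) (at x) v +
      (d\<Gamma> x v (coord Y x) (coord Z x) + \<Gamma> x (?D Y (at x) v) (coord Z x) + \<Gamma> x (coord Y x) (?D Z (at x) v)))) (at x)"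
      by (rule has_derivative_transform_within_open[OF has_derivative_add[OF
          frechet_derivative_of_frechet_derivative[OF open_U vector_field_M(1)[OF Z] x Y']
          \<Gamma>_deriv[OF x Y' Z']] open_U x])
        (simp add: coord_nabla Y Z)
    from frechet_derivative_at[OF this, symmetric] show ?thesis by simp
  qed
  have lin: "\<Gamma> x a (b + c) = \<Gamma> x a b + \<Gamma> x a c" "\<Gamma> x (b - c) a = \<Gamma> x b a - \<Gamma> x c a" for a b c
    using \<Gamma>_linear[OF x, of a] \<Gamma>_sym[OF x, of _ a] by (auto simp: linear_add linear_diff)
  have "linear (?D Z (at x))"
    using has_derivative_coord[OF Z x] has_derivative_linear by blast
  note DZ = linear_diff[OF this]
  note sym2 = second_derivative_symmetric[OF open_U vector_field_M(1)[OF Z] x, of "coord X x" "coord Y x"]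
  show ?thesis
    unfolding curvature_op_def
    using X Y Z x
    apply (simp add: nabla_M nabla_closed lie_bracket_M coord_nabla linear_diff[OF linear_d\<Phi>, symmetric] D d\<Phi>_eq_iff curv_def)
    apply (simp add: lin DZ sym2 algebra_simps)
    done
qed

text \<open>A constant quotient over all bases of E makes \<open>\<kappa>\<close> a solution of the
  description; the basis \<open>a0\<close>, \<open>b0\<close> extends to fields and makes it the
  only one.\<close>

lemma sectional_curvature_M:
  assumes x: "x \<in> U" and E: "E = span {d\<Phi> x a0, d\<Phi> x b0}"
    and \<kappa>: "\<And>a b. span {d\<Phi> x a, d\<Phi> x b} = E \<Longrightarrow>
      G x (curv x a b b) a / (G x a a * G x b b - (G x a b)\<^sup>2) = \<kappa>"
  shows "sectional_curvature M g nabla (\<Phi> x) E = \<kappa>"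
  unfolding sectional_curvature_def
proof (rule the_equality)
  have *: "g (\<Phi> x) (curvature_op M nabla X Y Y (\<Phi> x)) (X (\<Phi> x)) /
            (g (\<Phi> x) (X (\<Phi> x)) (X (\<Phi> x)) * g (\<Phi> x) (Y (\<Phi> x)) (Y (\<Phi> x)) - (g (\<Phi> x) (X (\<Phi> x)) (Y (\<Phi> x)))\<^sup>2) = \<kappa>"
    if V: "X \<in> vector_fields M" "Y \<in> vector_fields M" and s: "span {X (\<Phi> x), Y (\<Phi> x)} = E" for X Y
    using \<kappa>[of "coord X x" "coord Y x"] s
    by (simp add: vector_field_M(2)[OF V(1) x] vector_field_M(2)[OF V(2) x] curvature_op_M V x g_eq)
  thus "\<forall>X\<in>vector_fields M. \<forall>Y\<in>vector_fields M. span {X (\<Phi> x), Y (\<Phi> x)} = E \<longrightarrow>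
        \<kappa> = g (\<Phi> x) (curvature_op M nabla X Y Y (\<Phi> x)) (X (\<Phi> x)) /
            (g (\<Phi> x) (X (\<Phi> x)) (X (\<Phi> x)) * g (\<Phi> x) (Y (\<Phi> x)) (Y (\<Phi> x)) - (g (\<Phi> x) (X (\<Phi> x)) (Y (\<Phi> x)))\<^sup>2)"
    by metis
  fix \<kappa>' assume k: "\<forall>X\<in>vector_fields M. \<forall>Y\<in>vector_fields M. span {X (\<Phi> x), Y (\<Phi> x)} = E \<longrightarrow>
        \<kappa>' = g (\<Phi> x) (curvature_op M nabla X Y Y (\<Phi> x)) (X (\<Phi> x)) /
            (g (\<Phi> x) (X (\<Phi> x)) (X (\<Phi> x)) * g (\<Phi> x) (Y (\<Phi> x)) (Y (\<Phi> x)) - (g (\<Phi> x) (X (\<Phi> x)) (Y (\<Phi> x)))\<^sup>2)"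
  have V: "push (\<lambda>_. c) \<in> vector_fields M" "push (\<lambda>_. c) (\<Phi> x) = d\<Phi> x c" for c
    using push[OF smooth_on_const] x by auto
  have s: "span {push (\<lambda>_. a0) (\<Phi> x), push (\<lambda>_. b0) (\<Phi> x)} = E" by (simp add: V E)
  show "\<kappa>' = \<kappa>" using k V(1) s *[OF V(1) V(1) s] by metis
qed

text \<open>In the chart the complex structure is the constant map \<open>j\<close>, so its
  parallelism reduces to \<open>\<Gamma>\<close> commuting with \<open>j\<close> in the second
  argument.\<close>

lemma kaehler_metric_M:
  assumes j: "linear j" "\<And>v. j (j v) = - v"
    and Gj: "\<And>x v w. x \<in> U \<Longrightarrow> G x (j v) (j w) = G x v w"
    and \<Gamma>j: "\<And>x v w. x \<in> U \<Longrightarrow> \<Gamma> x v (j w) = j (\<Gamma> x v w)"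
    and J: "\<And>x v. x \<in> U \<Longrightarrow> J (\<Phi> x) (d\<Phi> x v) = d\<Phi> x (j v)"
  shows "kaehler_metric M g J nabla"
proof -
  have blj: "bounded_linear j" using j(1) linear_conv_bounded_linear by blast
  have JV: "(\<lambda>p. J p (X p)) \<in> vector_fields M" "\<And>x. x \<in> U \<Longrightarrow> coord (\<lambda>p. J p (X p)) x = j (coord X x)"
    if X: "X \<in> vector_fields M" for X
  proof -
    have "J (\<Phi> x) (X (\<Phi> x)) = d\<Phi> x (j (coord X x))" if "x \<in> U" for x
      using vector_field_M(2)[OF X that] J[OF that] by simp
    from vector_fieldI[OF smooth_on_linear_compose[OF blj open_U vector_field_M(1)[OF X]] this]
    show "(\<lambda>p. J p (X p)) \<in> vector_fields M" "\<And>x. x \<in> U \<Longrightarrow> coord (\<lambda>p. J p (X p)) x = j (coord X x)"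
      by auto
  qed
  have "nabla X (\<lambda>p. J p (Y p)) (\<Phi> x) = J (\<Phi> x) (nabla X Y (\<Phi> x))"
    if V: "X \<in> vector_fields M" "Y \<in> vector_fields M" and x: "x \<in> U" for X Y x
  proof -
    have "((\<lambda>y. j (coord Y y)) has_derivative (\<lambda>v. j (frechet_derivative (coord Y) (at x) v))) (at x)"
      by (rule bounded_linear.has_derivative[OF blj has_derivative_coord[OF V(2) x]])
    hence "(coord (\<lambda>p. J p (Y p)) has_derivative (\<lambda>v. j (frechet_derivative (coord Y) (at x) v))) (at x)"
      by (rule has_derivative_transform_within_open[OF _ open_U x]) (simp add: JV V)
    thus ?thesis
      using V x by (simp add: nabla_M JV frechet_derivative_at[symmetric] \<Gamma>j J linear_add[OF j(1)])
  qed
  moreover have "J (\<Phi> x) (\<alpha> *\<^sub>R d\<Phi> x v + \<beta> *\<^sub>R d\<Phi> x w) = \<alpha> *\<^sub>R J (\<Phi> x) (d\<Phi> x v) + \<beta> *\<^sub>R J (\<Phi> x) (d\<Phi> x w)"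
    if "x \<in> U" for x v w \<alpha> \<beta>
  proof -
    note lin = linear_add[OF linear_d\<Phi>[OF that]] linear_scale[OF linear_d\<Phi>[OF that]]
    have "\<alpha> *\<^sub>R d\<Phi> x v + \<beta> *\<^sub>R d\<Phi> x w = d\<Phi> x (\<alpha> *\<^sub>R v + \<beta> *\<^sub>R w)"
      by (simp add: lin)
    thus ?thesis
      by (simp only: J[OF that]) (simp add: lin linear_add[OF j(1)] linear_scale[OF j(1)])
  qed
  ultimately show ?thesis
    unfolding kaehler_metric_def
    using riemannian_metric JV(1)
    by (auto simp: tangent_space_M J j(2) g_eq Gj linear_neg[OF linear_d\<Phi>])
qed

end

section \<open>The Hermitian form of signature \<open>(n - 1, 1)\<close>\<close>

definition hform :: "'n::finite \<Rightarrow> complex ^ 'n \<Rightarrow> complex ^ 'n \<Rightarrow> complex" where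
  "hform l z w = (\<Sum>i\<in>UNIV. (if i = l then - 1 else 1) * (z $ i * cnj (w $ i)))"

lemma flat_metric_hform: "flat_metric l z w = Re (hform l z w)"
  unfolding flat_metric_def hform_def Re_sum by (intro sum.cong) auto

lemma hform_add_left: "hform l (z + z') w = hform l z w + hform l z' w"
  and hform_add_right: "hform l w (z + z') = hform l w z + hform l w z'"
  unfolding hform_def by (auto simp: algebra_simps sum.distrib)

lemma hform_scale_left: "hform l (c *s z) w = c * hform l z w"
  and hform_scale_right: "hform l w (c *s z) = cnj c * hform l w z"
  unfolding hform_def by (auto simp: algebra_simps sum_distrib_left intro!: sum.cong)

lemma scaleR_eq_scale: "r *\<^sub>R z = complex_of_real r *s (z :: complex ^ 'n)"
  by (simp only: vec_eq_iff vector_scaleR_component vector_smult_component) (simp add: scaleR_conv_of_real)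

lemma hform_scaleR_left: "hform l (r *\<^sub>R z) w = r * hform l z w"
  and hform_scaleR_right: "hform l w (r *\<^sub>R z) = r * hform l w z"
  by (simp_all add: scaleR_eq_scale hform_scale_left hform_scale_right)

lemma hform_cnj: "hform l w z = cnj (hform l z w)"
  unfolding hform_def by (auto simp: mult.commute intro!: sum.cong)

lemma hform_self: "hform l z z = of_real (Re (hform l z z))"
  using hform_cnj[of l z z] by (simp add: complex_eq_iff)

lemmas hform_linear = hform_add_left hform_add_right hform_scale_left hform_scale_right

lemma bounded_bilinear_hform:
  fixes l :: "'n::finite"
  shows "bounded_bilinear (hform l)"
proof
  show "\<exists>K. \<forall>a b. norm (hform l a b) \<le> norm a * norm b * K"
  proof (intro exI allI)
    fix a b :: "complex ^ 'n"
    have "norm (hform l a b) \<le> (\<Sum>i\<in>(UNIV::'n set). norm a * norm b)"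
      unfolding hform_def
      by (rule sum_norm_le) (auto simp: norm_mult intro!: mult_mono Finite_Cartesian_Product.norm_nth_le)
    thus "norm (hform l a b) \<le> norm a * norm b * real CARD('n)" by (simp add: mult.commute)
  qed
qed (rule hform_add_left hform_add_right
    | (simp only: hform_scaleR_left hform_scaleR_right, simp add: scaleR_conv_of_real))+

lemma bounded_bilinear_scale: "bounded_bilinear ((*s) :: complex \<Rightarrow> complex ^ 'n \<Rightarrow> complex ^ 'n)"
proof
  have "norm (a *s b) = norm a * norm b * 1" for a :: complex and b :: "complex ^ 'n"
    unfolding norm_vec_def L2_set_def
    by (simp add: norm_mult power_mult_distrib real_sqrt_mult flip: sum_distrib_left)
  thus "\<exists>K. \<forall>a (b :: complex ^ 'n). norm (a *s b) \<le> norm a * norm b * K" by (metis order_refl)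
qed (simp_all add: vec_eq_iff algebra_simps)

lemmas hform_has_derivative [derivative_intros] = bounded_bilinear.FDERIV[OF bounded_bilinear_hform]
  and scale_has_derivative [derivative_intros] = bounded_bilinear.FDERIV[OF bounded_bilinear_scale]

text \<open>Orthogonality equates the product of the moduli at \<open>l\<close> with that of the
  spatial pairing. Cauchy-Schwarz bounds its square by S(v) S(w), and S(w) is below the squared
  modulus of \<open>w $ l\<close>, so S(v) must exceed that of \<open>v $ l\<close>.\<close>

lemma hform_orthogonal_timelike:
  fixes l :: "'n::finite"
  assumes w: "Re (hform l w w) < 0" and v: "hform l v w = 0" "v \<noteq> 0"
  shows "Re (hform l v v) > 0"
proof -
  have split: "hform l a b = (\<Sum>i\<in>-{l}. a $ i * cnj (b $ i)) - a $ l * cnj (b $ l)" for a b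
  proof -
    have "(\<Sum>i\<in>UNIV - {l}. (if i = l then - 1 else 1) * (a $ i * cnj (b $ i))) =
        (\<Sum>i\<in>-{l}. a $ i * cnj (b $ i))"
      by (rule sum.cong) auto
    thus ?thesis by (simp add: hform_def sum.remove[of UNIV l])
  qed
  define S where "S a = (\<Sum>i\<in>-{l}. (cmod (a $ i))\<^sup>2)" for a :: "complex ^ 'n"
  have self: "Re (hform l a a) = S a - (cmod (a $ l))\<^sup>2" for a
    unfolding split S_def by (simp flip: complex_norm_square of_real_power)
  have "v $ l * cnj (w $ l) = (\<Sum>i\<in>-{l}. v $ i * cnj (w $ i))"
    using v(1) unfolding split by simp
  hence "cmod (v $ l) * cmod (w $ l) = cmod (\<Sum>i\<in>-{l}. v $ i * cnj (w $ i))"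
    by (metis norm_mult complex_mod_cnj)
  also have "\<dots> \<le> (\<Sum>i\<in>-{l}. cmod (v $ i) * cmod (w $ i))"
    by (rule sum_norm_le) (simp add: norm_mult)
  finally have "(cmod (v $ l) * cmod (w $ l))\<^sup>2 \<le> (\<Sum>i\<in>-{l}. cmod (v $ i) * cmod (w $ i))\<^sup>2"
    by (rule power_mono) simp
  also have "\<dots> \<le> S v * S w"
    unfolding S_def by (rule Cauchy_Schwarz_ineq_sum)
  finally have CS: "(cmod (v $ l))\<^sup>2 * (cmod (w $ l))\<^sup>2 \<le> S v * S w"
    by (simp add: power_mult_distrib)
  have Sw: "0 \<le> S w" "S w < (cmod (w $ l))\<^sup>2"
    using w unfolding self by (auto simp: S_def sum_nonneg)
  have "S v > 0"
  proof (rule ccontr)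
    assume "\<not> S v > 0"
    moreover have "S v \<ge> 0" by (simp add: S_def sum_nonneg)
    ultimately have "S v = 0" by simp
    hence "(cmod (v $ l))\<^sup>2 * (cmod (w $ l))\<^sup>2 \<le> 0" using CS by simp
    hence "v $ l = 0" using Sw by (smt (verit) mult_pos_pos zero_less_norm_iff zero_less_power)
    moreover have "\<forall>i\<in>-{l}. v $ i = 0"
      using \<open>S v = 0\<close> unfolding S_def by (subst (asm) sum_nonneg_eq_0_iff) auto
    ultimately have "v = 0" by (auto simp: vec_eq_iff)
    thus False using v(2) by simp
  qed
  hence "S v * S w < S v * (cmod (w $ l))\<^sup>2" using Sw by simp
  hence "(cmod (v $ l))\<^sup>2 * (cmod (w $ l))\<^sup>2 < S v * (cmod (w $ l))\<^sup>2" using CS by linarith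
  hence "(cmod (v $ l))\<^sup>2 < S v" using Sw by (simp add: mult_less_cancel_right)
  thus ?thesis unfolding self by simp
qed

section \<open>Kaehler metrics with a unitarily invariant potential\<close>

text \<open>With a potential \<open>F(u)\<close>, \<open>u = - h(w, w)\<close>, one has \<open>A = - F'\<close> and \<open>A' = - \<alpha> A\<close>; \<open>\<beta>\<close> is then
  determined by \<open>\<partial>\<^sub>X H(Y, Z) = H(\<Gamma>(X, Y), Z)\<close>, with \<open>\<partial>\<^sub>X\<close> the holomorphic directional derivative.\<close>

locale rot_kaehler =
  fixes l :: "'n::finite" and V :: "real set" and A \<alpha> \<beta> \<alpha>' \<beta>' :: "real \<Rightarrow> real"
  assumes open_V: "open V" and V_pos: "u \<in> V \<Longrightarrow> u > 0" and A_pos: "u \<in> V \<Longrightarrow> A u > 0"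
    and A_deriv: "u \<in> V \<Longrightarrow> (A has_real_derivative - \<alpha> u * A u) (at u)"
    and \<alpha>_deriv: "u \<in> V \<Longrightarrow> (\<alpha> has_real_derivative \<alpha>' u) (at u)"
    and \<beta>_deriv: "u \<in> V \<Longrightarrow> (\<beta> has_real_derivative \<beta>' u) (at u)"
    and T_neg: "u \<in> V \<Longrightarrow> 1 - \<alpha> u * u < 0"
    and \<beta>_eq: "u \<in> V \<Longrightarrow> \<beta> u * (1 - \<alpha> u * u) = - (\<alpha>' u + (\<alpha> u)\<^sup>2)"
    and A_smooth: "smooth_on A V" and \<alpha>_smooth: "smooth_on \<alpha> V"
begin

section \<open>The metric in the chart, its positivity and its Christoffel symbol\<close>

definition nrm :: "complex ^ 'n \<Rightarrow> real" where "nrm w = - Re (hform l w w)"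

definition U :: "(complex ^ 'n) set" where "U = {w. nrm w \<in> V}"

definition H :: "complex ^ 'n \<Rightarrow> complex ^ 'n \<Rightarrow> complex ^ 'n \<Rightarrow> complex" where
  "H w X Y = A (nrm w) * (hform l X Y + \<alpha> (nrm w) * hform l X w * hform l w Y)"

definition \<Gamma> :: "complex ^ 'n \<Rightarrow> complex ^ 'n \<Rightarrow> complex ^ 'n \<Rightarrow> complex ^ 'n" where
  "\<Gamma> w X Y = (\<alpha> (nrm w) * hform l X w) *s Y + (\<alpha> (nrm w) * hform l Y w) *s X +
    (\<beta> (nrm w) * (hform l X w * hform l Y w)) *s w"

text \<open>The derivative in direction v with X and Y frozen: m is the derivative of
  \<open>nrm\<close>, and x', y' are those of x, y, with v in the conjugate linear slot.\<close>

definition d\<Gamma> :: "complex ^ 'n \<Rightarrow> complex ^ 'n \<Rightarrow> complex ^ 'n \<Rightarrow> complex ^ 'n \<Rightarrow> complex ^ 'n" where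
  "d\<Gamma> w v X Y =
    (let u = nrm w; m = - (hform l v w + hform l w v); x = hform l X w; y = hform l Y w;
         x' = hform l X v; y' = hform l Y v in
     (\<alpha>' u * m * x + \<alpha> u * x') *s Y + (\<alpha>' u * m * y + \<alpha> u * y') *s X +
     (\<beta>' u * m * (x * y) + \<beta> u * (x' * y + x * y')) *s w + (\<beta> u * (x * y)) *s v)"

lemma hform_nrm: "hform l w w = - of_real (nrm w)"
  using hform_self[of l w] by (simp add: nrm_def)

lemma nrm_has_derivative: "(nrm has_derivative (\<lambda>v. - 2 * Re (hform l v w))) (at w)"
proof -
  have "(nrm has_derivative (\<lambda>v. - Re (hform l w v + hform l v w))) (at w)"
    unfolding nrm_def by (auto intro!: derivative_eq_intros)
  moreover have "- Re (hform l w v + hform l v w) = - 2 * Re (hform l v w)" for v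
    using hform_cnj[of l w v] by simp
  ultimately show ?thesis by simp
qed

lemma smooth_on_nrm: "open S \<Longrightarrow> smooth_on nrm S"
  unfolding nrm_def
  by (intro smooth_on_uminus smooth_on_linear_compose[OF bounded_linear_Re]
      bounded_bilinear.smooth_on[OF bounded_bilinear_hform] smooth_on_ident)

lemma open_U: "open U"
proof -
  have "continuous_on UNIV nrm"
    by (rule smooth_on_imp_continuous_on[OF smooth_on_nrm[OF open_UNIV]])
  from open_vimage[OF open_V this] show ?thesis by (simp add: U_def vimage_def)
qed

lemma smooth_on_compose_nrm: "smooth_on f V \<Longrightarrow> smooth_on (\<lambda>w. f (nrm w)) U"
  by (rule smooth_on_compose[OF open_U open_V _ _ smooth_on_nrm[OF open_U]]) (auto simp: U_def)

text \<open>Writing - 2 Re h(v, w) as - (h(v, w) + h(w, v)) keeps the later identities polynomial in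
  values of \<open>hform\<close>.\<close>

lemma compose_nrm_has_derivative:
  assumes "(f has_real_derivative d) (at (nrm w))"
  shows "((\<lambda>w. complex_of_real (f (nrm w))) has_derivative
    (\<lambda>v. d * - (hform l v w + hform l w v))) (at w)"
proof -
  have "((\<lambda>w. f (nrm w)) has_derivative (\<lambda>v. d * (- 2 * Re (hform l v w)))) (at w)"
    by (rule has_derivative_compose[OF nrm_has_derivative assms[unfolded has_field_derivative_def]])
  from has_derivative_of_real[OF this] show ?thesis
  proof (rule has_derivative_eq_rhs)
    show "(\<lambda>v. complex_of_real (d * (- 2 * Re (hform l v w)))) =
        (\<lambda>v. d * - (hform l v w + hform l w v))"
      by (simp add: fun_eq_iff hform_cnj[of l w] complex_add_cnj flip: of_real_mult)
  qed
qed

lemma H_cnj: "H w Y X = cnj (H w X Y)"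
  using hform_cnj[of l Y X] hform_cnj[of l Y w] hform_cnj[of l w X] by (simp add: H_def)

lemma H_linear:
  "H w (X + X') Y = H w X Y + H w X' Y" "H w Y (X + X') = H w Y X + H w Y X'"
  "H w (c *s X) Y = c * H w X Y" "H w Y (c *s X) = cnj c * H w Y X"
  by (simp_all add: H_def hform_linear algebra_simps)

lemma H_self: "H w v v = of_real (Re (H w v v))"
  using H_cnj[of w v v] by (simp add: complex_eq_iff)

lemma H_w: "H w X w = of_real (A (nrm w) * (1 - \<alpha> (nrm w) * nrm w)) * hform l X w"
  by (simp add: H_def hform_nrm algebra_simps)

text \<open>With c = - h(v, w) / u the vector v - c w is orthogonal to w. Its contribution is
  positive because the signature is Lorentzian, that of c w because 1 - \<alpha> u < 0 outweighs
  h(w, w) < 0; the mixed terms vanish.\<close>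

lemma H_pos:
  assumes "w \<in> U" "v \<noteq> 0"
  shows "Re (H w v v) > 0"
proof -
  define u where "u = nrm w"
  have u: "u \<in> V" "u > 0" using assms V_pos by (auto simp: U_def u_def)
  define c where "c = - hform l v w / u"
  define v' where "v' = v - c *s w"
  have v: "v = v' + c *s w" by (simp add: v'_def)
  have "hform l v w = hform l v' w + c * hform l w w" by (subst v) (simp add: hform_linear)
  hence ort: "hform l v' w = 0" using u by (simp add: hform_nrm c_def flip: u_def)
  have ort': "hform l w v' = 0" using hform_cnj[of l w v'] ort by simp
  have "H w v v = A u * (hform l v' v' + (of_real (\<alpha> u * u - 1) * u) * (c * cnj c))"
    unfolding H_def v by (simp add: hform_linear ort ort' hform_nrm algebra_simps flip: u_def)
  hence eq: "Re (H w v v) = A u * (Re (hform l v' v') + (\<alpha> u * u - 1) * u * (cmod c)\<^sup>2)"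
    by (simp flip: complex_norm_square of_real_power of_real_mult)
  have 1: "Re (hform l v' v') > 0 \<or> v' = 0"
    using hform_orthogonal_timelike[of l w v'] ort u by (auto simp: nrm_def u_def)
  have 2: "(\<alpha> u * u - 1) * u > 0" using T_neg[OF u(1)] u by simp
  have "Re (hform l v' v') + (\<alpha> u * u - 1) * u * (cmod c)\<^sup>2 > 0"
  proof (cases "v' = 0")
    case True
    hence "c \<noteq> 0" using assms(2) v by auto
    thus ?thesis using True 2 by (simp add: hform_def)
  next
    case False
    have "0 \<le> (\<alpha> u * u - 1) * u * (cmod c)\<^sup>2" using 2 by simp
    thus ?thesis using 1 False by linarith
  qed
  thus ?thesis unfolding eq using A_pos[OF u(1)] by simp
qed

lemma H_smooth:
  assumes "smooth_on X U" "smooth_on Y U"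
  shows "smooth_on (\<lambda>w. Re (H w (X w) (Y w))) U"
  unfolding H_def
  by (intro smooth_on_linear_compose[OF bounded_linear_Re] smooth_on_mult smooth_on_add
      bounded_bilinear.smooth_on[OF bounded_bilinear_hform] assms open_U smooth_on_ident
      smooth_on_linear_compose[OF bounded_linear_of_real] smooth_on_compose_nrm A_smooth \<alpha>_smooth)

text \<open>Derivative terms with v in the linear slot add up to H(\<Gamma>(v, Y), Z), those with v
  in the conjugate linear slot to H(Y, \<Gamma>(v, Z)); hence \<open>\<Gamma>\<close> is
  metric.\<close>

lemma H_has_derivative:
  assumes w: "w \<in> U" and Y: "(Y has_derivative Y') (at w)" and Z: "(Z has_derivative Z') (at w)"
  shows "((\<lambda>w. H w (Y w) (Z w)) has_derivative
    (\<lambda>v. H w (Y' v + \<Gamma> w v (Y w)) (Z w) + H w (Y w) (Z' v + \<Gamma> w v (Z w)))) (at w)"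
proof -
  have u: "nrm w \<in> V" using w by (simp add: U_def)
  note A = compose_nrm_has_derivative[OF A_deriv[OF u]]
    and a = compose_nrm_has_derivative[OF \<alpha>_deriv[OF u]]
  \<comment> \<open>The defining relation of \<open>\<beta>\<close>: comparing the coefficients of
    h(v, w) h(Y, w) h(w, Z) gives \<alpha>^2 - \<alpha>' = \<beta> (1 - \<alpha> u) + 2
    \<alpha>^2.\<close>
  have key: "complex_of_real (\<beta> (nrm w)) * (1 - complex_of_real (\<alpha> (nrm w)) * complex_of_real (nrm w)) =
      - (complex_of_real (\<alpha>' (nrm w)) + (complex_of_real (\<alpha> (nrm w)))\<^sup>2)"
    using arg_cong[OF \<beta>_eq[OF u], of complex_of_real] by simp
  have D: "((\<lambda>w. a w * (hform l (Y w) (Z w) + b w * hform l (Y w) w * hform l w (Z w))) has_derivative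
    (\<lambda>v. a' v * (hform l (Y w) (Z w) + b w * hform l (Y w) w * hform l w (Z w)) +
      a w * (hform l (Y' v) (Z w) + hform l (Y w) (Z' v) + b' v * hform l (Y w) w * hform l w (Z w) +
        b w * (hform l (Y' v) w + hform l (Y w) v) * hform l w (Z w) +
        b w * hform l (Y w) w * (hform l v (Z w) + hform l w (Z' v))))) (at w)"
    if "(a has_derivative a') (at w)" "(b has_derivative b') (at w)" for a b a' b'
    by (auto intro!: derivative_eq_intros that Y Z simp: algebra_simps)
  show ?thesis
    unfolding H_def
  proof (rule has_derivative_eq_rhs[OF D[OF A a]], rule ext)
    fix v
    show "complex_of_real (- \<alpha> (nrm w) * A (nrm w)) * - (hform l v w + hform l w v) *
        (hform l (Y w) (Z w) + complex_of_real (\<alpha> (nrm w)) * hform l (Y w) w * hform l w (Z w)) +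
      complex_of_real (A (nrm w)) * (hform l (Y' v) (Z w) + hform l (Y w) (Z' v) +
        complex_of_real (\<alpha>' (nrm w)) * - (hform l v w + hform l w v) * hform l (Y w) w * hform l w (Z w) +
        complex_of_real (\<alpha> (nrm w)) * (hform l (Y' v) w + hform l (Y w) v) * hform l w (Z w) +
        complex_of_real (\<alpha> (nrm w)) * hform l (Y w) w * (hform l v (Z w) + hform l w (Z' v))) =
      complex_of_real (A (nrm w)) * (hform l (Y' v + \<Gamma> w v (Y w)) (Z w) +
        complex_of_real (\<alpha> (nrm w)) * hform l (Y' v + \<Gamma> w v (Y w)) w * hform l w (Z w)) +
      complex_of_real (A (nrm w)) * (hform l (Y w) (Z' v + \<Gamma> w v (Z w)) +
        complex_of_real (\<alpha> (nrm w)) * hform l (Y w) w * hform l w (Z' v + \<Gamma> w v (Z w)))"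
      \<comment> \<open>Conjugates are rewritten as values of \<open>hform\<close> with exchanged
        arguments, which leaves a polynomial identity modulo \<open>key\<close>.\<close>
      unfolding \<Gamma>_def hform_linear hform_nrm complex_cnj_mult complex_cnj_complex_of_real
        hform_cnj[of l w v, symmetric] hform_cnj[of l w "Z w", symmetric] of_real_mult of_real_minus
      using key by algebra
  qed
qed

lemma \<Gamma>_has_derivative:
  assumes w: "w \<in> U" and Y: "(Y has_derivative Y') (at w)" and Z: "(Z has_derivative Z') (at w)"
  shows "((\<lambda>w. \<Gamma> w (Y w) (Z w)) has_derivative
    (\<lambda>v. d\<Gamma> w v (Y w) (Z w) + \<Gamma> w (Y' v) (Z w) + \<Gamma> w (Y w) (Z' v))) (at w)"
proof -
  have u: "nrm w \<in> V" using w by (simp add: U_def)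
  note b = compose_nrm_has_derivative[OF \<beta>_deriv[OF u]]
    and a = compose_nrm_has_derivative[OF \<alpha>_deriv[OF u]]
  have D: "((\<lambda>w. (a w * hform l (Y w) w) *s Z w + (a w * hform l (Z w) w) *s Y w +
      (b w * (hform l (Y w) w * hform l (Z w) w)) *s w) has_derivative
    (\<lambda>v. (a' v * hform l (Y w) w + a w * (hform l (Y' v) w + hform l (Y w) v)) *s Z w +
      (a w * hform l (Y w) w) *s Z' v +
      (a' v * hform l (Z w) w + a w * (hform l (Z' v) w + hform l (Z w) v)) *s Y w +
      (a w * hform l (Z w) w) *s Y' v +
      (b' v * (hform l (Y w) w * hform l (Z w) w) +
       b w * ((hform l (Y' v) w + hform l (Y w) v) * hform l (Z w) w +
              hform l (Y w) w * (hform l (Z' v) w + hform l (Z w) v))) *s w +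
      (b w * (hform l (Y w) w * hform l (Z w) w)) *s v)) (at w)"
    if "(a has_derivative a') (at w)" "(b has_derivative b') (at w)" for a b a' b'
    by (auto intro!: derivative_eq_intros that Y Z simp: vec_eq_iff algebra_simps)
  show ?thesis
    unfolding \<Gamma>_def
    by (rule has_derivative_eq_rhs[OF D[OF a b]])
      (simp add: d\<Gamma>_def Let_def fun_eq_iff vec_eq_iff algebra_simps)
qed

text \<open>The quadratic terms in \<open>\<Gamma>\<close> and the part of \<open>d\<Gamma>\<close>
  that is complex linear in its direction contribute \<omega>^2 times the same vector twice and
  cancel. Only the part conjugate linear in the direction survives, whence the factor \<omega>
  (\<omega> - cnj \<omega>).\<close>

lemma curvature_holomorphic:
  fixes v w :: "complex ^ 'n" and \<omega> x N :: complex
  defines "u \<equiv> nrm w" and "x \<equiv> hform l v w" and "N \<equiv> hform l v v"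
  shows "d\<Gamma> w v (\<omega> *s v) (\<omega> *s v) - d\<Gamma> w (\<omega> *s v) v (\<omega> *s v) +
      \<Gamma> w v (\<Gamma> w (\<omega> *s v) (\<omega> *s v)) - \<Gamma> w (\<omega> *s v) (\<Gamma> w v (\<omega> *s v)) =
    (\<omega> * (\<omega> - cnj \<omega>)) *s ((2 * \<alpha> u * N - 2 * \<alpha>' u * (x * cnj x)) *s v +
      ((2 * \<beta> u * N - \<beta>' u * (x * cnj x)) * x) *s w)"
  unfolding u_def x_def N_def
  unfolding d\<Gamma>_def \<Gamma>_def Let_def hform_linear hform_cnj[of l w v]
  by (simp add: vec_eq_iff) (simp add: algebra_simps)

text \<open>The reversed Cauchy-Schwarz inequality for the negative vector w: the component of v
  orthogonal to w has nonnegative square. It becomes \<open>cos2 w v \<le> 1\<close>.\<close>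

lemma hform_lower_bound:
  assumes "w \<in> U"
  shows "nrm w * Re (hform l v v) + (cmod (hform l v w))\<^sup>2 \<ge> 0"
proof -
  define u where "u = nrm w"
  have u: "u > 0" using assms V_pos by (auto simp: U_def u_def)
  define x where "x = hform l v w"
  define v' where "v' = v + (x / u) *s w"
  have x': "hform l w v = cnj x" using hform_cnj[of l w v] by (simp add: x_def)
  have "hform l v' w = 0"
    using u by (simp add: v'_def hform_linear hform_nrm flip: u_def x_def)
  hence "Re (hform l v' v') \<ge> 0"
    using hform_orthogonal_timelike[of l w v'] u
    by (cases "v' = 0") (auto simp: hform_def nrm_def u_def)
  moreover have "hform l v' v' = hform l v v + x * cnj x / u"
    using u by (simp add: v'_def hform_linear hform_nrm x' field_simps flip: u_def x_def)
  hence "hform l v' v' = hform l v v + of_real ((cmod x)\<^sup>2 / u)"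
    by (simp only: of_real_divide complex_norm_square)
  ultimately have "Re (hform l v v) + (cmod x)\<^sup>2 / u \<ge> 0" by simp
  thus ?thesis using u by (simp add: field_simps flip: u_def x_def)
qed

text \<open>The modulus of H(v, w) instead of its real part makes the value invariant under complex
  rescaling of v, hence a function of the complex line.\<close>

definition cos2 :: "complex ^ 'n \<Rightarrow> complex ^ 'n \<Rightarrow> real" where
  "cos2 w v = (cmod (H w v w))\<^sup>2 / (Re (H w v v) * Re (H w w w))"

lemma H_v: "Re (H w v v) = A (nrm w) * (Re (hform l v v) + \<alpha> (nrm w) * (cmod (hform l v w))\<^sup>2)"
proof -
  have "H w v v = A (nrm w) * (hform l v v + \<alpha> (nrm w) * (hform l v w * cnj (hform l v w)))"
    by (simp add: H_def hform_cnj[of l w v])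
  also have "\<dots> = A (nrm w) *
      (hform l v v + complex_of_real (\<alpha> (nrm w)) * complex_of_real ((cmod (hform l v w))\<^sup>2))"
    by (simp only: complex_norm_square)
  finally show ?thesis by (simp del: of_real_power)
qed

lemma cos2_eq:
  assumes "w \<in> U" "v \<noteq> 0"
  shows "cos2 w v = - (1 - \<alpha> (nrm w) * nrm w) * (cmod (hform l v w))\<^sup>2 /
    (nrm w * (Re (hform l v v) + \<alpha> (nrm w) * (cmod (hform l v w))\<^sup>2))"
proof -
  define u T where "u = nrm w" and "T = 1 - \<alpha> u * u"
  have u: "u > 0" "A u > 0" "T < 0" using assms(1) V_pos A_pos T_neg by (auto simp: U_def u_def T_def)
  have "Re (H w w w) = - (A u * T * u)"
    by (simp add: H_w hform_nrm T_def flip: u_def)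
  moreover have "(cmod (H w v w))\<^sup>2 = (A u * T)\<^sup>2 * (cmod (hform l v w))\<^sup>2"
    unfolding H_w u_def[symmetric] T_def[symmetric] norm_mult norm_of_real power_mult_distrib[of "\<bar>_\<bar>"] power2_abs ..
  moreover have "(a * t)\<^sup>2 * X / (a * h * - (a * t * u)) = - t * X / (u * h)"
    if "a \<noteq> 0" "t \<noteq> 0" for a t X h :: real
    using that u by (cases "h = 0") (simp_all add: power2_eq_square field_simps)
  ultimately show ?thesis
    using u by (simp only: cos2_def) (simp add: H_v flip: u_def T_def)
qed

lemma cos2_le_1:
  assumes "w \<in> U" "v \<noteq> 0"
  shows "cos2 w v \<le> 1"
proof -
  define u where "u = nrm w"
  have u: "u > 0" "A u > 0" using assms(1) V_pos A_pos by (auto simp: U_def u_def)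
  have "Re (hform l v v) + \<alpha> u * (cmod (hform l v w))\<^sup>2 > 0"
    using H_pos[OF assms] u by (simp add: H_v zero_less_mult_iff flip: u_def)
  hence "u * (Re (hform l v v) + \<alpha> u * (cmod (hform l v w))\<^sup>2) > 0" using u by simp
  thus ?thesis
    using hform_lower_bound[OF assms(1), of v]
    unfolding cos2_eq[OF assms] u_def[symmetric]
    by (subst divide_le_eq_1_pos) (auto simp: algebra_simps)
qed

text \<open>Here e stands for X / h with X = |h(v, w)|^2 and h = H(v, v) / A. Then h(v, v) / h = 1 -
  \<alpha> e, and the squared cosine - T e / u, solved for e, gives the expression in c.\<close>

definition hol_curv :: "real \<Rightarrow> real \<Rightarrow> real" where
  "hol_curv u c = (let T = 1 - \<alpha> u * u; e = - u * c / T in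
    - 2 * (2 * \<alpha> u * (1 - \<alpha> u * e) - 2 * \<alpha>' u * e + (2 * \<beta> u * (1 - \<alpha> u * e) - \<beta>' u * e) * e * T) / A u)"

text \<open>Numerator and denominator both carry the factor (Im \<omega>)^2, since Re (\<omega>
  (\<omega> - cnj \<omega>)) = - 2 (Im \<omega>)^2; the choice of the second basis vector
  cancels.\<close>

lemma holomorphic_sectional_curvature:
  fixes \<omega> :: complex
  assumes w: "w \<in> U" and v: "v \<noteq> 0" and \<omega>: "Im \<omega> \<noteq> 0"
  defines "R \<equiv> d\<Gamma> w v (\<omega> *s v) (\<omega> *s v) - d\<Gamma> w (\<omega> *s v) v (\<omega> *s v) +
      \<Gamma> w v (\<Gamma> w (\<omega> *s v) (\<omega> *s v)) - \<Gamma> w (\<omega> *s v) (\<Gamma> w v (\<omega> *s v))"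
  shows "Re (H w R v) / (Re (H w v v) * Re (H w (\<omega> *s v) (\<omega> *s v)) - (Re (H w v (\<omega> *s v)))\<^sup>2) =
    hol_curv (nrm w) (cos2 w v)"
proof -
  define u x where "u = nrm w" and "x = hform l v w"
  define T N X where "T = 1 - \<alpha> u * u" and "N = Re (hform l v v)" and "X = (cmod x)\<^sup>2"
  define h where "h = N + \<alpha> u * X"
  define K where "K = (2 * \<alpha> u * N - 2 * \<alpha>' u * X) * (A u * h) + (2 * \<beta> u * N - \<beta>' u * X) * X * (A u * T)"
  have u: "u > 0" "A u > 0" "T < 0" using w V_pos A_pos T_neg by (auto simp: U_def u_def T_def)
  have N: "hform l v v = of_real N" unfolding N_def by (rule hform_self)
  have X: "x * cnj x = of_real X" unfolding X_def by (rule complex_norm_square[symmetric])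
  have Hvv: "H w v v = of_real (A u * h)"
    using H_self[of w v] by (simp add: H_v h_def N_def X_def u_def x_def)
  have h: "h > 0" using H_pos[OF w v] u by (simp add: Hvv zero_less_mult_iff)
  have Hwv: "H w w v = of_real (A u * T) * cnj x"
    using H_cnj[of w w v] by (simp add: H_w T_def u_def x_def)
  have "H w R v = (\<omega> * (\<omega> - cnj \<omega>)) *
      ((2 * \<alpha> u * N - 2 * \<alpha>' u * X) * H w v v + (2 * \<beta> u * N - \<beta>' u * X) * (x * H w w v))"
    unfolding R_def curvature_holomorphic H_linear u_def[symmetric] x_def[symmetric] N X
    by (simp add: algebra_simps)
  also have "\<dots> = (\<omega> * (\<omega> - cnj \<omega>)) * of_real K"
    unfolding Hvv Hwv K_def by (simp add: mult.left_commute[of x] X)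
  finally have num: "Re (H w R v) = - 2 * (Im \<omega>)\<^sup>2 * K"
    by (simp add: power2_eq_square)
  have "H w (\<omega> *s v) (\<omega> *s v) = of_real ((cmod \<omega>)\<^sup>2) * of_real (A u * h)"
    unfolding complex_norm_square by (simp add: H_linear Hvv)
  hence "Re (H w (\<omega> *s v) (\<omega> *s v)) = ((Re \<omega>)\<^sup>2 + (Im \<omega>)\<^sup>2) * (A u * h)"
    by (simp add: cmod_power2 del: of_real_power flip: of_real_mult)
  moreover have "Re (H w v (\<omega> *s v)) = Re \<omega> * (A u * h)" by (simp add: H_linear Hvv)
  ultimately have den: "Re (H w v v) * Re (H w (\<omega> *s v) (\<omega> *s v)) - (Re (H w v (\<omega> *s v)))\<^sup>2 =
      (Im \<omega>)\<^sup>2 * (A u * h)\<^sup>2"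
    by (simp add: Hvv power2_eq_square algebra_simps)
  have e: "- u * cos2 w v / T = X / h"
    unfolding cos2_eq[OF w v] u_def[symmetric] x_def[symmetric] X_def[symmetric] N_def[symmetric]
      T_def[symmetric] h_def[symmetric]
    using u h by (simp add: field_simps)
  have N': "1 - \<alpha> u * (X / h) = N / h"
    using h by (simp add: field_simps h_def)
  have "hol_curv u (cos2 w v) = - 2 * K / (A u * h)\<^sup>2"
    unfolding hol_curv_def Let_def T_def[symmetric] e N' K_def
    using u h by (simp add: field_simps power2_eq_square)
  thus ?thesis
    unfolding num den u_def using \<omega> by simp
qed

text \<open>The least angle belongs to the largest real cosine over the two complex lines. That
  maximum is \<open>\<rho>\<close>, and \<open>arccos\<close> is decreasing on [-1, 1].\<close>

lemma cos_subspace_angle: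
  assumes w: "w \<in> U" and v: "v \<noteq> 0"
  shows "(cos (Inf {arccos (Re (H w (\<zeta> *s v) (\<eta> *s w)) /
        (sqrt (Re (H w (\<zeta> *s v) (\<zeta> *s v))) * sqrt (Re (H w (\<eta> *s w) (\<eta> *s w))))) | \<zeta> \<eta>.
        \<zeta> \<noteq> 0 \<and> \<eta> \<noteq> 0}))\<^sup>2 = cos2 w v"
proof -
  have w0: "w \<noteq> 0" using w V_pos[of 0] by (auto simp: U_def nrm_def hform_def)
  define a b z where "a = Re (H w v v)" and "b = Re (H w w w)" and "z = H w v w"
  have ab: "a > 0" "b > 0" using H_pos w v w0 by (auto simp: a_def b_def)
  define \<rho> where "\<rho> = cmod z / (sqrt a * sqrt b)"
  have \<rho>2: "\<rho>\<^sup>2 = cos2 w v"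
    using ab by (simp add: \<rho>_def cos2_def power_divide power_mult_distrib a_def b_def z_def)
  have \<rho>: "0 \<le> \<rho>" "\<rho> \<le> 1"
    using ab cos2_le_1[OF w v, folded \<rho>2] by (simp_all add: \<rho>_def abs_square_le_1)
  define f where "f \<zeta> \<eta> = Re (H w (\<zeta> *s v) (\<eta> *s w)) /
        (sqrt (Re (H w (\<zeta> *s v) (\<zeta> *s v))) * sqrt (Re (H w (\<eta> *s w) (\<eta> *s w))))" for \<zeta> \<eta>
  have sq: "Re (H w (\<zeta> *s y) (\<zeta> *s y)) = (cmod \<zeta>)\<^sup>2 * Re (H w y y)" for \<zeta> y
  proof -
    have "H w (\<zeta> *s y) (\<zeta> *s y) = of_real ((cmod \<zeta>)\<^sup>2) * H w y y"
      unfolding complex_norm_square by (simp add: H_linear)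
    thus ?thesis by (simp del: of_real_power)
  qed
  have f: "f \<zeta> \<eta> = Re (\<zeta> * cnj \<eta> * z) / ((cmod \<zeta> * cmod \<eta>) * (sqrt a * sqrt b))" for \<zeta> \<eta>
    unfolding f_def sq by (simp add: H_linear real_sqrt_mult mult_ac a_def b_def z_def)
  have le: "\<bar>f \<zeta> \<eta>\<bar> \<le> \<rho>" if "\<zeta> \<noteq> 0" "\<eta> \<noteq> 0" for \<zeta> \<eta>
  proof -
    have le: "\<bar>Re (\<zeta> * cnj \<eta> * z)\<bar> \<le> (cmod \<zeta> * cmod \<eta>) * cmod z"
      using abs_Re_le_cmod[of "\<zeta> * cnj \<eta> * z"] by (simp add: norm_mult)
    have "0 \<le> (cmod \<zeta> * cmod \<eta>) * (sqrt a * sqrt b)" using ab by simp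
    from divide_right_mono[OF le this] this
    have "\<bar>f \<zeta> \<eta>\<bar> \<le> (cmod \<zeta> * cmod \<eta>) * cmod z / ((cmod \<zeta> * cmod \<eta>) * (sqrt a * sqrt b))"
      by (simp only: f abs_divide abs_of_nonneg)
    thus ?thesis using that by (simp add: \<rho>_def)
  qed
  \<comment> \<open>Scaling v by cnj z turns the Hermitian product with w into the positive number
    |z|^2, so the bound \<open>\<rho>\<close> is attained; for z = 0 any scalar will do.\<close>
  obtain \<zeta>0 where \<zeta>0: "\<zeta>0 \<noteq> 0" "f \<zeta>0 1 = \<rho>"
  proof (cases "z = 0")
    case True
    thus ?thesis using that[of 1] by (simp add: f \<rho>_def)
  next
    case False
    have "cnj z * z = of_real ((cmod z)\<^sup>2)" unfolding complex_norm_square by simp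
    hence "f (cnj z) 1 = \<rho>"
      using False by (simp add: f \<rho>_def power2_eq_square del: of_real_power flip: of_real_mult)
    thus ?thesis using that[of "cnj z"] False by simp
  qed
  have "Inf {arccos (f \<zeta> \<eta>) | \<zeta> \<eta>. \<zeta> \<noteq> 0 \<and> \<eta> \<noteq> 0} = arccos \<rho>"
  proof (rule cInf_eq_minimum)
    show "arccos \<rho> \<in> {arccos (f \<zeta> \<eta>) | \<zeta> \<eta>. \<zeta> \<noteq> 0 \<and> \<eta> \<noteq> 0}"
      using \<zeta>0 zero_neq_one by (smt (verit, best) mem_Collect_eq)
    show "arccos \<rho> \<le> y" if y_in: "y \<in> {arccos (f \<zeta> \<eta>) | \<zeta> \<eta>. \<zeta> \<noteq> 0 \<and> \<eta> \<noteq> 0}" for y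
    proof -
      obtain \<zeta> \<eta> where y: "y = arccos (f \<zeta> \<eta>)" "\<bar>f \<zeta> \<eta>\<bar> \<le> \<rho>" using y_in le by blast
      show ?thesis unfolding y(1) using y(2) \<rho> by (intro arccos_le_arccos) linarith+
    qed
  qed
  hence "cos (Inf {arccos (f \<zeta> \<eta>) | \<zeta> \<eta>. \<zeta> \<noteq> 0 \<and> \<eta> \<noteq> 0}) = \<rho>"
    using \<rho> by (simp add: cos_arccos)
  thus ?thesis using \<rho>2 by (simp add: f_def)
qed

end

section \<open>A holomorphic chart of the rotational hypersurface\<close>

lemma inj_on_if_deriv_pos:
  fixes f :: "real \<Rightarrow> real"
  assumes "is_interval I" "\<And>s. s \<in> I \<Longrightarrow> (f has_real_derivative f' s) (at s)" "\<And>s. s \<in> I \<Longrightarrow> f' s > 0"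
  shows "inj_on f I"
proof (rule linorder_inj_onI')
  fix x y assume xy: "x \<in> I" "y \<in> I" "x < y"
  have "f x < f y"
  proof (rule DERIV_pos_imp_increasing[OF xy(3)])
    fix z assume "x \<le> z" "z \<le> y"
    hence "z \<in> I" using assms(1) xy by (meson mem_is_interval_1_I)
    thus "\<exists>y. (f has_real_derivative y) (at z) \<and> 0 < y" using assms(2,3) by blast
  qed
  thus "f x \<noteq> f y" by simp
qed

lemma antiderivative_on_interval:
  fixes f :: "real \<Rightarrow> real"
  assumes "open I" "is_interval I" "continuous_on I f"
  obtains F where "\<And>s. s \<in> I \<Longrightarrow> (F has_real_derivative f s) (at s)"
proof (cases "I = {}")
  case False
  then obtain c where c: "c \<in> I" by blast
  have "((\<lambda>x. LBINT y=c..x. f y) has_real_derivative f s) (at s)" if s: "s \<in> I" for s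
  proof -
    obtain e where e: "e > 0" "ball c e \<subseteq> I" using assms(1) c openE by blast
    obtain d where d: "d > 0" "ball s d \<subseteq> I" using assms(1) s openE by blast
    \<comment> \<open>A compact interval in \<open>I\<close> with both points in its interior; for s
      this turns the derivative within it into a full derivative.\<close>
    define a b where "a = min (c - e / 2) (s - d / 2)" and "b = max (c + e / 2) (s + d / 2)"
    have "c - e / 2 \<in> I" "c + e / 2 \<in> I" "s - d / 2 \<in> I" "s + d / 2 \<in> I"
      using e d by (auto simp: subset_iff dist_real_def)
    hence "a \<in> I" "b \<in> I" by (auto simp: a_def b_def min_def max_def)
    hence ab: "{a..b} \<subseteq> I" using assms(2) by (meson atLeastAtMost_iff mem_is_interval_1_I subsetI)
    have mid: "a < c" "c < b" "a < s" "s < b" using e(1) d(1) by (auto simp: a_def b_def)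
    have "((\<lambda>x. LBINT y=c..x. f y) has_vector_derivative f s) (at s within {a..b})"
      by (rule interval_integral_FTC2) (use mid ab assms(3) continuous_on_subset in auto)
    thus ?thesis
      using mid by (simp add: at_within_Icc_at has_real_derivative_iff_has_vector_derivative)
  qed
  thus ?thesis by (rule that)
qed (use that in auto)

lemma smooth_on_sqrt: "smooth_on sqrt {0<..}"
proof (rule smooth_on_ode)
  show "smooth_on (\<lambda>y. inverse (2 * y)) {0::real<..}"
    by (intro smooth_on_inverse smooth_on_mult smooth_on_const smooth_on_ident) auto
  show "(sqrt has_real_derivative inverse (2 * sqrt x)) (at x)" if "x \<in> {0<..}" for x
    using DERIV_real_sqrt[of x] that by (simp add: field_simps)
qed auto

locale rot_chart =
  fixes l :: "'n::finite" and t q r :: "real \<Rightarrow> real" and I :: "real set"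
  assumes open_I: "open I" and interval_I: "is_interval I"
    and smooth_t: "smooth_on t I" and smooth_q: "smooth_on q I" and smooth_r: "smooth_on r I"
    and t_pos: "s \<in> I \<Longrightarrow> t s > 0" and r_pos: "s \<in> I \<Longrightarrow> r s > 0"
    and r_deriv: "s \<in> I \<Longrightarrow> (r has_real_derivative r s / t s) (at s)"
    and natural_param: "s \<in> I \<Longrightarrow> (deriv q s)\<^sup>2 = (deriv t s)\<^sup>2 - 1"
    and t'_le: "s \<in> I \<Longrightarrow> deriv t s \<le> - 1"
begin

section \<open>The parameter s and the coefficients as functions of u\<close>

definition V :: "real set" where "V = (\<lambda>s. (r s)\<^sup>2) ` I"
definition \<phi> :: "real \<Rightarrow> real" where "\<phi> = inv_into I (\<lambda>s. (r s)\<^sup>2)"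
text \<open>In the chart s is recovered from r(s)^2, but on the ambient space from t(s)^2, which is
  - h of the \<complex>^n-component of a point; hence a second inverse function.\<close>

definition V' :: "real set" where "V' = (\<lambda>s. (t s)\<^sup>2) ` I"
definition \<phi>' :: "real \<Rightarrow> real" where "\<phi>' = inv_into I (\<lambda>s. (t s)\<^sup>2)"

lemma t_deriv: "s \<in> I \<Longrightarrow> (t has_real_derivative deriv t s) (at s)"
  and q_deriv: "s \<in> I \<Longrightarrow> (q has_real_derivative deriv q s) (at s)"
  using smooth_on_deriv(1)[OF open_I] smooth_t smooth_q by auto

lemma inj_t: "inj_on t I"
proof -
  have "inj_on (\<lambda>s. - t s) I"
    by (rule inj_on_if_deriv_pos[OF interval_I DERIV_minus[OF t_deriv]]) (use t'_le in force)+
  thus ?thesis by (simp add: inj_on_def)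
qed

lemma square_r:
  shows "s \<in> I \<Longrightarrow> ((\<lambda>s. (r s)\<^sup>2) has_real_derivative 2 * (r s)\<^sup>2 / t s) (at s)"
    and "inj_on (\<lambda>s. (r s)\<^sup>2) I" and "smooth_on (\<lambda>s. (r s)\<^sup>2) I"
proof -
  show *: "((\<lambda>s. (r s)\<^sup>2) has_real_derivative 2 * (r s)\<^sup>2 / t s) (at s)" if "s \<in> I" for s
    by (rule derivative_eq_intros r_deriv that refl)+ (simp add: power2_eq_square)
  show "inj_on (\<lambda>s. (r s)\<^sup>2) I"
    by (rule inj_on_if_deriv_pos[OF interval_I *]) (use t_pos r_pos in \<open>auto simp: less_imp_neq[symmetric]\<close>)
  show "smooth_on (\<lambda>s. (r s)\<^sup>2) I"
    unfolding power2_eq_square by (intro smooth_on_mult open_I smooth_r)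
qed

lemma square_t:
  shows "s \<in> I \<Longrightarrow> ((\<lambda>s. (t s)\<^sup>2) has_real_derivative 2 * t s * deriv t s) (at s)"
    and "inj_on (\<lambda>s. (t s)\<^sup>2) I" and "smooth_on (\<lambda>s. (t s)\<^sup>2) I"
proof -
  show *: "((\<lambda>s. (t s)\<^sup>2) has_real_derivative 2 * t s * deriv t s) (at s)" if "s \<in> I" for s
    by (rule derivative_eq_intros t_deriv that refl)+ simp
  show "inj_on (\<lambda>s. (t s)\<^sup>2) I"
    using inj_t t_pos by (auto simp: inj_on_def power2_eq_iff_nonneg less_imp_le)
  show "smooth_on (\<lambda>s. (t s)\<^sup>2) I"
    unfolding power2_eq_square by (intro smooth_on_mult open_I smooth_t)
qed

lemma \<phi>: "u \<in> V \<Longrightarrow> \<phi> u \<in> I" "u \<in> V \<Longrightarrow> (r (\<phi> u))\<^sup>2 = u" "s \<in> I \<Longrightarrow> \<phi> ((r s)\<^sup>2) = s" "s \<in> I \<Longrightarrow> (r s)\<^sup>2 \<in> V"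
  unfolding V_def \<phi>_def
  using inv_into_f_f[OF square_r(2)] f_inv_into_f[of _ "\<lambda>s. (r s)\<^sup>2" I] by (auto simp: inv_into_into)

lemma \<phi>': "m \<in> V' \<Longrightarrow> \<phi>' m \<in> I" "s \<in> I \<Longrightarrow> \<phi>' ((t s)\<^sup>2) = s" "s \<in> I \<Longrightarrow> (t s)\<^sup>2 \<in> V'"
  "m \<in> V' \<Longrightarrow> (t (\<phi>' m))\<^sup>2 = m"
  unfolding V'_def \<phi>'_def
  using inv_into_f_f[OF square_t(2)] f_inv_into_f[of _ "\<lambda>s. (t s)\<^sup>2" I] by (auto simp: inv_into_into)

lemma smooth_\<phi>: "open V" "smooth_on \<phi> V"
  and \<phi>_deriv: "u \<in> V \<Longrightarrow> (\<phi> has_real_derivative t (\<phi> u) / (2 * u)) (at u)"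
proof -
  have d: "deriv (\<lambda>s. (r s)\<^sup>2) s = 2 * (r s)\<^sup>2 / t s" "deriv (\<lambda>s. (r s)\<^sup>2) s \<noteq> 0" if "s \<in> I" for s
    using DERIV_imp_deriv[OF square_r(1)[OF that]] t_pos[OF that] r_pos[OF that] by auto
  note inv = smooth_inverse_function[OF open_I square_r(3,2) d(2), folded V_def \<phi>_def]
  show "open V" "smooth_on \<phi> V" using inv by auto
  show "(\<phi> has_real_derivative t (\<phi> u) / (2 * u)) (at u)" if "u \<in> V"
    using inv(2)[OF _ \<phi>(1)[OF that]] \<phi>[of u] that d(1)[of "\<phi> u"] by simp
qed

lemma \<phi>_chain:
  assumes "(f has_real_derivative d) (at (\<phi> u))" "u \<in> V"
  shows "((\<lambda>u. f (\<phi> u)) has_real_derivative d * (t (\<phi> u) / (2 * u))) (at u)"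
  by (rule DERIV_chain2[where f=f and g=\<phi>, OF assms(1) \<phi>_deriv[OF assms(2)]])

lemma smooth_\<phi>': "open V'" "smooth_on \<phi>' V'"
proof -
  have d: "deriv (\<lambda>s. (t s)\<^sup>2) s \<noteq> 0" if "s \<in> I" for s
    using DERIV_imp_deriv[OF square_t(1)[OF that]] t_pos[OF that] t'_le[OF that] by auto
  show "open V'" "smooth_on \<phi>' V'"
    using smooth_inverse_function[OF open_I square_t(3,2) d, folded V'_def \<phi>'_def] by auto
qed

lemma V_gt_0: "u \<in> V \<Longrightarrow> u > 0"
  unfolding V_def by (auto dest!: r_pos)

lemma smooth_on_\<phi>_compose: "smooth_on f I \<Longrightarrow> smooth_on (\<lambda>u. f (\<phi> u)) V"
  by (rule smooth_on_compose[OF smooth_\<phi>(1) open_I _ _ smooth_\<phi>(2)]) (auto simp: \<phi>)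

definition A :: "real \<Rightarrow> real" where "A u = (t (\<phi> u))\<^sup>2 / u"
definition \<alpha> :: "real \<Rightarrow> real" where "\<alpha> u = (1 - deriv t (\<phi> u)) / u"
text \<open>The relation required of \<open>\<beta>\<close>, solved by dividing by 1 - \<alpha> u =
  t', which is negative.\<close>

definition \<beta> :: "real \<Rightarrow> real" where "\<beta> u = - (deriv \<alpha> u + (\<alpha> u)\<^sup>2) / deriv t (\<phi> u)"

lemma one_minus_\<alpha>: "u \<in> V \<Longrightarrow> 1 - \<alpha> u * u = deriv t (\<phi> u)"
  using V_gt_0 by (fastforce simp: \<alpha>_def)

lemma t'_neg: "u \<in> V \<Longrightarrow> deriv t (\<phi> u) < 0"
  using t'_le[OF \<phi>(1)] by force

lemma smooth_coefficients: "smooth_on A V" "smooth_on \<alpha> V" "smooth_on \<beta> V"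
proof -
  note t' = smooth_on_\<phi>_compose[OF smooth_on_deriv(2)[OF open_I smooth_t]]
  show "smooth_on A V" unfolding A_def
    by (intro smooth_on_divide smooth_on_\<phi>_compose square_t smooth_on_ident smooth_\<phi>)
      (use V_gt_0 in force)
  show *: "smooth_on \<alpha> V" unfolding \<alpha>_def
    by (intro smooth_on_divide smooth_on_diff smooth_on_const t' smooth_on_ident smooth_\<phi>)
      (use V_gt_0 in force)
  show "smooth_on \<beta> V" unfolding \<beta>_def power2_eq_square
    by (intro smooth_on_divide smooth_on_uminus smooth_on_add smooth_on_mult
        smooth_on_deriv(2)[OF smooth_\<phi>(1) *] * t' smooth_\<phi>)
      (use t'_neg in force)
qed

sublocale rot_kaehler l V A \<alpha> \<beta> "deriv \<alpha>" "deriv \<beta>"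
proof
  fix u assume u: "u \<in> V"
  note s = \<phi>(1)[OF u]
  show "u > 0" by (rule V_gt_0[OF u])
  show "A u > 0" using V_gt_0[OF u] t_pos[OF s] by (simp add: A_def)
  show "(A has_real_derivative - \<alpha> u * A u) (at u)"
    unfolding A_def \<alpha>_def
    by (rule derivative_eq_intros \<phi>_chain[OF t_deriv[OF s] u] refl)+
      (use V_gt_0[OF u] in \<open>auto simp: field_simps power2_eq_square\<close>)
  show "(\<alpha> has_real_derivative deriv \<alpha> u) (at u)" "(\<beta> has_real_derivative deriv \<beta> u) (at u)"
    using smooth_on_deriv(1)[OF smooth_\<phi>(1)] smooth_coefficients u by auto
  show "1 - \<alpha> u * u < 0" "\<beta> u * (1 - \<alpha> u * u) = - (deriv \<alpha> u + (\<alpha> u)\<^sup>2)"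
    unfolding one_minus_\<alpha>[OF u] \<beta>_def using t'_neg[OF u] by auto
qed (use smooth_\<phi> smooth_coefficients in auto)

definition W :: "((complex ^ 'n) \<times> real) set" where "W = {p. nrm (fst p) \<in> V'}"

definition \<Phi> :: "complex ^ 'n \<Rightarrow> (complex ^ 'n) \<times> real" where
  "\<Phi> w = (let s = \<phi> (nrm w) in ((t s / r s) *\<^sub>R w, q s))"

text \<open>Reads s off the \<complex>^n-component alone, possible because t is strictly decreasing.
  Ignoring q makes the map available on an open set around the hypersurface.\<close>

definition \<Psi> :: "(complex ^ 'n) \<times> real \<Rightarrow> complex ^ 'n" where
  "\<Psi> p = (let s = \<phi>' (nrm (fst p)) in (r s / t s) *\<^sub>R fst p)"

lemma nrm_scaleR: "nrm (c *\<^sub>R w) = c\<^sup>2 * nrm w"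
  by (simp add: nrm_def hform_scaleR_left hform_scaleR_right power2_eq_square)

lemma in_U_iff: "w \<in> U \<longleftrightarrow> nrm w \<in> V"
  by (simp add: U_def)

lemma point_U:
  assumes "w \<in> U"
  shows "\<phi> (nrm w) \<in> I" "(r (\<phi> (nrm w)))\<^sup>2 = nrm w" "t (\<phi> (nrm w)) > 0" "r (\<phi> (nrm w)) > 0" "nrm w > 0"
    "deriv t (\<phi> (nrm w)) < 0"
  using assms \<phi> t_pos r_pos V_gt_0 t'_neg by (auto simp: in_U_iff)

lemma nrm_fst_\<Phi>:
  assumes "w \<in> U"
  shows "nrm (fst (\<Phi> w)) = (t (\<phi> (nrm w)))\<^sup>2"
  using point_U[OF assms] by (simp add: \<Phi>_def Let_def nrm_scaleR power_divide)

sublocale global_chart U W \<Phi> \<Psi>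
proof
  show "open U" by (rule open_U)
  have smooth_nrm_fst: "smooth_on (\<lambda>p. nrm (fst p)) S" if "open S" for S :: "((complex ^ 'n) \<times> real) set"
    by (rule smooth_on_compose[OF that open_UNIV _ smooth_on_nrm[OF open_UNIV]
          smooth_on_bounded_linear[OF bounded_linear_fst]]) auto
  have "open ((\<lambda>p :: (complex ^ 'n) \<times> real. nrm (fst p)) -` V')"
    using smooth_on_imp_continuous_on[OF smooth_nrm_fst[OF open_UNIV]] smooth_\<phi>'
    by (intro open_vimage) auto
  thus oW: "open W" by (simp add: W_def vimage_def)
  have "smooth_on (\<lambda>w. (t (\<phi> (nrm w)) / r (\<phi> (nrm w))) *\<^sub>R w) U"
    by (intro smooth_on_scaleR smooth_on_ident open_U
        smooth_on_compose_nrm[of "\<lambda>u. t (\<phi> u) / r (\<phi> u)"] smooth_on_\<phi>_compose[of "\<lambda>s. t s / r s"]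
        smooth_on_divide smooth_t smooth_r open_I) (use r_pos in force)
  moreover have "smooth_on (\<lambda>w. q (\<phi> (nrm w))) U"
    by (intro smooth_on_compose_nrm[of "\<lambda>u. q (\<phi> u)"] smooth_on_\<phi>_compose smooth_q)
  ultimately have "smooth_on (\<lambda>w. ((t (\<phi> (nrm w)) / r (\<phi> (nrm w))) *\<^sub>R w, 0) + (0, q (\<phi> (nrm w)))) U"
    by (intro smooth_on_add open_U smooth_on_linear_compose[where f="\<lambda>z. (z, 0)"]
        smooth_on_linear_compose[where f="\<lambda>z. (0, z)"] bounded_linear_Pair bounded_linear_ident
        bounded_linear_zero)
  thus "smooth_on \<Phi> U" by (simp add: \<Phi>_def[abs_def] Let_def)
  have s: "smooth_on (\<lambda>p. \<phi>' (nrm (fst p))) W"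
    by (rule smooth_on_compose[OF oW smooth_\<phi>'(1) _ smooth_\<phi>'(2) smooth_nrm_fst[OF oW]]) (auto simp: W_def)
  have "smooth_on (\<lambda>p. r (\<phi>' (nrm (fst p))) / t (\<phi>' (nrm (fst p)))) W"
    by (rule smooth_on_compose[OF oW open_I _ smooth_on_divide[OF open_I smooth_r smooth_t] s])
      (use t_pos in \<open>force simp: W_def \<phi>'\<close>)+
  thus "smooth_on \<Psi> W"
    unfolding \<Psi>_def Let_def
    by (intro smooth_on_scaleR oW smooth_on_bounded_linear[OF bounded_linear_fst])
  show "\<Phi> w \<in> W" if "w \<in> U" for w
    using nrm_fst_\<Phi>[OF that] point_U(1)[OF that] by (simp add: W_def \<phi>')
  show "\<Psi> p \<in> U" if "p \<in> W" for p
  proof -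
    define s where "s = \<phi>' (nrm (fst p))"
    have s: "s \<in> I" "(t s)\<^sup>2 = nrm (fst p)" using that by (auto simp: W_def s_def \<phi>')
    have "nrm (\<Psi> p) = (r s)\<^sup>2"
      unfolding \<Psi>_def Let_def nrm_scaleR s(2)[symmetric]
      using s(1) t_pos[OF s(1)] by (simp add: power_divide \<phi>')
    thus ?thesis using s(1) by (simp add: in_U_iff \<phi>)
  qed
  show "\<Psi> (\<Phi> w) = w" if "w \<in> U" for w
    using point_U[OF that] nrm_fst_\<Phi>[OF that]
    by (simp add: \<Psi>_def Let_def \<phi>') (simp add: \<Phi>_def Let_def)
qed

section \<open>The hypersurface and its structures in the chart\<close>

lemma rot_hypersurface_eq: "rot_hypersurface l t q I = \<Phi> ` U"
proof (intro subset_antisym subsetI)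
  fix p assume "p \<in> rot_hypersurface l t q I"
  then obtain s n where s: "s \<in> I" "flat_metric l n n = - 1" "p = (t s *\<^sub>R n, q s)"
    by (auto simp: rot_hypersurface_def rot_params_def rot_point_def)
  have n: "nrm (r s *\<^sub>R n) = (r s)\<^sup>2"
    using s(2) by (simp add: nrm_scaleR) (simp add: nrm_def flat_metric_hform)
  have "p = \<Phi> (r s *\<^sub>R n)"
    using s(1) r_pos[OF s(1)] unfolding s(3) \<Phi>_def n by (simp add: \<phi> Let_def)
  moreover have "r s *\<^sub>R n \<in> U" using s(1) by (simp add: in_U_iff n \<phi>)
  ultimately show "p \<in> \<Phi> ` U" by blast
next
  fix p assume "p \<in> \<Phi> ` U"
  then obtain w where w: "w \<in> U" "p = \<Phi> w" by blast
  define s where "s = \<phi> (nrm w)"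
  have "nrm ((1 / r s) *\<^sub>R w) = 1"
    using point_U[OF w(1)] by (simp add: nrm_scaleR power_divide s_def)
  hence "(s, (1 / r s) *\<^sub>R w) \<in> rot_params l I"
    using point_U(1)[OF w(1)] by (simp add: rot_params_def flat_metric_hform nrm_def s_def)
  moreover have "p = rot_point t q (s, (1 / r s) *\<^sub>R w)"
    by (simp add: w(2) \<Phi>_def rot_point_def Let_def s_def)
  ultimately show "p \<in> rot_hypersurface l t q I"
    unfolding rot_hypersurface_def by blast
qed

text \<open>\<open>rot_s\<close> and \<open>rot_n\<close> are taken from \<open>inv_into\<close>, so
  injectivity is what fixes their values. The parameter s is determined by t(s)^2 = - h(t n, t
  n).\<close>

lemma inj_rot_point: "inj_on (rot_point t q) (rot_params l I)"
proof (rule inj_onI, clarify)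
  fix s n s' n'
  assume p: "(s, n) \<in> rot_params l I" "(s', n') \<in> rot_params l I" and eq: "rot_point t q (s, n) = rot_point t q (s', n')"
  have s: "s \<in> I" "s' \<in> I" "nrm n = 1" "nrm n' = 1"
    using p by (auto simp: rot_params_def nrm_def flat_metric_hform)
  have e: "t s *\<^sub>R n = t s' *\<^sub>R n'" using eq by (simp add: rot_point_def)
  hence "(t s)\<^sup>2 = (t s')\<^sup>2" using s nrm_scaleR[of "t s" n] nrm_scaleR[of "t s'" n'] by simp
  hence "s = s'" using square_t(2) s by (simp add: inj_on_def)
  thus "s = s' \<and> n = n'" using e t_pos[OF s(1)] by simp
qed

lemma inv_rot_point:
  assumes "w \<in> U"
  shows "inv_into (rot_params l I) (rot_point t q) (\<Phi> w) = (\<phi> (nrm w), (1 / r (\<phi> (nrm w))) *\<^sub>R w)"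
proof -
  let ?s = "\<phi> (nrm w)"
  have "nrm ((1 / r ?s) *\<^sub>R w) = 1"
    using point_U[OF assms] by (simp add: nrm_scaleR power_divide)
  hence "(?s, (1 / r ?s) *\<^sub>R w) \<in> rot_params l I"
    using point_U(1)[OF assms] by (simp add: rot_params_def flat_metric_hform nrm_def)
  moreover have "\<Phi> w = rot_point t q (?s, (1 / r ?s) *\<^sub>R w)"
    by (simp add: \<Phi>_def rot_point_def Let_def)
  ultimately show ?thesis using inv_into_f_f[OF inj_rot_point] by metis
qed

lemma rot_s: "w \<in> U \<Longrightarrow> rot_s l t q I (\<Phi> w) = \<phi> (nrm w)"
  and rot_n: "w \<in> U \<Longrightarrow> rot_n l t q I (\<Phi> w) = (1 / r (\<phi> (nrm w))) *\<^sub>R w"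
  by (simp_all add: rot_s_def rot_n_def inv_rot_point)

lemma s_has_derivative:
  assumes "w \<in> U"
  shows "((\<lambda>w. \<phi> (nrm w)) has_derivative (\<lambda>v. - t (\<phi> (nrm w)) * Re (hform l v w) / nrm w)) (at w)"
proof -
  have "nrm w \<in> V" using assms by (simp add: in_U_iff)
  from has_derivative_compose[OF nrm_has_derivative \<phi>_deriv[OF this, unfolded has_field_derivative_def]]
  show ?thesis by (simp add: divide_simps)
qed

lemma compose_s_has_derivative:
  assumes "w \<in> U" "(f has_real_derivative d) (at (\<phi> (nrm w)))"
  shows "((\<lambda>w. f (\<phi> (nrm w))) has_derivative (\<lambda>v. d * (- t (\<phi> (nrm w)) * Re (hform l v w) / nrm w))) (at w)"
  by (rule has_derivative_compose[OF s_has_derivative[OF assms(1)] assms(2)[unfolded has_field_derivative_def]])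

text \<open>\<open>\<sigma>\<close> is the differential of s, and r' = r / t gives (t / r)' = (t' -
  1) / r.\<close>

lemma d\<Phi>_eq:
  assumes "w \<in> U"
  defines "s \<equiv> \<phi> (nrm w)"
  defines "\<sigma> \<equiv> \<lambda>v. - t s * Re (hform l v w) / nrm w"
  shows "d\<Phi> w v = ((t s / r s) *\<^sub>R v + ((deriv t s - 1) / r s * \<sigma> v) *\<^sub>R w, deriv q s * \<sigma> v)"
proof -
  have s: "s \<in> I" "t s > 0" "r s > 0" using point_U[OF assms(1)] by (auto simp: s_def)
  have "((\<lambda>s. t s / r s) has_real_derivative (deriv t s - 1) / r s) (at s)"
    by (rule derivative_eq_intros t_deriv r_deriv s refl)+ (use s in \<open>auto simp: field_simps\<close>)
  note D = compose_s_has_derivative[OF assms(1) this[unfolded s_def], folded s_def]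
    compose_s_has_derivative[OF assms(1) q_deriv[OF s(1), unfolded s_def], folded s_def]
  have "(\<Phi> has_derivative
      (\<lambda>v. ((t s / r s) *\<^sub>R v + ((deriv t s - 1) / r s * \<sigma> v) *\<^sub>R w, deriv q s * \<sigma> v))) (at w)"
    unfolding \<Phi>_def[abs_def] Let_def
    by (rule has_derivative_eq_rhs[OF has_derivative_Pair[OF has_derivative_scaleR[OF D(1) has_derivative_ident] D(2)]])
      (simp add: s_def \<sigma>_def)
  from frechet_derivative_at[OF this, symmetric] show ?thesis by (simp add: d\<Phi>_def)
qed

lemma d\<Phi>_linear:
  assumes "w \<in> U"
  shows "d\<Phi> w (v + v') = d\<Phi> w v + d\<Phi> w v'" "d\<Phi> w (v - v') = d\<Phi> w v - d\<Phi> w v'"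
    "d\<Phi> w (c *\<^sub>R v) = c *\<^sub>R d\<Phi> w v" "d\<Phi> w 0 = 0"
  using linear_d\<Phi>[OF assms] by (auto simp: linear_add linear_diff linear_scale linear_0)

text \<open>Apart from (t / r)^2 h(v, v') all terms are multiples of \<sigma>(v) \<sigma>(v'), with
  total coefficient - 2 (t' - 1) - (t' - 1)^2 + q'^2, which is 0 for a natural parameter.\<close>

lemma product_metric_d\<Phi>:
  assumes "w \<in> U"
  shows "product_metric l (d\<Phi> w v) (d\<Phi> w v') = A (nrm w) * Re (hform l v v')"
proof -
  define u s where "u = nrm w" and "s = \<phi> u"
  define a \<sigma> where "a = (\<lambda>v. Re (hform l v w))" and "\<sigma> = (\<lambda>v. - t s * a v / u)"
  note p = point_U[OF assms, folded u_def, folded s_def]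
  have a: "Re (hform l w v) = a v" for v using hform_cnj[of l w v] by (simp add: a_def)
  have aw: "Re (hform l w w) = - (r s)\<^sup>2" unfolding p(2) u_def hform_nrm by simp
  have av: "a v = - u * \<sigma> v / t s" for v using p by (simp add: \<sigma>_def)
  have q': "(deriv q s)\<^sup>2 = (deriv t s)\<^sup>2 - 1" by (rule natural_param[OF p(1)])
  define B where "B = (deriv t s - 1) / r s"
  have D: "d\<Phi> w v = ((t s / r s) *\<^sub>R v + (B * \<sigma> v) *\<^sub>R w, deriv q s * \<sigma> v)" for v
    unfolding d\<Phi>_eq[OF assms] by (simp add: \<sigma>_def a_def B_def s_def u_def)
  have sesq: "Re (hform l (c *\<^sub>R x + d *\<^sub>R w) (c *\<^sub>R y + e *\<^sub>R w)) =
      c * c * Re (hform l x y) + c * e * a x + d * c * a y + d * e * - (r s)\<^sup>2" for c d e x y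
    by (simp add: hform_add_left hform_add_right hform_scaleR_left hform_scaleR_right aw a[of y])
      (simp add: a_def algebra_simps)
  have "product_metric l (d\<Phi> w v) (d\<Phi> w v') =
      (t s / r s) * (t s / r s) * Re (hform l v v') + (t s / r s) * (B * \<sigma> v') * a v
      + (B * \<sigma> v) * (t s / r s) * a v' + (B * \<sigma> v) * (B * \<sigma> v') * - (r s)\<^sup>2
      + (deriv q s)\<^sup>2 * (\<sigma> v * \<sigma> v')"
    unfolding product_metric_def flat_metric_hform D fst_conv snd_conv sesq
    by (simp add: power2_eq_square)
  also have "\<dots> = (t s)\<^sup>2 / (r s)\<^sup>2 * Re (hform l v v')"
    unfolding q' av B_def using p(3,4) unfolding p(2)[symmetric]
    by (simp add: field_simps power2_eq_square)
  finally show ?thesis by (simp add: A_def p(2) flip: u_def s_def)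
qed

text \<open>In the chart the meridian is s \<mapsto> r(s) n, with velocity r' n = w / t.\<close>

lemma xi_bar_\<Phi>:
  assumes "w \<in> U"
  shows "xi_bar l t q I (\<Phi> w) = d\<Phi> w ((1 / t (\<phi> (nrm w))) *\<^sub>R w)"
proof -
  note p = point_U[OF assms]
  have "- t (\<phi> (nrm w)) * Re (hform l ((1 / t (\<phi> (nrm w))) *\<^sub>R w) w) / nrm w = 1"
    using p by (simp add: hform_scaleR_left hform_nrm)
  thus ?thesis
    unfolding xi_bar_def d\<Phi>_eq[OF assms]
    using p by (simp add: rot_s[OF assms] rot_n[OF assms] field_simps flip: scaleR_add_left)
qed

lemma xi_bar_tilde_\<Phi>:
  assumes "w \<in> U"
  shows "xi_bar_tilde l t q I (\<Phi> w) = d\<Phi> w ((1 / t (\<phi> (nrm w))) *\<^sub>R (\<i> *s w))"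
proof -
  note p = point_U[OF assms]
  have "Re (hform l ((1 / t (\<phi> (nrm w))) *\<^sub>R (\<i> *s w)) w) = 0"
    by (simp add: hform_scaleR_left hform_scale_left hform_nrm)
  thus ?thesis
    unfolding xi_bar_tilde_def d\<Phi>_eq[OF assms] J\<^sub>0_def
    using p by (simp add: rot_n[OF assms] scaleR_eq_scale mult.commute)
qed

lemma complex_line:
  assumes "w \<in> U"
  shows "span {d\<Phi> w v, d\<Phi> w (\<i> *s v)} = {d\<Phi> w (\<zeta> *s v) | \<zeta>. True}"
proof (rule subset_antisym)
  show "span {d\<Phi> w v, d\<Phi> w (\<i> *s v)} \<subseteq> {d\<Phi> w (\<zeta> *s v) | \<zeta>. True}"
  proof (rule span_minimal)
    have "d\<Phi> w v = d\<Phi> w (1 *s v)" by simp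
    thus "{d\<Phi> w v, d\<Phi> w (\<i> *s v)} \<subseteq> {d\<Phi> w (\<zeta> *s v) | \<zeta>. True}" by blast
    show "subspace {d\<Phi> w (\<zeta> *s v) | \<zeta>. True}"
    proof (rule subspaceI)
      have "0 = d\<Phi> w (0 *s v)" by (simp add: d\<Phi>_linear[OF assms])
      thus "0 \<in> {d\<Phi> w (\<zeta> *s v) | \<zeta>. True}" by blast
      fix x y c assume "x \<in> {d\<Phi> w (\<zeta> *s v) | \<zeta>. True}" "y \<in> {d\<Phi> w (\<zeta> *s v) | \<zeta>. True}"
      then obtain \<zeta> \<eta> where xy: "x = d\<Phi> w (\<zeta> *s v)" "y = d\<Phi> w (\<eta> *s v)" by blast
      have "x + y = d\<Phi> w ((\<zeta> + \<eta>) *s v)" "c *\<^sub>R x = d\<Phi> w ((of_real c * \<zeta>) *s v)"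
        unfolding xy by (simp_all add: vector_sadd_rdistrib scaleR_eq_scale flip: d\<Phi>_linear[OF assms])
      thus "x + y \<in> {d\<Phi> w (\<zeta> *s v) | \<zeta>. True}" "c *\<^sub>R x \<in> {d\<Phi> w (\<zeta> *s v) | \<zeta>. True}" by blast+
    qed
  qed
  show "{d\<Phi> w (\<zeta> *s v) | \<zeta>. True} \<subseteq> span {d\<Phi> w v, d\<Phi> w (\<i> *s v)}"
  proof (rule subsetI)
    fix x assume "x \<in> {d\<Phi> w (\<zeta> *s v) | \<zeta>. True}"
    then obtain \<zeta> where x: "x = d\<Phi> w (\<zeta> *s v)" by blast
    have "\<zeta> *s v = Re \<zeta> *\<^sub>R v + Im \<zeta> *\<^sub>R (\<i> *s v)"
      unfolding scaleR_eq_scale vector_smult_assoc vector_sadd_rdistrib[symmetric]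
      by (metis complex_eq mult.commute)
    hence "d\<Phi> w (\<zeta> *s v) = Re \<zeta> *\<^sub>R d\<Phi> w v + Im \<zeta> *\<^sub>R d\<Phi> w (\<i> *s v)"
      by (simp only: d\<Phi>_linear[OF assms])
    moreover have "Re \<zeta> *\<^sub>R d\<Phi> w v + Im \<zeta> *\<^sub>R d\<Phi> w (\<i> *s v) \<in> span {d\<Phi> w v, d\<Phi> w (\<i> *s v)}"
      by (intro span_add span_scale span_base) auto
    ultimately show "x \<in> span {d\<Phi> w v, d\<Phi> w (\<i> *s v)}" by (simp only: x)
  qed
qed

lemma rot_D_perp_\<Phi>:
  assumes "w \<in> U"
  shows "rot_D_perp l t q I (\<Phi> w) = {d\<Phi> w (\<eta> *s w) | \<eta>. True}"
proof -
  let ?t = "t (\<phi> (nrm w))"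
  have t: "?t > 0" using point_U[OF assms] by simp
  have "(1 / ?t) *\<^sub>R (\<i> *s w) = \<i> *s ((1 / ?t) *\<^sub>R w)"
    by (simp add: scaleR_eq_scale mult.commute)
  hence "rot_D_perp l t q I (\<Phi> w) = {d\<Phi> w (\<zeta> *s ((1 / ?t) *\<^sub>R w)) | \<zeta>. True}"
    unfolding rot_D_perp_def xi_bar_\<Phi>[OF assms] xi_bar_tilde_\<Phi>[OF assms]
    by (simp only: complex_line[OF assms])
  also have "\<dots> = {d\<Phi> w (\<eta> *s w) | \<eta>. True}"
  proof -
    have 1: "d\<Phi> w (\<zeta> *s ((1 / ?t) *\<^sub>R w)) = d\<Phi> w ((\<zeta> / ?t) *s w)" for \<zeta>
      by (simp add: scaleR_eq_scale)
    have 2: "d\<Phi> w (\<zeta> *s w) = d\<Phi> w ((\<zeta> * ?t) *s ((1 / ?t) *\<^sub>R w))" for \<zeta>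
      using t by (simp add: scaleR_eq_scale)
    show ?thesis using 1 2 by blast
  qed
  finally show ?thesis .
qed

lemma rot_D_\<Phi>:
  assumes "w \<in> U"
  shows "rot_D l t q I (\<Phi> w) = {d\<Phi> w v | v. hform l v w = 0}"
proof -
  have A: "A (nrm w) > 0" using A_pos assms by (simp add: in_U_iff)
  have D: "(\<forall>x\<in>rot_D_perp l t q I (\<Phi> w). product_metric l (d\<Phi> w v) x = 0) \<longleftrightarrow> hform l v w = 0" for v
  proof
    assume *: "\<forall>x\<in>rot_D_perp l t q I (\<Phi> w). product_metric l (d\<Phi> w v) x = 0"
    \<comment> \<open>The metric sees only real parts; testing against h(v, w) w turns the real part
      into |h(v, w)|^2.\<close>
    have "product_metric l (d\<Phi> w v) (d\<Phi> w (hform l v w *s w)) = 0"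
      using * unfolding rot_D_perp_\<Phi>[OF assms] by blast
    hence "Re (cnj (hform l v w) * hform l v w) = 0"
      using A by (simp add: product_metric_d\<Phi>[OF assms] hform_scale_right)
    hence "(Re (hform l v w))\<^sup>2 + (Im (hform l v w))\<^sup>2 = 0" by (simp add: power2_eq_square)
    thus "hform l v w = 0" by (simp add: complex_eq_iff sum_power2_eq_zero_iff)
  next
    assume "hform l v w = 0"
    thus "\<forall>x\<in>rot_D_perp l t q I (\<Phi> w). product_metric l (d\<Phi> w v) x = 0"
      unfolding rot_D_perp_\<Phi>[OF assms]
      by (auto simp: product_metric_d\<Phi>[OF assms] hform_scale_right)
  qed
  show ?thesis
    unfolding rot_D_def rot_hypersurface_eq tangent_space_M[OF assms] using D by blast
qed

text \<open>The forms dual to \<open>xi_bar\<close> and \<open>xi_bar_tilde\<close> are A / t times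
  the real and imaginary parts of h(X, w), so the sum of their squares polarises to (A / t)^2 Re
  (h(X, w) h(w, Y)). As A / t^2 = 1 / u, the factor 1 - t' yields A \<alpha>.\<close>

lemma rot_g_d\<Phi>:
  assumes "w \<in> U"
  shows "rot_g l t q I (\<Phi> w) (d\<Phi> w X) (d\<Phi> w Y) = Re (H w X Y)"
proof -
  define u s where "u = nrm w" and "s = \<phi> u"
  note p = point_U[OF assms, folded u_def, folded s_def]
  have xi: "product_metric l (xi_bar l t q I (\<Phi> w)) (d\<Phi> w X) = A u * (Re (hform l X w) / t s)" for X
    using hform_cnj[of l w X]
    by (simp add: xi_bar_\<Phi>[OF assms] product_metric_d\<Phi>[OF assms] hform_scaleR_left flip: u_def s_def)
  have xi': "product_metric l (xi_bar_tilde l t q I (\<Phi> w)) (d\<Phi> w X) = A u * (Im (hform l X w) / t s)" for X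
    using hform_cnj[of l w X]
    by (simp add: xi_bar_tilde_\<Phi>[OF assms] product_metric_d\<Phi>[OF assms] hform_scaleR_left
        hform_scale_left flip: u_def s_def)
  have A: "(1 - deriv t s) * (A u / t s)\<^sup>2 = A u * \<alpha> u"
    using p by (simp add: A_def \<alpha>_def power2_eq_square field_simps flip: s_def)
  have "rot_g l t q I (\<Phi> w) (d\<Phi> w X) (d\<Phi> w Y) = A u * Re (hform l X Y) +
      (1 - deriv t s) * (A u / t s)\<^sup>2 * (Re (hform l X w) * Re (hform l Y w) + Im (hform l X w) * Im (hform l Y w))"
    unfolding rot_g_def Let_def xi xi' product_metric_d\<Phi>[OF assms] rot_s[OF assms]
    using p(3) by (simp add: power2_eq_square field_simps flip: u_def s_def)
  also have "\<dots> = Re (H w X Y)"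
    unfolding A using hform_cnj[of l w Y] by (simp add: H_def algebra_simps flip: u_def)
  finally show ?thesis .
qed

text \<open>On \<open>rot_D\<close> the term \<sigma> vanishes and \<open>d\<Phi>\<close> is scaling
  by t / r, which commutes with i; on \<open>rot_D_perp\<close> the vectors w / t and i w / t are
  mapped to the given frame. Any admissible decomposition reassembles to the same v, so the
  description is determined.\<close>

lemma rot_J_d\<Phi>:
  assumes "w \<in> U"
  shows "rot_J l t q I (\<Phi> w) (d\<Phi> w v) = d\<Phi> w (\<i> *s v)"
proof -
  define \<tau> where "\<tau> = t (\<phi> (nrm w))"
  note p = point_U[OF assms, folded \<tau>_def]
  note xi = xi_bar_\<Phi>[OF assms, folded \<tau>_def] xi_bar_tilde_\<Phi>[OF assms, folded \<tau>_def]
  have J0: "J\<^sub>0 (d\<Phi> w x) = d\<Phi> w (\<i> *s x)" if "hform l x w = 0" for x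
    unfolding d\<Phi>_eq[OF assms] J\<^sub>0_def using that
    by (simp add: hform_scale_left scaleR_eq_scale mult.commute)
  have lin: "d\<Phi> w x + \<alpha> *\<^sub>R d\<Phi> w ((1 / \<tau>) *\<^sub>R w) + \<beta> *\<^sub>R d\<Phi> w ((1 / \<tau>) *\<^sub>R (\<i> *s w)) = d\<Phi> w (x + (Complex \<alpha> \<beta> / \<tau>) *s w)"
    and lin': "d\<Phi> w (\<i> *s x) + \<alpha> *\<^sub>R d\<Phi> w ((1 / \<tau>) *\<^sub>R (\<i> *s w)) - \<beta> *\<^sub>R d\<Phi> w ((1 / \<tau>) *\<^sub>R w) =
      d\<Phi> w (\<i> *s (x + (Complex \<alpha> \<beta> / \<tau>) *s w))" for x \<alpha> \<beta>
    unfolding d\<Phi>_linear[OF assms, symmetric]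
    by (rule arg_cong[where f="d\<Phi> w"], simp only: scaleR_eq_scale,
        simp add: vec_eq_iff Complex_eq add_divide_distrib algebra_simps)+
  show ?thesis
    unfolding rot_J_def
  proof (rule the_equality)
    define \<eta> where "\<eta> = - hform l v w / nrm w"
    define x where "x = v - \<eta> *s w"
    have v: "v = x + \<eta> *s w" by (simp add: x_def)
    have "hform l v w = hform l x w + \<eta> * hform l w w" by (subst v) (simp add: hform_linear)
    hence x: "hform l x w = 0" using p by (simp add: hform_nrm \<eta>_def)
    have "v = x + (Complex (\<tau> * Re \<eta>) (\<tau> * Im \<eta>) / \<tau>) *s w"
    proof -
      have "Complex (\<tau> * Re \<eta>) (\<tau> * Im \<eta>) / \<tau> = \<eta>" using p by (simp add: complex_eq_iff)
      thus ?thesis using v by simp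
    qed
    thus "\<exists>x\<in>rot_D l t q I (\<Phi> w). \<exists>\<alpha> \<beta>.
        d\<Phi> w v = x + \<alpha> *\<^sub>R xi_bar l t q I (\<Phi> w) + \<beta> *\<^sub>R xi_bar_tilde l t q I (\<Phi> w) \<and>
        d\<Phi> w (\<i> *s v) = J\<^sub>0 x + \<alpha> *\<^sub>R xi_bar_tilde l t q I (\<Phi> w) - \<beta> *\<^sub>R xi_bar l t q I (\<Phi> w)"
      unfolding rot_D_\<Phi>[OF assms] xi using x J0[OF x] lin[of x] lin'[of x]
      by (metis (mono_tags, lifting) mem_Collect_eq)
  next
    fix y
    assume "\<exists>x\<in>rot_D l t q I (\<Phi> w). \<exists>\<alpha> \<beta>.
        d\<Phi> w v = x + \<alpha> *\<^sub>R xi_bar l t q I (\<Phi> w) + \<beta> *\<^sub>R xi_bar_tilde l t q I (\<Phi> w) \<and>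
        y = J\<^sub>0 x + \<alpha> *\<^sub>R xi_bar_tilde l t q I (\<Phi> w) - \<beta> *\<^sub>R xi_bar l t q I (\<Phi> w)"
    then obtain x \<alpha> \<beta> where "hform l x w = 0" "d\<Phi> w v = d\<Phi> w (x + (Complex \<alpha> \<beta> / \<tau>) *s w)"
      "y = d\<Phi> w (\<i> *s (x + (Complex \<alpha> \<beta> / \<tau>) *s w))"
      unfolding rot_D_\<Phi>[OF assms] xi using J0 lin lin' by auto
    thus "y = d\<Phi> w (\<i> *s v)" by (simp add: d\<Phi>_eq_iff[OF assms])
  qed
qed

definition \<xi>_coeff :: "real \<Rightarrow> real" where
  "\<xi>_coeff s = inverse (t s * sqrt (- deriv t s))"

lemma smooth_\<xi>_coeff: "smooth_on \<xi>_coeff I"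
proof -
  have "smooth_on (\<lambda>s. sqrt (- deriv t s)) I"
    by (rule smooth_on_compose[OF open_I _ _ smooth_on_sqrt
          smooth_on_uminus[OF open_I smooth_on_deriv(2)[OF open_I smooth_t]]])
      (use t'_le in force)+
  thus ?thesis unfolding \<xi>_coeff_def
  proof (intro smooth_on_inverse smooth_on_mult open_I smooth_t)
    show "t s * sqrt (- deriv t s) \<noteq> 0" if "s \<in> I" for s
      using t_pos[OF that] t'_le[OF that] by simp
  qed
qed

lemma rot_xi_\<Phi>:
  assumes "w \<in> U"
  shows "rot_xi l t q I (\<Phi> w) = d\<Phi> w (\<xi>_coeff (\<phi> (nrm w)) *\<^sub>R w)"
  unfolding rot_xi_def xi_bar_\<Phi>[OF assms] rot_s[OF assms] \<xi>_coeff_def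
  by (simp add: field_simps flip: d\<Phi>_linear[OF assms])

end

locale rot_connection = rot_chart l t q r I
  for l :: "'n::finite" and t q r I +
  fixes nabla :: "((complex ^ 'n) \<times> real \<Rightarrow> (complex ^ 'n) \<times> real) \<Rightarrow>
    ((complex ^ 'n) \<times> real \<Rightarrow> (complex ^ 'n) \<times> real) \<Rightarrow> (complex ^ 'n) \<times> real \<Rightarrow> (complex ^ 'n) \<times> real"
  assumes nabla: "levi_civita (rot_hypersurface l t q I) (rot_g l t q I) nabla"
begin

sublocale chart_connection U W \<Phi> \<Psi> "rot_g l t q I" "\<lambda>w X Y. Re (H w X Y)" \<Gamma> d\<Gamma> nabla
proof (intro chart_connection.intro chart_connection_axioms.intro global_chart_axioms)
  fix w assume w: "w \<in> U"
  show "rot_g l t q I (\<Phi> w) (d\<Phi> w X) (d\<Phi> w Y) = Re (H w X Y)" for X Y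
    by (rule rot_g_d\<Phi>[OF w])
  show "Re (H w X Y) = Re (H w Y X)" for X Y
    using H_cnj[of w X Y] by simp
  show "linear (\<lambda>X. Re (H w X Y))" for Y
    by (rule linearI) (simp_all add: H_linear scaleR_eq_scale)
  show "X \<noteq> 0 \<Longrightarrow> Re (H w X X) > 0" for X by (rule H_pos[OF w])
  show "\<Gamma> w X Y = \<Gamma> w Y X" for X Y by (simp add: \<Gamma>_def algebra_simps)
  show "linear (\<Gamma> w X)" for X
    by (rule linearI) (simp_all add: \<Gamma>_def scaleR_eq_scale hform_linear vec_eq_iff algebra_simps)
  fix Y Y' Z Z' :: "complex ^ 'n \<Rightarrow> complex ^ 'n" assume Y: "(Y has_derivative Y') (at w)" and Z: "(Z has_derivative Z') (at w)"
  show "((\<lambda>y. Re (H y (Y y) (Z y))) has_derivative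
      (\<lambda>v. Re (H w (Y' v + \<Gamma> w v (Y w)) (Z w)) + Re (H w (Y w) (Z' v + \<Gamma> w v (Z w))))) (at w)"
    using has_derivative_Re[OF H_has_derivative[OF w Y Z]] by simp
  show "((\<lambda>y. \<Gamma> y (Y y) (Z y)) has_derivative
      (\<lambda>v. d\<Gamma> w v (Y w) (Z w) + \<Gamma> w (Y' v) (Z w) + \<Gamma> w (Y w) (Z' v))) (at w)"
    by (rule \<Gamma>_has_derivative[OF w Y Z])
qed (use H_smooth nabla in \<open>auto simp: rot_hypersurface_eq\<close>)

lemma kaehler: "kaehler_metric M (rot_g l t q I) (rot_J l t q I) nabla"
proof (rule kaehler_metric_M[where j="\<lambda>v. \<i> *s v"])
  show "linear (\<lambda>v :: complex ^ 'n. \<i> *s v)"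
    by (rule linearI) (simp_all add: vec_eq_iff scaleR_conv_of_real algebra_simps)
  show "\<i> *s (\<i> *s v) = - v" for v :: "complex ^ 'n" by (simp add: vec_eq_iff)
  show "Re (H w (\<i> *s X) (\<i> *s Y)) = Re (H w X Y)" for w X Y by (simp add: H_linear)
  show "\<Gamma> w X (\<i> *s Y) = \<i> *s \<Gamma> w X Y" for w X Y
    by (simp add: \<Gamma>_def hform_linear vec_eq_iff algebra_simps)
qed (rule rot_J_d\<Phi>)

text \<open>The plane contains the images of v and i v. They are independent over the reals because
  i is not real, and so they span it.\<close>

lemma J_invariant_plane_\<Phi>:
  assumes w: "w \<in> U" and E: "J_invariant_plane M (rot_J l t q I) (\<Phi> w) E"
    and v: "d\<Phi> w v \<in> E" "v \<noteq> 0"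
  shows "E = {d\<Phi> w (\<zeta> *s v) | \<zeta>. True}"
proof -
  have "subspace E" "dim E = 2" "rot_J l t q I (\<Phi> w) ` E \<subseteq> E"
    using E by (auto simp: J_invariant_plane_def tangent_plane_def)
  have iv: "d\<Phi> w (\<i> *s v) \<in> E"
    using v(1) \<open>rot_J l t q I (\<Phi> w) ` E \<subseteq> E\<close> rot_J_d\<Phi>[OF w, of v] by force
  have ne: "d\<Phi> w v \<noteq> 0" using d\<Phi>_eq_iff[OF w, of v 0] v(2) d\<Phi>_linear(4)[OF w] by simp
  have nin: "d\<Phi> w (\<i> *s v) \<notin> span {d\<Phi> w v}"
  proof
    assume "d\<Phi> w (\<i> *s v) \<in> span {d\<Phi> w v}"
    then obtain c where "d\<Phi> w (\<i> *s v) = d\<Phi> w (c *\<^sub>R v)"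
      by (auto simp: span_singleton d\<Phi>_linear(3)[OF w])
    hence c: "\<i> * v $ i = of_real c * v $ i" for i
      using d\<Phi>_eq_iff[OF w, of "\<i> *s v" "c *\<^sub>R v"] by (auto simp: vec_eq_iff scaleR_eq_scale)
    obtain i where "v $ i \<noteq> 0" using v(2) by (auto simp: vec_eq_iff)
    hence "\<i> = of_real c" using c[of i] by simp
    thus False by (simp add: complex_eq_iff)
  qed
  have "independent {d\<Phi> w (\<i> *s v), d\<Phi> w v}"
    using nin ne by (simp add: independent_insert span_base)
  moreover have "d\<Phi> w (\<i> *s v) \<noteq> d\<Phi> w v"
    using nin span_base[of "d\<Phi> w v" "{d\<Phi> w v}"] by auto
  hence "card {d\<Phi> w (\<i> *s v), d\<Phi> w v} = 2" by simp
  ultimately have "E \<subseteq> span {d\<Phi> w (\<i> *s v), d\<Phi> w v}"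
    using v(1) iv \<open>dim E = 2\<close> card_ge_dim_independent[of "{d\<Phi> w (\<i> *s v), d\<Phi> w v}" E] by simp
  moreover have "span {d\<Phi> w (\<i> *s v), d\<Phi> w v} \<subseteq> E"
    using v(1) iv \<open>subspace E\<close> by (intro span_minimal) auto
  ultimately have "E = span {d\<Phi> w v, d\<Phi> w (\<i> *s v)}" by (simp add: insert_commute)
  thus ?thesis using complex_line[OF w] by simp
qed

lemma subspace_angle_\<Phi>:
  assumes w: "w \<in> U" and E: "J_invariant_plane M (rot_J l t q I) (\<Phi> w) E"
    and v: "d\<Phi> w v \<in> E" "v \<noteq> 0"
  shows "(cos (subspace_angle (rot_g l t q I) (\<Phi> w) E (rot_D_perp l t q I (\<Phi> w))))\<^sup>2 = cos2 w v"
proof -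
  let ?g = "rot_g l t q I (\<Phi> w)"
  have w0: "w \<noteq> 0" using point_U[OF w] by (auto simp: nrm_def hform_def)
  have nz: "d\<Phi> w (\<zeta> *s y) = 0 \<longleftrightarrow> \<zeta> = 0" if "y \<noteq> 0" for \<zeta> y
    using d\<Phi>_eq_iff[OF w, of "\<zeta> *s y" 0] that by (auto simp: d\<Phi>_linear(4)[OF w] vec_eq_iff)
  have "{arccos (?g x y / (sqrt (?g x x) * sqrt (?g y y))) | x y. x \<in> E \<and> x \<noteq> 0 \<and> y \<in> rot_D_perp l t q I (\<Phi> w) \<and> y \<noteq> 0} =
    {arccos (?g (d\<Phi> w (\<zeta> *s v)) (d\<Phi> w (\<eta> *s w)) /
      (sqrt (?g (d\<Phi> w (\<zeta> *s v)) (d\<Phi> w (\<zeta> *s v))) * sqrt (?g (d\<Phi> w (\<eta> *s w)) (d\<Phi> w (\<eta> *s w))))) | \<zeta> \<eta>.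
      \<zeta> \<noteq> 0 \<and> \<eta> \<noteq> 0}"
    unfolding J_invariant_plane_\<Phi>[OF assms] rot_D_perp_\<Phi>[OF w] using nz[OF v(2)] nz[OF w0] by blast
  thus ?thesis
    unfolding subspace_angle_def using cos_subspace_angle[OF w v(2)] by (simp add: rot_g_d\<Phi>[OF w])
qed

lemma sectional_curvature_\<Phi>:
  assumes w: "w \<in> U" and E: "J_invariant_plane M (rot_J l t q I) (\<Phi> w) E"
  shows "sectional_curvature M (rot_g l t q I) nabla (\<Phi> w) E =
    hol_curv (nrm w) ((cos (subspace_angle (rot_g l t q I) (\<Phi> w) E (rot_D_perp l t q I (\<Phi> w))))\<^sup>2)"
proof -
  have dim: "dim E = 2" and sub: "E \<subseteq> range (d\<Phi> w)"
    using E w by (auto simp: J_invariant_plane_def tangent_plane_def tangent_space_M)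
  have "\<not> E \<subseteq> {0}" using dim dim_subset[of E "{0}"] by force
  then obtain v where v: "d\<Phi> w v \<in> E" "v \<noteq> 0" using sub d\<Phi>_linear(4)[OF w] by blast
  have E_eq: "E = span {d\<Phi> w v, d\<Phi> w (\<i> *s v)}"
    using J_invariant_plane_\<Phi>[OF w E v] complex_line[OF w] by simp
  show ?thesis
  proof (rule sectional_curvature_M[OF w E_eq])
    fix a b assume s: "span {d\<Phi> w a, d\<Phi> w b} = E"
    \<comment> \<open>Excludes degenerate bases: it forces a to be nonzero and the ratio \<omega> of
      b to a to be nonreal.\<close>
    have small: "span {x, c *\<^sub>R x} \<noteq> E" for x c
    proof
      assume "span {x, c *\<^sub>R x} = E"
      moreover have "span {x, c *\<^sub>R x} = span {x}"
        by (rule span_eq[THEN iffD2]) (auto intro: span_base span_scale)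
      moreover have "dim (span {x}) \<le> 1" using dim_le_card[of "{x}" "{x}"] span_superset by (simp add: dim_span)
      ultimately show False using dim by simp
    qed
    have a: "d\<Phi> w a \<in> E" using s span_base by blast
    have a0: "a \<noteq> 0"
    proof
      assume "a = 0"
      hence "span {d\<Phi> w b, 0 *\<^sub>R d\<Phi> w b} = E" using s by (simp add: d\<Phi>_linear(4)[OF w] insert_commute)
      thus False using small by blast
    qed
    have "d\<Phi> w b \<in> E" using s span_base by blast
    then obtain \<omega> where b: "b = \<omega> *s a"
      using J_invariant_plane_\<Phi>[OF w E a a0] d\<Phi>_eq_iff[OF w] by auto
    have "Im \<omega> \<noteq> 0"
    proof
      assume "Im \<omega> = 0"
      hence "\<omega> = of_real (Re \<omega>)" by (simp add: complex_eq_iff)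
      hence "b = Re \<omega> *\<^sub>R a" unfolding b by (metis scaleR_eq_scale)
      thus False using s small by (simp add: d\<Phi>_linear(3)[OF w])
    qed
    from holomorphic_sectional_curvature[OF w a0 this]
    show "Re (H w (curv w a b b) a) / (Re (H w a a) * Re (H w b b) - (Re (H w a b))\<^sup>2) =
        hol_curv (nrm w) ((cos (subspace_angle (rot_g l t q I) (\<Phi> w) E (rot_D_perp l t q I (\<Phi> w))))\<^sup>2)"
      unfolding curv_def b subspace_angle_\<Phi>[OF w E a a0] .
  qed
qed

lemma quasi_constant:
  "quasi_constant_hol_sec_curv M (rot_g l t q I) (rot_J l t q I) (rot_D_perp l t q I) nabla"
  unfolding quasi_constant_hol_sec_curv_def
  by (rule exI[of _ "\<lambda>p \<theta>. hol_curv (nrm (\<Psi> p)) ((cos \<theta>)\<^sup>2)"])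
    (auto simp: sectional_curvature_\<Phi> \<Psi>_\<Phi>)

text \<open>A plane in \<open>rot_D\<close> has \<open>cos2\<close> equal to 0, where
  \<open>hol_curv\<close> reduces to - 4 \<alpha> / A.\<close>

lemma sectional_curvature_D:
  assumes w: "w \<in> U" and E: "J_invariant_plane M (rot_J l t q I) (\<Phi> w) E" and D: "E \<subseteq> rot_D l t q I (\<Phi> w)"
  shows "sectional_curvature M (rot_g l t q I) nabla (\<Phi> w) E =
    4 * (deriv t (\<phi> (nrm w)) - 1) / (t (\<phi> (nrm w)))\<^sup>2"
proof -
  have dim: "dim E = 2"
    using E by (auto simp: J_invariant_plane_def tangent_plane_def)
  have "\<not> E \<subseteq> {0}" using dim dim_subset[of E "{0}"] by force
  then obtain v where v: "d\<Phi> w v \<in> E" "v \<noteq> 0" "hform l v w = 0"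
    using D d\<Phi>_linear(4)[OF w] unfolding rot_D_\<Phi>[OF w] by blast
  have "cos2 w v = 0" by (simp add: cos2_eq[OF w v(2)] v(3))
  hence "sectional_curvature M (rot_g l t q I) nabla (\<Phi> w) E = hol_curv (nrm w) 0"
    using sectional_curvature_\<Phi>[OF w E] subspace_angle_\<Phi>[OF w E v(1,2)] by simp
  also have "\<dots> = - 4 * (\<alpha> (nrm w) / A (nrm w))"
    by (simp add: hol_curv_def)
  also have "\<alpha> (nrm w) / A (nrm w) = (1 - deriv t (\<phi> (nrm w))) / (t (\<phi> (nrm w)))\<^sup>2"
    using point_U(5)[OF w] by (simp add: A_def \<alpha>_def)
  finally show ?thesis by (simp add: divide_simps)
qed

text \<open>In the chart \<xi> is c w with c a function of u. For h(v, w) = 0 the derivative of c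
  vanishes, leaving c v, and \<open>\<Gamma>\<close> contributes - c \<alpha> u v; together this is
  c (1 - \<alpha> u) v = c t' v.\<close>

lemma cov_deriv_xi:
  assumes w: "w \<in> U" and x: "x \<in> rot_D l t q I (\<Phi> w)"
  shows "cov_deriv_at M nabla (\<Phi> w) x (rot_xi l t q I) =
    (\<xi>_coeff (\<phi> (nrm w)) * deriv t (\<phi> (nrm w))) *\<^sub>R x"
proof -
  obtain v where v: "x = d\<Phi> w v" "hform l v w = 0" using x unfolding rot_D_\<Phi>[OF w] by blast
  define c where "c w = \<xi>_coeff (\<phi> (nrm w))" for w
  have c: "smooth_on c U" unfolding c_def
    by (rule smooth_on_compose_nrm[OF smooth_on_\<phi>_compose[OF smooth_\<xi>_coeff]])
  have "smooth_on (\<lambda>w. c w *\<^sub>R w) U" by (intro smooth_on_scaleR c smooth_on_ident open_U)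
  from vector_fieldI[OF this rot_xi_\<Phi>[folded c_def]]
  have xi: "rot_xi l t q I \<in> vector_fields M" "\<And>y. y \<in> U \<Longrightarrow> coord (rot_xi l t q I) y = c y *\<^sub>R y" by auto
  have "(c has_derivative (\<lambda>v. deriv \<xi>_coeff (\<phi> (nrm w)) * (- t (\<phi> (nrm w)) * Re (hform l v w) / nrm w))) (at w)"
    unfolding c_def
    by (rule compose_s_has_derivative[OF w smooth_on_deriv(1)[OF open_I smooth_\<xi>_coeff point_U(1)[OF w]]])
  from has_derivative_scaleR[OF this has_derivative_ident]
  have "(coord (rot_xi l t q I) has_derivative (\<lambda>v. c w *\<^sub>R v +
      (deriv \<xi>_coeff (\<phi> (nrm w)) * (- t (\<phi> (nrm w)) * Re (hform l v w) / nrm w)) *\<^sub>R w)) (at w)"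
    by (rule has_derivative_transform_within_open[OF _ open_U w]) (simp add: xi)
  from frechet_derivative_at[OF this, symmetric]
  have "frechet_derivative (coord (rot_xi l t q I)) (at w) v = c w *\<^sub>R v" by (simp add: v(2))
  moreover have "\<Gamma> w v (c w *\<^sub>R w) = - (c w * (\<alpha> (nrm w) * nrm w)) *\<^sub>R v"
    unfolding \<Gamma>_def scaleR_eq_scale by (simp add: v(2) hform_scale_left hform_nrm vec_eq_iff)
  moreover have "c w *\<^sub>R v + (- (c w * (\<alpha> (nrm w) * nrm w))) *\<^sub>R v = (c w * (1 - \<alpha> (nrm w) * nrm w)) *\<^sub>R v"
    by (simp add: algebra_simps)
  ultimately show ?thesis
    using w by (simp add: v(1) cov_deriv_at_M[OF xi(1) w] xi(2) one_minus_\<alpha> in_U_iff c_def d\<Phi>_linear(3)[OF w])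
qed

end

theorem theorem6p11:
  fixes l :: "'n::finite"
    and t q :: "real \<Rightarrow> real"
    and I :: "real set"
    and nabla :: "((complex ^ 'n) \<times> real \<Rightarrow> (complex ^ 'n) \<times> real) \<Rightarrow>
                  ((complex ^ 'n) \<times> real \<Rightarrow> (complex ^ 'n) \<times> real) \<Rightarrow>
                  (complex ^ 'n) \<times> real \<Rightarrow> (complex ^ 'n) \<times> real"
  assumes dim: "CARD('n) \<ge> 2"
    and interval: "open I" "is_interval I"
    and smooth: "smooth_on t I" "smooth_on q I"
    and t_pos: "\<forall>s\<in>I. t s > 0"
    and type_III: "spacelike_normals l (rot_hypersurface l t q I)"
    and natural_param: "\<forall>s\<in>I. - (deriv t s)\<^sup>2 + (deriv q s)\<^sup>2 = - 1"
    and t'_le: "\<forall>s\<in>I. deriv t s \<le> - 1"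
    and nabla: "levi_civita (rot_hypersurface l t q I) (rot_g l t q I) nabla"
  shows "kaehler_metric (rot_hypersurface l t q I) (rot_g l t q I) (rot_J l t q I) nabla \<and>
    quasi_constant_hol_sec_curv (rot_hypersurface l t q I) (rot_g l t q I) (rot_J l t q I)
      (rot_D_perp l t q I) nabla \<and>
    (\<exists>a k :: (complex ^ 'n) \<times> real \<Rightarrow> real. \<forall>p\<in>rot_hypersurface l t q I.
       (\<forall>E. J_invariant_plane (rot_hypersurface l t q I) (rot_J l t q I) p E \<and>
            E \<subseteq> rot_D l t q I p \<longrightarrow>
          sectional_curvature (rot_hypersurface l t q I) (rot_g l t q I) nabla p E = a p) \<and>
       (\<forall>x\<in>rot_D l t q I p.
          cov_deriv_at (rot_hypersurface l t q I) nabla p x (rot_xi l t q I) = (k p / 2) *\<^sub>R x) \<and>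
       a p < 0 \<and> a p + (k p)\<^sup>2 < 0)"
proof -
  have t: "smooth_on (\<lambda>s. 1 / t s) I"
    using t_pos by (intro smooth_on_divide smooth_on_const smooth interval) force
  from antiderivative_on_interval[OF interval smooth_on_imp_continuous_on[OF t]]
  obtain R where R: "\<And>s. s \<in> I \<Longrightarrow> (R has_real_derivative 1 / t s) (at s)" by blast
  have smooth_R: "smooth_on R I"
    by (rule smooth_on_antiderivative[OF interval(1) R t])
  \<comment> \<open>The equation r' = r / t says that log r is an antiderivative of 1 / t; the
    exponential also gives positivity.\<close>
  define r where "r s = exp (R s)" for s
  have smooth_exp: "smooth_on exp (UNIV :: real set)"
    by (rule smooth_on_ode[OF open_UNIV open_UNIV _ smooth_on_ident]) (auto intro: DERIV_exp)
  interpret rot_connection l t q r I nabla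
  proof
    show "smooth_on r I" unfolding r_def
      by (rule smooth_on_compose[OF interval(1) open_UNIV _ smooth_exp smooth_R]) auto
    show "(r has_real_derivative r s / t s) (at s)" if "s \<in> I" for s
      unfolding r_def by (rule derivative_eq_intros R that refl)+ simp
  qed (use assms in \<open>auto simp: r_def\<close>)
  define a where "a p = 4 * (deriv t (\<phi> (nrm (\<Psi> p))) - 1) / (t (\<phi> (nrm (\<Psi> p))))\<^sup>2" for p
  \<comment> \<open>Twice the factor found for the covariant derivative of \<xi>; its value is - 2
    sqrt (- t') / t, the negative root of - 4 t' / t^2.\<close>
  define k where "k p = 2 * (\<xi>_coeff (\<phi> (nrm (\<Psi> p))) * deriv t (\<phi> (nrm (\<Psi> p))))" for p
  have "(\<forall>E. J_invariant_plane M (rot_J l t q I) p E \<and> E \<subseteq> rot_D l t q I p \<longrightarrow>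
          sectional_curvature M (rot_g l t q I) nabla p E = a p) \<and>
       (\<forall>x\<in>rot_D l t q I p. cov_deriv_at M nabla p x (rot_xi l t q I) = (k p / 2) *\<^sub>R x) \<and>
       a p < 0 \<and> a p + (k p)\<^sup>2 < 0" if p: "p \<in> M" for p
  proof -
    obtain w where w: "w \<in> U" "p = \<Phi> w" using p by blast
    define s where "s = \<phi> (nrm w)"
    have s: "s \<in> I" "t s > 0" "deriv t s < 0" using point_U[OF w(1)] by (auto simp: s_def)
    have a: "a p = 4 * (deriv t s - 1) / (t s)\<^sup>2" and k: "k p = 2 * (\<xi>_coeff s * deriv t s)"
      by (simp_all add: a_def k_def w(2) \<Psi>_\<Phi>[OF w(1)] s_def)
    have "a p < 0" unfolding a using s by (simp add: divide_neg_pos)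
    moreover have "(k p)\<^sup>2 = 4 * - deriv t s / (t s)\<^sup>2"
      unfolding k \<xi>_coeff_def using s by (simp add: power_mult_distrib power_inverse field_simps power2_eq_square)
    hence "a p + (k p)\<^sup>2 = - 4 / (t s)\<^sup>2"
      unfolding a by (simp add: algebra_simps flip: add_divide_distrib diff_divide_distrib)
    hence "a p + (k p)\<^sup>2 < 0" using s by (simp add: divide_neg_pos)
    ultimately show ?thesis
      using sectional_curvature_D[OF w(1), folded s_def w(2)] cov_deriv_xi[OF w(1), folded s_def w(2)]
      by (simp add: a k)
  qed
  thus ?thesis
    unfolding rot_hypersurface_eq using kaehler quasi_constant by blast
qed

end
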